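(* Consider the unknown-scale model with softplus-reparametrized scale described in the context. Suppose $k_n\sim n^a$ for some $a\in(0,1/2)$, and that for some $0\le\delta<1-a$: (A1) for each $n$ there is $\theta_{0n}=(\theta_{10n},\dots,\theta_{K(n)0n})$ with $\|f_{\theta_{0n}}-f_0\|_2=o(n^{-\delta})$; (A2) $\sum_{i=1}^{K(n)}\theta_{i0n}^2=o(n^{1-\delta})$. Then for every $\varepsilon>0$, $\pi^*(\mathcal V_\varepsilon^c)=o_{P_0^n}(n^{-\delta})$.
   Context: Data: i.i.d. pairs $(y_i,\mathbf x_i)$, $i=1,\dots,n$, with $\mathbf x_i\sim\mathrm{Uniform}[0,1]^p$ ($p$ fixed), $y_i=f_0(\mathbf x_i)+\xi_i$, $\xi_i\sim N(0,\sigma_0^2)$ independent of $\mathbf x_i$, $f_0$ square integrable, $\sigma_0>0$ unknown. $P_0^n$ is the true data law; $Z_n=o_{P_0^n}(r_n)$ means $Z_n/r_n\to0$ in $P_0^n$-probability; $\|\cdot\|_2$ is the $L_2([0,1]^p)$ norm. $\psi(u)=1/(1+e^{-u})$, $f_{\theta_n}(\mathbf x)=\beta_0+\sum_{j=1}^{k_n}\beta_j\psi(\gamma_{j0}+\sum_{h=1}^p\gamma_{jh}x_h)$, $\theta_n=(\theta_{1n},\dots,\theta_{K(n)n})$ all parameters, $K(n)$ their number. Parameter $\omega_n=(\theta_n,\rho)$ with $\sigma_\rho=\log(1+e^\rho)$; model density $l_{\omega_n}(y,\mathbf x)=(2\pi\sigma_\rho^2)^{-1/2}\exp(-(y-f_{\theta_n}(\mathbf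 x))^2/(2\sigma_\rho^2))$; $l_0$ the same with $f_0,\sigma_0$; $L(\omega_n)=\prod_{i=1}^nl_{\omega_n}(y_i,\mathbf x_i)$. Prior $p(\omega_n)=(2\pi\eta^2)^{-1/2}e^{-\rho^2/(2\eta^2)}\prod_{i=1}^{K(n)}(2\pi\zeta^2)^{-1/2}e^{-\theta_{in}^2/(2\zeta^2)}$ with fixed $\eta,\zeta>0$. Posterior $\pi(\omega_n|\mathbf y_n,\mathbf X_n)\propto L(\omega_n)p(\omega_n)$. $d_{KL}(q,p)=\int q\log(q/p)$. Variational family $\mathcal Q_n$: product densities $N(\rho;\tilde m_{0n},\tilde s_{0n}^2)\prod_{i=1}^{K(n)}N(\theta_{in};\tilde m_{in},\tilde s_{in}^2)$; $\pi^*=\arg\min_{q\in\mathcal Q_n}d_{KL}(q,\pi(\cdot|\mathbf y_n,\mathbf X_n))$. $d_H(l_0,l_{\omega_n})=\int\int(\sqrt{l_{\omega_n}}-\sqrt{l_0})^2dy\,d\mathbf x$, $\mathcal V_\varepsilon=\{\omega_n:d_H(l_0,l_{\omega_n})<\varepsilon\}$. *)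

theory Defs
  imports "HOL-Probability.Probability" "HOL-Library.Landau_Symbols"
begin

definition cube_unif :: "nat \<Rightarrow> (nat \<Rightarrow> real) measure" where
  "cube_unif p = PiM {..<p} (\<lambda>_. uniform_measure lborel {0..1::real})"

definition sigmoid :: "real \<Rightarrow> real" where
  "sigmoid u = 1 / (1 + exp (- u))"

definition softplus :: "real \<Rightarrow> real" where
  "softplus \<rho> = ln (1 + exp \<rho>)"

definition nparam :: "nat \<Rightarrow> nat \<Rightarrow> nat" where
  "nparam p k = 1 + k * (p + 2)"

text \<open>Network f_theta with k hidden nodes; theta indexed by {..< nparam p k}:
  theta 0 = beta_0, theta (1+j) = beta_(j+1), theta (1+k+j(p+1)) = gamma_(j+1)0,
  theta (1+k+j(p+1)+1+h) = gamma_(j+1)(h+1).\<close>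
definition net :: "nat \<Rightarrow> nat \<Rightarrow> (nat \<Rightarrow> real) \<Rightarrow> (nat \<Rightarrow> real) \<Rightarrow> real" where
  "net p k \<theta> x = \<theta> 0 + (\<Sum>j<k. \<theta> (1 + j) *
      sigmoid (\<theta> (1 + k + j * (p + 1)) + (\<Sum>h<p. \<theta> (1 + k + j * (p + 1) + 1 + h) * x h)))"

text \<open>Parameter omega :: nat => real on {..K}: omega 0 = rho, omega (i+1) = theta_i (i < K).\<close>
definition theta_of :: "(nat \<Rightarrow> real) \<Rightarrow> nat \<Rightarrow> real" where
  "theta_of \<omega> = (\<lambda>i. \<omega> (Suc i))"

definition param_space :: "nat \<Rightarrow> nat \<Rightarrow> (nat \<Rightarrow> real) measure" where
  "param_space p k = PiM {..nparam p k} (\<lambda>_. lborel)"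

definition model_dens :: "nat \<Rightarrow> nat \<Rightarrow> (nat \<Rightarrow> real) \<Rightarrow> real \<times> (nat \<Rightarrow> real) \<Rightarrow> real" where
  "model_dens p k \<omega> z = normal_density (net p k (theta_of \<omega>) (snd z)) (softplus (\<omega> 0)) (fst z)"

definition true_dens :: "((nat \<Rightarrow> real) \<Rightarrow> real) \<Rightarrow> real \<Rightarrow> real \<times> (nat \<Rightarrow> real) \<Rightarrow> real" where
  "true_dens f0 \<sigma>0 z = normal_density (f0 (snd z)) \<sigma>0 (fst z)"

definition P0 :: "nat \<Rightarrow> ((nat \<Rightarrow> real) \<Rightarrow> real) \<Rightarrow> real \<Rightarrow> (real \<times> (nat \<Rightarrow> real)) measure" where
  "P0 p f0 \<sigma>0 = density (lborel \<Otimes>\<^sub>M cube_unif p) (\<lambda>z. ennreal (true_dens f0 \<sigma>0 z))"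

definition P0n :: "nat \<Rightarrow> ((nat \<Rightarrow> real) \<Rightarrow> real) \<Rightarrow> real \<Rightarrow> nat \<Rightarrow> (nat \<Rightarrow> real \<times> (nat \<Rightarrow> real)) measure" where
  "P0n p f0 \<sigma>0 n = PiM {..<n} (\<lambda>_. P0 p f0 \<sigma>0)"

definition lik :: "nat \<Rightarrow> nat \<Rightarrow> nat \<Rightarrow> (nat \<Rightarrow> real \<times> (nat \<Rightarrow> real)) \<Rightarrow> (nat \<Rightarrow> real) \<Rightarrow> real" where
  "lik p k n D \<omega> = (\<Prod>i<n. model_dens p k \<omega> (D i))"

definition prior_dens :: "nat \<Rightarrow> nat \<Rightarrow> real \<Rightarrow> real \<Rightarrow> (nat \<Rightarrow> real) \<Rightarrow> real" where
  "prior_dens p k \<eta> \<zeta> \<omega> = normal_density 0 \<eta> (\<omega> 0) * (\<Prod>i\<in>{1..nparam p k}. normal_density 0 \<zeta> (\<omega> i))"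

definition post_dens :: "nat \<Rightarrow> nat \<Rightarrow> real \<Rightarrow> real \<Rightarrow> nat \<Rightarrow> (nat \<Rightarrow> real \<times> (nat \<Rightarrow> real)) \<Rightarrow> (nat \<Rightarrow> real) \<Rightarrow> real" where
  "post_dens p k \<eta> \<zeta> n D \<omega> = lik p k n D \<omega> * prior_dens p k \<eta> \<zeta> \<omega> /
     integral\<^sup>L (param_space p k) (\<lambda>w. lik p k n D w * prior_dens p k \<eta> \<zeta> w)"

definition vdens :: "nat \<Rightarrow> nat \<Rightarrow> (nat \<Rightarrow> real) \<Rightarrow> (nat \<Rightarrow> real) \<Rightarrow> (nat \<Rightarrow> real) \<Rightarrow> real" where
  "vdens p k m s \<omega> = (\<Prod>i\<in>{..nparam p k}. normal_density (m i) (s i) (\<omega> i))"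

definition vmeasure :: "nat \<Rightarrow> nat \<Rightarrow> (nat \<Rightarrow> real) \<Rightarrow> (nat \<Rightarrow> real) \<Rightarrow> (nat \<Rightarrow> real) measure" where
  "vmeasure p k m s = density (param_space p k) (\<lambda>\<omega>. ennreal (vdens p k m s \<omega>))"

definition dKL :: "'a measure \<Rightarrow> ('a \<Rightarrow> real) \<Rightarrow> ('a \<Rightarrow> real) \<Rightarrow> ereal" where
  "dKL M q r = (if integrable M (\<lambda>\<omega>. q \<omega> * ln (q \<omega> / r \<omega>))
                then ereal (integral\<^sup>L M (\<lambda>\<omega>. q \<omega> * ln (q \<omega> / r \<omega>))) else \<infinity>)"

definition vb_minimizer :: "nat \<Rightarrow> nat \<Rightarrow> real \<Rightarrow> real \<Rightarrow> nat \<Rightarrow> (nat \<Rightarrow> real \<times> (nat \<Rightarrow> real))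
     \<Rightarrow> (nat \<Rightarrow> real) \<Rightarrow> (nat \<Rightarrow> real) \<Rightarrow> bool" where
  "vb_minimizer p k \<eta> \<zeta> n D m s \<longleftrightarrow>
     (\<forall>i\<le>nparam p k. s i > 0) \<and>
     (\<forall>m' s'. (\<forall>i\<le>nparam p k. s' i > 0) \<longrightarrow>
        dKL (param_space p k) (vdens p k m s) (post_dens p k \<eta> \<zeta> n D)
        \<le> dKL (param_space p k) (vdens p k m' s') (post_dens p k \<eta> \<zeta> n D))"

definition hellinger :: "nat \<Rightarrow> nat \<Rightarrow> ((nat \<Rightarrow> real) \<Rightarrow> real) \<Rightarrow> real \<Rightarrow> (nat \<Rightarrow> real) \<Rightarrow> real" where
  "hellinger p k f0 \<sigma>0 \<omega> = integral\<^sup>L (lborel \<Otimes>\<^sub>M cube_unif p)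
      (\<lambda>z. (sqrt (model_dens p k \<omega> z) - sqrt (true_dens f0 \<sigma>0 z))\<^sup>2)"

definition L2norm :: "nat \<Rightarrow> ((nat \<Rightarrow> real) \<Rightarrow> real) \<Rightarrow> real" where
  "L2norm p g = sqrt (integral\<^sup>L (cube_unif p) (\<lambda>x. (g x)\<^sup>2))"

text \<open>Outer probability (so that o_P makes sense without measurability side conditions).\<close>
definition outer_prob :: "'a measure \<Rightarrow> 'a set \<Rightarrow> real" where
  "outer_prob M A = Inf {measure M B | B. B \<in> sets M \<and> A \<subseteq> B}"

definition small_o_P :: "(nat \<Rightarrow> 'a measure) \<Rightarrow> (nat \<Rightarrow> 'a \<Rightarrow> real) \<Rightarrow> (nat \<Rightarrow> real) \<Rightarrow> bool" where
  "small_o_P P Z r \<longleftrightarrow>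
     (\<forall>c>0. (\<lambda>n. outer_prob (P n) {D \<in> space (P n). \<bar>Z n D\<bar> > c * r n}) \<longlonglongrightarrow> 0)"

end

theory Submission
  imports Defs "HOL-Real_Asymp.Real_Asymp"
begin

text \<open>
  Let w be the likelihood ratio of the model against the truth times the prior. By the inequality
  ln x \<le> x - 1, a minimiser q* of the variational objective satisfies, for every member q of the
  family, every set A and every t \<ge> 0,
    t q*(A) \<le> E_q |ln (q / w)| + (integral of w) + e^t (integral of w over A).
  Take t = c n, A the complement of the Hellinger ball, and q a product of normal densities of
  standard deviation n^-3 around the approximating network and the true scale. The first term has
  expectation o(n^(1 - delta)) and the second has expectation 1. For the third, a Wald argument
  applies: on the sieve of parameters bounded by R = O(sqrt n), the model densities lie below
  exp (O(n^(a + 1/2) + n^a log n)) = exp (o(n)) upper brackets, each a slightly widened model density, and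
  Markov's inequality for the square root of the bracketed likelihood ratio gives exponentially
  small bounds; off the sieve, the prior mass is O(n^a e^(-2n)). Restricting the log-scale
  parameter to O(sqrt n) is what requires a < 1/2, since the brackets must resolve scales as small
  as e^(-R).
\<close>

subsection \<open>Sigmoid, softplus and normal densities\<close>

text \<open>The minimiser is an arbitrary function of the data, known only through its minimality,
  so randomness is controlled in terms that do not contain it: Markov's inequality is applied to the
  right side of the variational inequality. It wants nonnegative terms, hence |ln (q / w)| instead
  of the signed integrand. This has a price: the product of noise and approximation error no longer
  averages to zero, and a Kullback-Leibler cost of order r^2, with r the norm in (A1), becomes one
  of order r. The rate in (A1) is just what this allows: n r is o(n^(1 - \<delta>)), and division by
  t = c n returns n^(-\<delta>). The standard deviation n^-3 comes from crude counting: K = O(n),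
  parameters O(sqrt n) and a Young weight of at least 1/n make the perturbation cost O(n^6 s^2).
  Small s costs O(ln n) per parameter, in all O(n^a ln n), which is where \<delta> < 1 - a enters.
  The radius of order sqrt n is forced from below: the Gaussian tail e^(-const R^2) must beat
  e^t.\<close>

lemma lipschitz_one_if_deriv_le_one:
  fixes f :: "real \<Rightarrow> real"
  assumes "\<And>x. (f has_real_derivative f' x) (at x)" "\<And>x. \<bar>f' x\<bar> \<le> 1"
  shows "\<bar>f x - f y\<bar> \<le> \<bar>x - y\<bar>"
proof -
  have "norm (f x - f y) \<le> 1 * norm (x - y)"
    by (rule field_differentiable_bound[where S=UNIV and f'=f'])
      (use assms in auto)
  then show ?thesis by simp
qed

lemma one_plus_exp_neq_0: "1 + exp x \<noteq> (0 :: real)"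
  by (metis add_pos_pos exp_gt_zero less_irrefl zero_less_one)

lemma sigmoid_bounds: "0 \<le> sigmoid u" "sigmoid u \<le> 1"
  by (auto simp: sigmoid_def field_simps add_pos_pos)

lemma sigmoid_lipschitz: "\<bar>sigmoid u - sigmoid v\<bar> \<le> \<bar>u - v\<bar>"
proof (rule lipschitz_one_if_deriv_le_one)
  fix x :: real
  show "(sigmoid has_real_derivative exp (- x) / (1 + exp (- x))\<^sup>2) (at x)"
    unfolding sigmoid_def [abs_def]
    using one_plus_exp_neq_0[of "- x"]
    by (auto intro!: derivative_eq_intros simp: power2_eq_square)
  have "exp (-x) \<le> (1 + exp (-x))\<^sup>2"
    by (simp add: power2_eq_square algebra_simps)
  then show "\<bar>exp (- x) / (1 + exp (- x))\<^sup>2\<bar> \<le> 1"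
    by (simp add: divide_le_eq_1 add_pos_pos)
qed

lemma borel_measurable_sigmoid [measurable]: "sigmoid \<in> borel_measurable borel"
  unfolding sigmoid_def [abs_def] by measurable

lemma borel_measurable_softplus [measurable]: "softplus \<in> borel_measurable borel"
  unfolding softplus_def [abs_def] by measurable

lemma softplus_pos [simp]: "softplus \<rho> > 0"
  by (simp add: softplus_def ln_gt_zero)

text \<open>This is ln x \<le> x - 1 at x = 1 / (1 + e^\<rho>). The right side is the derivative of
  \<open>softplus\<close>, so the logarithmic derivative is at most 1; for \<rho> \<le> 0 it also
  keeps the scale above a multiple of e^\<rho>.\<close>

lemma softplus_ge: "softplus \<rho> \<ge> exp \<rho> / (1 + exp \<rho>)"
proof -
  have "ln (1 / (1 + exp \<rho>)) \<le> 1 / (1 + exp \<rho>) - 1"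
    by (rule ln_le_minus_one) (simp add: add_pos_pos)
  moreover have "1 / (1 + exp \<rho>) - 1 = - (exp \<rho> / (1 + exp \<rho>))"
    using one_plus_exp_neq_0[of \<rho>] by (simp add: field_simps)
  moreover have "ln (1 / (1 + exp \<rho>)) = - softplus \<rho>"
    using one_plus_exp_neq_0[of \<rho>] by (simp add: softplus_def ln_div)
  ultimately show ?thesis by linarith
qed

text \<open>Steps in \<rho> act on the scale as multiplicative errors, uniformly even where the
  scale tends to 0. The brackets need this relative accuracy; a Lipschitz bound for
  \<open>softplus\<close> itself would not give it.\<close>

lemma ln_softplus_lipschitz: "\<bar>ln (softplus u) - ln (softplus v)\<bar> \<le> \<bar>u - v\<bar>"
proof (rule lipschitz_one_if_deriv_le_one)
  fix x :: real
  have pos: "1 + exp x > 0" by (simp add: add_pos_pos)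
  show "((\<lambda>x. ln (softplus x)) has_real_derivative exp x / (1 + exp x) / softplus x) (at x)"
    unfolding softplus_def [abs_def]
    using pos softplus_pos[of x, unfolded softplus_def]
    by (auto intro!: derivative_eq_intros)
  have "exp x / (1 + exp x) / softplus x \<ge> 0"
    using softplus_pos[of x] pos by (intro divide_nonneg_nonneg) (auto intro: less_imp_le)
  moreover have "exp x / (1 + exp x) / softplus x \<le> 1"
    using softplus_ge[of x] softplus_pos[of x] by (subst divide_le_eq_1) auto
  ultimately show "\<bar>exp x / (1 + exp x) / softplus x\<bar> \<le> 1"
    by linarith
qed

lemma softplus_ratio: "softplus u \<le> softplus v * exp \<bar>u - v\<bar>"
proof -
  have "ln (softplus u) \<le> ln (softplus v) + \<bar>u - v\<bar>"
    using ln_softplus_lipschitz[of u v] by linarith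
  then have "exp (ln (softplus u)) \<le> exp (ln (softplus v) + \<bar>u - v\<bar>)"
    by (simp only: exp_le_cancel_iff)
  then show ?thesis by (simp add: exp_add)
qed

text \<open>Some \<rho> attains the true scale, so a member of the variational family can be centred
  on it.\<close>

lemma softplus_surj:
  assumes "\<sigma> > 0"
  shows "softplus (ln (exp \<sigma> - 1)) = \<sigma>"
  using assms by (simp add: softplus_def)

lemma softplus_ge_half_exp:
  assumes "\<rho> \<le> 0"
  shows "softplus \<rho> \<ge> exp \<rho> / 2"
proof -
  have "exp \<rho> \<le> 1" using assms by simp
  then have "exp \<rho> / 2 \<le> exp \<rho> / (1 + exp \<rho>)"
    by (intro divide_left_mono) (auto simp: add_pos_pos)
  with softplus_ge[of \<rho>] show ?thesis by linarith
qed

lemma softplus_mono: "u \<le> v \<Longrightarrow> softplus u \<le> softplus v"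
  by (simp add: softplus_def add_pos_pos)

section \<open>Lipschitz dependence of the network on its parameters\<close>

lemma nparam_weight_index:
  assumes "j < k" "h \<le> p"
  shows "1 + k + j * (p + 1) + h < nparam p k"
proof -
  have "(j + 1) * (p + 1) \<le> k * (p + 1)"
    using assms by (intro mult_right_mono) auto
  then show ?thesis using assms by (simp add: nparam_def algebra_simps)
qed

text \<open>Inputs in the unit cube let each preactivation move by at most (p + 1) \<tau>, and
  \<open>sigmoid\<close> is bounded by 1 and 1-Lipschitz. Only the reference \<theta>' carries a
  size bound, so \<theta> may be a random perturbation with unbounded range. The crude constant is
  harmless: it enters the entropy through a logarithm and the competitor's cost next to s^2.\<close>

lemma net_lipschitz:
  assumes x: "\<And>h. h < p \<Longrightarrow> 0 \<le> x h \<and> x h \<le> 1"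
    and d: "\<And>i. i < nparam p k \<Longrightarrow> \<bar>\<theta> i - \<theta>' i\<bar> \<le> \<tau>"
    and B: "\<And>i. i < nparam p k \<Longrightarrow> \<bar>\<theta>' i\<bar> \<le> B"
  shows "\<bar>net p k \<theta> x - net p k \<theta>' x\<bar> \<le> real (nparam p k) * (1 + B) * \<tau>"
proof -
  define u where "u = (\<lambda>\<theta> j. \<theta> (1 + k + j * (p + 1)) + (\<Sum>h<p. \<theta> (1 + k + j * (p + 1) + 1 + h) * x h) :: real)"
  have K0: "0 < nparam p k" by (simp add: nparam_def)
  have \<tau>: "0 \<le> \<tau>" using d[OF K0] by linarith
  have B0: "0 \<le> B" using B[OF K0] by linarith
  have u_diff: "\<bar>u \<theta> j - u \<theta>' j\<bar> \<le> real (p + 1) * \<tau>" if "j < k" for j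
  proof -
    have "\<bar>u \<theta> j - u \<theta>' j\<bar> = \<bar>(\<theta> (1 + k + j * (p + 1)) - \<theta>' (1 + k + j * (p + 1)))
      + (\<Sum>h<p. (\<theta> (1 + k + j * (p + 1) + 1 + h) - \<theta>' (1 + k + j * (p + 1) + 1 + h)) * x h)\<bar>"
      by (simp add: u_def sum_subtractf algebra_simps)
    also have "\<dots> \<le> \<tau> + (\<Sum>h<p. \<tau>)"
    proof (rule order.trans[OF abs_triangle_ineq], rule add_mono)
      show "\<bar>\<theta> (1 + k + j * (p + 1)) - \<theta>' (1 + k + j * (p + 1))\<bar> \<le> \<tau>"
        using nparam_weight_index[OF that, of 0 p] by (intro d) simp
      show "\<bar>\<Sum>h<p. (\<theta> (1 + k + j * (p + 1) + 1 + h) - \<theta>' (1 + k + j * (p + 1) + 1 + h)) * x h\<bar> \<le> (\<Sum>h<p. \<tau>)"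
      proof (rule order.trans[OF sum_abs], rule sum_mono)
        fix h assume "h \<in> {..<p}"
        then have h: "h < p" by simp
        have "\<bar>\<theta> (1 + k + j * (p + 1) + 1 + h) - \<theta>' (1 + k + j * (p + 1) + 1 + h)\<bar> \<le> \<tau>"
          using nparam_weight_index[OF that, of "1 + h" p] h by (intro d) simp
        then show "\<bar>(\<theta> (1 + k + j * (p + 1) + 1 + h) - \<theta>' (1 + k + j * (p + 1) + 1 + h)) * x h\<bar> \<le> \<tau>"
          unfolding abs_mult using x[OF h] \<tau>
          by (smt (verit, best) mult_left_le mult_nonneg_nonneg)
      qed
    qed
    also have "\<dots> = real (p + 1) * \<tau>" by (simp add: algebra_simps)
    finally show ?thesis .
  qed
  have summand: "\<bar>\<theta> (1 + j) * sigmoid (u \<theta> j) - \<theta>' (1 + j) * sigmoid (u \<theta>' j)\<bar>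
      \<le> \<tau> + B * (real (p + 1) * \<tau>)" if j: "j < k" for j
  proof -
    have idx: "1 + j < nparam p k"
    proof -
      have "k * 1 \<le> k * (p + 2)" by (intro mult_left_mono) auto
      then show ?thesis using j by (simp add: nparam_def)
    qed
    \<comment> \<open>The splitting puts \<theta>', not \<theta>, next to the difference of
      sigmoids, where the bound B is available.\<close>
    have "\<theta> (1 + j) * sigmoid (u \<theta> j) - \<theta>' (1 + j) * sigmoid (u \<theta>' j)
      = (\<theta> (1 + j) - \<theta>' (1 + j)) * sigmoid (u \<theta> j) + \<theta>' (1 + j) * (sigmoid (u \<theta> j) - sigmoid (u \<theta>' j))"
      by (simp add: algebra_simps)
    also have "\<bar>\<dots>\<bar> \<le> \<bar>\<theta> (1 + j) - \<theta>' (1 + j)\<bar> * \<bar>sigmoid (u \<theta> j)\<bar>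
        + \<bar>\<theta>' (1 + j)\<bar> * \<bar>sigmoid (u \<theta> j) - sigmoid (u \<theta>' j)\<bar>"
      by (metis abs_mult abs_triangle_ineq)
    also have "\<dots> \<le> \<tau> * 1 + B * (real (p + 1) * \<tau>)"
      using d[OF idx] B[OF idx] sigmoid_bounds[of "u \<theta> j"] \<tau> B0
        order.trans[OF sigmoid_lipschitz u_diff[OF j]]
      by (intro add_mono mult_mono) auto
    finally show ?thesis by simp
  qed
  have "\<bar>net p k \<theta> x - net p k \<theta>' x\<bar> = \<bar>(\<theta> 0 - \<theta>' 0)
      + (\<Sum>j<k. \<theta> (1 + j) * sigmoid (u \<theta> j) - \<theta>' (1 + j) * sigmoid (u \<theta>' j))\<bar>"
    by (simp add: net_def u_def sum_subtractf)
  also have "\<dots> \<le> \<tau> + (\<Sum>j<k. \<tau> + B * (real (p + 1) * \<tau>))"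
    by (intro order.trans[OF abs_triangle_ineq] add_mono d K0 order.trans[OF sum_abs] sum_mono summand) auto
  also have "\<dots> = (1 + real k + real k * real (p + 1) * B) * \<tau>"
    by (simp add: algebra_simps)
  also have "\<dots> \<le> (real (nparam p k) * (1 + B)) * \<tau>"
  proof (rule mult_right_mono[OF _ \<tau>])
    have "0 \<le> real k * B" "0 \<le> real k * real p" using B0 by auto
    then show "1 + real k + real k * real (p + 1) * B \<le> real (nparam p k) * (1 + B)"
      using B0 by (simp add: nparam_def algebra_simps)
  qed
  finally show ?thesis .
qed

section \<open>Pointwise comparison of normal densities\<close>

lemma square_sum_le_weighted:
  fixes a b :: real
  assumes "c > 0"
  shows "(a + b)\<^sup>2 \<le> (1 + c) * a\<^sup>2 + (1 + 1 / c) * b\<^sup>2"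
proof -
  have "0 \<le> (c * a - b)\<^sup>2 / c" using assms by simp
  also have "\<dots> = c * a\<^sup>2 + b\<^sup>2 / c - 2 * a * b"
    using assms by (simp add: power2_eq_square field_simps)
  finally show ?thesis by (simp add: power2_eq_square algebra_simps)
qed

text \<open>Young's inequality with weight \<kappa> turns the mean shift into a factor 1 + \<kappa>
  on the variance and an error \<kappa> \<sigma>'^2; hence the widened scale. In 7 = 9/2 + 5/2 the
  first part is the error in the exponent, by \<sigma>'^2 / \<sigma>^2 \<le> e^2 \<le> 9, and the
  second the ratio of the normalising constants: e^\<kappa> twice and sqrt (1 + \<kappa>) \<le>
  e^(\<kappa>/2).\<close>

lemma normal_density_upper_bracket:
  assumes \<kappa>: "0 < \<kappa>" "\<kappa> \<le> 1" and \<sigma>': "\<sigma>' > 0"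
    and \<mu>: "\<bar>\<mu> - \<mu>'\<bar> \<le> \<kappa> * \<sigma>'"
    and \<sigma>: "\<sigma>' * exp (- \<kappa>) \<le> \<sigma>" "\<sigma> \<le> \<sigma>' * exp \<kappa>"
  shows "normal_density \<mu> \<sigma> y \<le> exp (7 * \<kappa>) * normal_density \<mu>' (\<sigma>' * exp \<kappa> * sqrt (1 + \<kappa>)) y"
proof -
  define s where "s = \<sigma>' * exp \<kappa> * sqrt (1 + \<kappa>)"
  have pos: "0 < \<sigma>" using \<sigma>(1) \<sigma>' by (smt (verit) exp_gt_zero mult_pos_pos)
  have s0: "s > 0" using \<sigma>' \<kappa> by (simp add: s_def)
  have s2: "s\<^sup>2 = \<sigma>'\<^sup>2 * exp (2 * \<kappa>) * (1 + \<kappa>)"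
    using \<kappa> by (simp add: s_def power_mult_distrib exp_double[symmetric])
  have sq1: "\<sigma>\<^sup>2 \<le> \<sigma>'\<^sup>2 * exp (2 * \<kappa>)"
    using power_mono[OF \<sigma>(2), of 2] pos by (simp add: power_mult_distrib exp_double)
  have sq2: "\<sigma>'\<^sup>2 \<le> \<sigma>\<^sup>2 * exp (2 * \<kappa>)"
  proof -
    have "\<sigma>' \<le> \<sigma> * exp \<kappa>" using \<sigma>(1) by (simp add: exp_minus field_simps)
    from power_mono[OF this, of 2] \<sigma>' show ?thesis by (simp add: power_mult_distrib exp_double)
  qed
  have "(y - \<mu>')\<^sup>2 \<le> (1 + \<kappa>) * (y - \<mu>)\<^sup>2 + (1 + 1 / \<kappa>) * (\<mu> - \<mu>')\<^sup>2"
    using square_sum_le_weighted[OF \<kappa>(1), of "y - \<mu>" "\<mu> - \<mu>'"] by simp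
  also have "(\<mu> - \<mu>')\<^sup>2 \<le> \<kappa>\<^sup>2 * \<sigma>'\<^sup>2"
    using power_mono[OF \<mu>, of 2] by (simp add: power_mult_distrib)
  finally have "(y - \<mu>')\<^sup>2 \<le> (1 + \<kappa>) * (y - \<mu>)\<^sup>2 + (1 + 1 / \<kappa>) * (\<kappa>\<^sup>2 * \<sigma>'\<^sup>2)"
    using \<kappa> by (simp add: mult_left_mono)
  also have "\<dots> = (1 + \<kappa>) * ((y - \<mu>)\<^sup>2 + \<kappa> * \<sigma>'\<^sup>2)"
    using \<kappa> by (simp add: power2_eq_square field_simps)
  finally have "(y - \<mu>')\<^sup>2 / (1 + \<kappa>) - \<kappa> * \<sigma>'\<^sup>2 \<le> (y - \<mu>)\<^sup>2"
    using \<kappa> by (simp add: field_simps)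
  then have "(y - \<mu>)\<^sup>2 / (2 * \<sigma>\<^sup>2) \<ge> ((y - \<mu>')\<^sup>2 / (1 + \<kappa>) - \<kappa> * \<sigma>'\<^sup>2) / (2 * \<sigma>\<^sup>2)"
    using pos by (intro divide_right_mono) auto
  also have "((y - \<mu>')\<^sup>2 / (1 + \<kappa>) - \<kappa> * \<sigma>'\<^sup>2) / (2 * \<sigma>\<^sup>2)
      = (y - \<mu>')\<^sup>2 / (1 + \<kappa>) / (2 * \<sigma>\<^sup>2) - \<kappa> * (\<sigma>'\<^sup>2 / \<sigma>\<^sup>2) / 2"
    by (simp add: diff_divide_distrib)
  finally have "(y - \<mu>')\<^sup>2 / (1 + \<kappa>) / (2 * \<sigma>\<^sup>2) - \<kappa> * (\<sigma>'\<^sup>2 / \<sigma>\<^sup>2) / 2 \<le> (y - \<mu>)\<^sup>2 / (2 * \<sigma>\<^sup>2)" .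
  moreover have "(y - \<mu>')\<^sup>2 / (2 * s\<^sup>2) \<le> (y - \<mu>')\<^sup>2 / (1 + \<kappa>) / (2 * \<sigma>\<^sup>2)"
    unfolding s2 divide_divide_eq_left using sq1 pos \<kappa>
    by (intro divide_left_mono) (auto simp: mult_ac intro!: mult_pos_pos add_pos_pos)
  moreover have "\<kappa> * (\<sigma>'\<^sup>2 / \<sigma>\<^sup>2) / 2 \<le> 9 / 2 * \<kappa>"
  proof -
    have "\<sigma>'\<^sup>2 / \<sigma>\<^sup>2 \<le> exp (2 * \<kappa>)"
      using sq2 pos by (simp add: field_simps)
    also have "\<dots> \<le> exp 2" using \<kappa> by simp
    also have "exp 2 = (exp 1 :: real)\<^sup>2" by (simp add: exp_double[symmetric])
    also have "\<dots> \<le> 3\<^sup>2" by (intro power_mono exp_le) auto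
    finally have "\<kappa> * (\<sigma>'\<^sup>2 / \<sigma>\<^sup>2) \<le> \<kappa> * 9" using \<kappa> by (intro mult_left_mono) auto
    then show ?thesis by simp
  qed
  ultimately have expo: "- (y - \<mu>)\<^sup>2 / (2 * \<sigma>\<^sup>2) \<le> 9 / 2 * \<kappa> + - (y - \<mu>')\<^sup>2 / (2 * s\<^sup>2)"
    by simp
  have "s \<le> \<sigma> * exp (5 / 2 * \<kappa>)"
  proof -
    have "sqrt (1 + \<kappa>) \<le> exp (\<kappa> / 2)"
    proof (rule real_le_lsqrt)
      show "1 + \<kappa> \<le> (exp (\<kappa> / 2))\<^sup>2"
        by (simp add: exp_double[symmetric])
    qed (use \<kappa> in auto)
    moreover have "\<sigma>' \<le> \<sigma> * exp \<kappa>" using \<sigma>(1) by (simp add: exp_minus field_simps)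
    ultimately have "s \<le> (\<sigma> * exp \<kappa>) * exp \<kappa> * exp (\<kappa> / 2)"
      unfolding s_def using pos \<sigma>' \<kappa> by (intro mult_mono) auto
    also have "\<dots> = \<sigma> * exp (5 / 2 * \<kappa>)"
      by (simp add: mult.assoc exp_add[symmetric])
    finally show ?thesis .
  qed
  then have "1 / (sqrt (2 * pi) * \<sigma>) \<le> exp (5 / 2 * \<kappa>) * (1 / (sqrt (2 * pi) * s))"
    using pos s0 by (simp add: field_simps)
  moreover have "exp (- (y - \<mu>)\<^sup>2 / (2 * \<sigma>\<^sup>2)) \<le> exp (9 / 2 * \<kappa>) * exp (- (y - \<mu>')\<^sup>2 / (2 * s\<^sup>2))"
    using expo by (simp add: exp_add[symmetric])
  ultimately have "1 / (sqrt (2 * pi) * \<sigma>) * exp (- (y - \<mu>)\<^sup>2 / (2 * \<sigma>\<^sup>2))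
     \<le> (exp (5 / 2 * \<kappa>) * (1 / (sqrt (2 * pi) * s))) * (exp (9 / 2 * \<kappa>) * exp (- (y - \<mu>')\<^sup>2 / (2 * s\<^sup>2)))"
    using s0 by (intro mult_mono) auto
  also have "\<dots> = (exp (5 / 2 * \<kappa>) * exp (9 / 2 * \<kappa>)) * (1 / (sqrt (2 * pi) * s) * exp (- (y - \<mu>')\<^sup>2 / (2 * s\<^sup>2)))"
    by simp
  also have "exp (5 / 2 * \<kappa>) * exp (9 / 2 * \<kappa>) = exp (7 * \<kappa>)"
    by (simp add: exp_add[symmetric])
  finally show ?thesis
    using pos s0 by (simp add: normal_density_def real_sqrt_mult flip: s_def)
qed

text \<open>With \<sigma> = \<sigma>0 e^v and y = \<mu>0 + \<xi> the logarithm is explicit. Under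
  the absolute value the cross term in \<xi> (\<mu>0 - \<mu>) cannot average out, so Young's
  inequality splits it with a free weight \<tau>; a \<tau> of the order of the approximation error
  later makes both halves of that order.\<close>

lemma abs_ln_normal_density_ratio_le:
  assumes \<sigma>0: "\<sigma>0 > 0" and \<sigma>: "\<sigma> > 0" and \<tau>: "\<tau> > 0"
    and d: "\<bar>ln \<sigma> - ln \<sigma>0\<bar> \<le> d"
  shows "\<bar>ln (normal_density \<mu>0 \<sigma>0 y / normal_density \<mu> \<sigma> y)\<bar>
    \<le> (exp (2 * d) - 1) * (1 + (y - \<mu>0)\<^sup>2 / (2 * \<sigma>0\<^sup>2))
      + exp (2 * d) * (\<tau> * (y - \<mu>0)\<^sup>2 + (1 + 1 / \<tau>) * (\<mu>0 - \<mu>)\<^sup>2) / (2 * \<sigma>0\<^sup>2)"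
proof -
  define v where "v = ln \<sigma> - ln \<sigma>0"
  define \<xi> where "\<xi> = y - \<mu>0"
  define g where "g = \<mu>0 - \<mu>"
  have v: "\<bar>v\<bar> \<le> d" using d by (simp add: v_def)
  have \<sigma>_eq: "\<sigma> = \<sigma>0 * exp v" using \<sigma>0 \<sigma> by (simp add: v_def exp_diff)
  have ln_nd: "ln (normal_density m s y) = - ln (sqrt (2 * pi)) - ln s - (y - m)\<^sup>2 / (2 * s\<^sup>2)" if "s > 0" for m s
    using that by (simp add: normal_density_def real_sqrt_mult ln_mult ln_div)
  have "ln (normal_density \<mu>0 \<sigma>0 y / normal_density \<mu> \<sigma> y) = v + ((\<xi> + g)\<^sup>2 * exp (- 2 * v) - \<xi>\<^sup>2) / (2 * \<sigma>0\<^sup>2)"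
  proof -
    have "exp (v * 2) = (exp v)\<^sup>2" by (simp add: exp_double[symmetric] mult.commute)
    then have "(y - \<mu>)\<^sup>2 / (2 * \<sigma>\<^sup>2) = (\<xi> + g)\<^sup>2 * exp (- 2 * v) / (2 * \<sigma>0\<^sup>2)"
      unfolding \<sigma>_eq \<xi>_def g_def
      by (simp add: power_mult_distrib exp_minus exp_double field_simps)
    then show ?thesis
      using normal_density_pos[OF \<sigma>0, of \<mu>0 y] normal_density_pos[OF \<sigma>, of \<mu> y] \<sigma>0 \<sigma>
      by (simp add: ln_div less_imp_neq[symmetric] ln_nd v_def \<xi>_def diff_divide_distrib)
  qed
  also have "(\<xi> + g)\<^sup>2 * exp (- 2 * v) - \<xi>\<^sup>2 = \<xi>\<^sup>2 * (exp (- 2 * v) - 1) + (2 * \<xi> * g + g\<^sup>2) * exp (- 2 * v)"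
    by (simp add: power2_eq_square algebra_simps)
  also have "\<bar>v + (\<xi>\<^sup>2 * (exp (- 2 * v) - 1) + (2 * \<xi> * g + g\<^sup>2) * exp (- 2 * v)) / (2 * \<sigma>0\<^sup>2)\<bar>
    \<le> (exp (2 * d) - 1) + (\<xi>\<^sup>2 * (exp (2 * d) - 1) + (\<tau> * \<xi>\<^sup>2 + (1 + 1 / \<tau>) * g\<^sup>2) * exp (2 * d)) / (2 * \<sigma>0\<^sup>2)"
  proof (rule order.trans[OF abs_triangle_ineq], rule add_mono)
    have "d \<ge> 0" using v by linarith
    then show "\<bar>v\<bar> \<le> exp (2 * d) - 1" using v exp_ge_add_one_self[of "2 * d"] by linarith
    have e1: "\<bar>exp (- 2 * v) - 1\<bar> \<le> exp (2 * d) - 1"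
    proof (rule abs_leI)
      show "exp (- 2 * v) - 1 \<le> exp (2 * d) - 1" using v by simp
      have "1 - exp (- 2 * v) \<le> 2 * v" using exp_ge_add_one_self[of "- 2 * v"] by linarith
      also have "\<dots> \<le> 2 * d" using v by simp
      also have "\<dots> \<le> exp (2 * d) - 1" using exp_ge_add_one_self[of "2 * d"] by linarith
      finally show "- (exp (- 2 * v) - 1) \<le> exp (2 * d) - 1" by simp
    qed
    have "2 * \<bar>\<xi>\<bar> * \<bar>g\<bar> \<le> \<tau> * \<xi>\<^sup>2 + g\<^sup>2 / \<tau>"
      using square_sum_le_weighted[OF \<tau>, of "\<bar>\<xi>\<bar>" "\<bar>g\<bar>"] by (simp add: power2_sum algebra_simps)
    then have e2: "\<bar>2 * \<xi> * g + g\<^sup>2\<bar> \<le> \<tau> * \<xi>\<^sup>2 + (1 + 1 / \<tau>) * g\<^sup>2"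
      using abs_triangle_ineq[of "2 * \<xi> * g" "g\<^sup>2"] by (simp add: abs_mult algebra_simps)
    have "\<bar>\<xi>\<^sup>2 * (exp (- 2 * v) - 1) + (2 * \<xi> * g + g\<^sup>2) * exp (- 2 * v)\<bar>
      \<le> \<xi>\<^sup>2 * (exp (2 * d) - 1) + (\<tau> * \<xi>\<^sup>2 + (1 + 1 / \<tau>) * g\<^sup>2) * exp (2 * d)"
      by (rule order.trans[OF abs_triangle_ineq], unfold abs_mult, intro add_mono mult_mono)
        (use e1 e2 v \<tau> in auto)
    then show "\<bar>(\<xi>\<^sup>2 * (exp (- 2 * v) - 1) + (2 * \<xi> * g + g\<^sup>2) * exp (- 2 * v)) / (2 * \<sigma>0\<^sup>2)\<bar>
      \<le> (\<xi>\<^sup>2 * (exp (2 * d) - 1) + (\<tau> * \<xi>\<^sup>2 + (1 + 1 / \<tau>) * g\<^sup>2) * exp (2 * d)) / (2 * \<sigma>0\<^sup>2)"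
      by (simp add: abs_divide divide_right_mono)
  qed
  finally show ?thesis
    by (simp add: \<xi>_def g_def add_divide_distrib diff_divide_distrib algebra_simps)
qed

subsection \<open>Integrals against products of normal densities\<close>

lemma normal_density_neq_0: "s > 0 \<Longrightarrow> normal_density m s x \<noteq> 0"
  using normal_density_pos[of s m x] by simp

lemma nn_integral_normal_density [simp]:
  assumes "s > 0"
  shows "(\<integral>\<^sup>+x. ennreal (normal_density m s x) \<partial>lborel) = 1"
  using assms by (simp add: nn_integral_eq_integral)

lemma nn_integral_normal_square:
  assumes "s > 0"
  shows "(\<integral>\<^sup>+x. ennreal (normal_density m s x) * ennreal ((x - m)\<^sup>2) \<partial>lborel) = ennreal (s\<^sup>2)"
proof -
  have "has_bochner_integral lborel (\<lambda>x. normal_density m s x * (x - m)\<^sup>2) (s\<^sup>2)"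
    using normal_moment_even[OF assms, of m 1] by (simp add: power2_eq_square)
  then have "(\<integral>\<^sup>+x. ennreal (normal_density m s x * (x - m)\<^sup>2) \<partial>lborel) = ennreal (s\<^sup>2)"
    by (subst nn_integral_eq_integral) (auto simp: has_bochner_integral_iff)
  then show ?thesis by (simp add: ennreal_mult)
qed

lemma nn_integral_normal_exp:
  assumes s: "s > 0"
  shows "(\<integral>\<^sup>+x. ennreal (normal_density m s x) * ennreal (exp (t * (x - m))) \<partial>lborel) = ennreal (exp (t\<^sup>2 * s\<^sup>2 / 2))"
proof -
  have "normal_density m s x * exp (t * (x - m)) = exp (t\<^sup>2 * s\<^sup>2 / 2) * normal_density (m + t * s\<^sup>2) s x" for x
  proof -
    have "- (x - m)\<^sup>2 / (2 * s\<^sup>2) + t * (x - m) = t\<^sup>2 * s\<^sup>2 / 2 + - (x - (m + t * s\<^sup>2))\<^sup>2 / (2 * s\<^sup>2)"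
      using s by (simp add: field_simps power2_eq_square)
    then have "exp (- (x - m)\<^sup>2 / (2 * s\<^sup>2)) * exp (t * (x - m)) = exp (t\<^sup>2 * s\<^sup>2 / 2) * exp (- (x - (m + t * s\<^sup>2))\<^sup>2 / (2 * s\<^sup>2))"
      by (simp only: exp_add[symmetric])
    then show ?thesis by (simp add: normal_density_def)
  qed
  then have "(\<integral>\<^sup>+x. ennreal (normal_density m s x) * ennreal (exp (t * (x - m))) \<partial>lborel)
    = (\<integral>\<^sup>+x. ennreal (exp (t\<^sup>2 * s\<^sup>2 / 2)) * ennreal (normal_density (m + t * s\<^sup>2) s x) \<partial>lborel)"
    by (simp add: ennreal_mult[symmetric])
  also have "\<dots> = ennreal (exp (t\<^sup>2 * s\<^sup>2 / 2))"
    using s by (simp add: nn_integral_cmult)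
  finally show ?thesis .
qed

lemma nn_integral_normal_exp_abs_le:
  assumes s: "s > 0"
  shows "(\<integral>\<^sup>+x. ennreal (normal_density m s x) * ennreal (exp (t * \<bar>x - m\<bar>)) \<partial>lborel) \<le> ennreal (2 * exp (t\<^sup>2 * s\<^sup>2 / 2))"
proof -
  have "(\<integral>\<^sup>+x. ennreal (normal_density m s x) * ennreal (exp (t * \<bar>x - m\<bar>)) \<partial>lborel)
    \<le> (\<integral>\<^sup>+x. ennreal (normal_density m s x) * ennreal (exp (t * (x - m)))
        + ennreal (normal_density m s x) * ennreal (exp (- t * (x - m))) \<partial>lborel)"
  proof (intro nn_integral_mono)
    fix x
    have "exp (t * \<bar>x - m\<bar>) \<le> exp (t * (x - m)) + exp (- t * (x - m))"
      by (cases "x \<ge> m") (simp_all add: algebra_simps)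
    then have "normal_density m s x * exp (t * \<bar>x - m\<bar>)
        \<le> normal_density m s x * (exp (t * (x - m)) + exp (- t * (x - m)))"
      by (intro mult_left_mono) auto
    then show "ennreal (normal_density m s x) * ennreal (exp (t * \<bar>x - m\<bar>))
      \<le> ennreal (normal_density m s x) * ennreal (exp (t * (x - m)))
        + ennreal (normal_density m s x) * ennreal (exp (- t * (x - m)))"
      by (simp add: ennreal_mult[symmetric] ennreal_plus[symmetric] distrib_left del: ennreal_plus)
  qed
  also have "\<dots> = ennreal (2 * exp (t\<^sup>2 * s\<^sup>2 / 2))"
    by (subst nn_integral_add)
      (simp_all only: nn_integral_normal_exp[OF s] power2_minus, simp_all add: ennreal_plus[symmetric] del: ennreal_plus)
  finally show ?thesis .
qed

text \<open>Since e^(2d) - 1 \<le> 2 d e^(2d), the arithmetic-geometric mean inequality with weight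
  s splits it into d^2 / s and s e^(4d), both of mean O(s). The constant e^8 is the
  exponential-moment bound e^(4^2 s^2 / 2) at s = 1.\<close>

lemma nn_integral_normal_exp_abs_minus_one_le:
  assumes s: "0 < s" "s \<le> 1"
  shows "(\<integral>\<^sup>+x. ennreal (normal_density m s x) * ennreal (exp (2 * \<bar>x - m\<bar>) - 1) \<partial>lborel) \<le> ennreal (s * (1 + 2 * exp 8))"
proof -
  have pw: "exp (2 * d) - 1 \<le> d\<^sup>2 / s + s * exp (4 * d)" if "d \<ge> 0" for d :: real
  proof -
    have "1 - exp (- (2 * d)) \<le> 2 * d"
      using exp_ge_add_one_self[of "- (2 * d)"] by linarith
    then have "exp (2 * d) * (1 - exp (- (2 * d))) \<le> exp (2 * d) * (2 * d)"
      by (intro mult_left_mono) auto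
    then have "exp (2 * d) - 1 \<le> 2 * d * exp (2 * d)"
      by (simp add: algebra_simps exp_minus)
    also have "\<dots> \<le> d\<^sup>2 / s + s * (exp (2 * d))\<^sup>2"
    proof -
      have "0 \<le> (d - s * exp (2 * d))\<^sup>2 / s" using s by simp
      also have "\<dots> = d\<^sup>2 / s + s * (exp (2 * d))\<^sup>2 - 2 * d * exp (2 * d)"
        using s by (simp add: power2_eq_square field_simps)
      finally show ?thesis by simp
    qed
    also have "(exp (2 * d))\<^sup>2 = exp (4 * d)" by (simp add: exp_double[symmetric])
    finally show ?thesis .
  qed
  have "(\<integral>\<^sup>+x. ennreal (normal_density m s x) * ennreal (exp (2 * \<bar>x - m\<bar>) - 1) \<partial>lborel)
    \<le> (\<integral>\<^sup>+x. ennreal (1 / s) * (ennreal (normal_density m s x) * ennreal ((x - m)\<^sup>2))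
       + ennreal s * (ennreal (normal_density m s x) * ennreal (exp (4 * \<bar>x - m\<bar>))) \<partial>lborel)"
  proof (rule nn_integral_mono)
    fix x
    have "normal_density m s x * (exp (2 * \<bar>x - m\<bar>) - 1) \<le> normal_density m s x * ((x - m)\<^sup>2 / s + s * exp (4 * \<bar>x - m\<bar>))"
      using pw[of "\<bar>x - m\<bar>"] by (intro mult_left_mono) auto
    also have "\<dots> = 1 / s * (normal_density m s x * (x - m)\<^sup>2) + s * (normal_density m s x * exp (4 * \<bar>x - m\<bar>))"
      by (simp add: algebra_simps)
    finally show "ennreal (normal_density m s x) * ennreal (exp (2 * \<bar>x - m\<bar>) - 1)
     \<le> ennreal (1 / s) * (ennreal (normal_density m s x) * ennreal ((x - m)\<^sup>2))
       + ennreal s * (ennreal (normal_density m s x) * ennreal (exp (4 * \<bar>x - m\<bar>)))"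
      using s by (simp add: ennreal_mult[symmetric] ennreal_plus[symmetric] del: ennreal_plus)
  qed
  also have "\<dots> = ennreal (1 / s) * ennreal (s\<^sup>2) + ennreal s * (\<integral>\<^sup>+x. ennreal (normal_density m s x) * ennreal (exp (4 * \<bar>x - m\<bar>)) \<partial>lborel)"
    using s by (subst nn_integral_add) (auto simp: nn_integral_cmult nn_integral_normal_square)
  also have "\<dots> \<le> ennreal (1 / s) * ennreal (s\<^sup>2) + ennreal s * ennreal (2 * exp (4\<^sup>2 * s\<^sup>2 / 2))"
    using s by (intro add_mono mult_left_mono nn_integral_normal_exp_abs_le) auto
  also have "\<dots> = ennreal (s + s * (2 * exp (4\<^sup>2 * s\<^sup>2 / 2)))"
    using s by (simp add: ennreal_mult[symmetric] ennreal_plus[symmetric] power2_eq_square del: ennreal_plus)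
  also have "\<dots> \<le> ennreal (s * (1 + 2 * exp 8))"
  proof -
    have "s\<^sup>2 \<le> 1" using s by (simp add: power_le_one)
    then have "s * (2 * exp (4\<^sup>2 * s\<^sup>2 / 2)) \<le> s * (2 * exp 8)"
      using s by (intro mult_left_mono) auto
    then show ?thesis by (intro ennreal_leI) (simp add: algebra_simps)
  qed
  finally show ?thesis .
qed

text \<open>Chernoff's bound with the exponent left free; it is later taken as sqrt n, to match R of
  order sqrt n.\<close>

lemma nn_integral_normal_tail_le:
  assumes s: "s > 0" and t: "t \<ge> 0"
  shows "(\<integral>\<^sup>+x. ennreal (normal_density 0 s x) * indicator {x. \<bar>x\<bar> > R} x \<partial>lborel) \<le> ennreal (2 * exp (t\<^sup>2 * s\<^sup>2 / 2 - t * R))"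
proof -
  have "(\<integral>\<^sup>+x. ennreal (normal_density 0 s x) * indicator {x. \<bar>x\<bar> > R} x \<partial>lborel)
     \<le> (\<integral>\<^sup>+x. ennreal (exp (- t * R)) * (ennreal (normal_density 0 s x) * ennreal (exp (t * \<bar>x - 0\<bar>))) \<partial>lborel)"
  proof (rule nn_integral_mono)
    fix x
    have "indicator {x. \<bar>x\<bar> > R} x \<le> exp (- t * R) * exp (t * \<bar>x\<bar>)"
      using t by (auto simp: indicator_def exp_add[symmetric] mult_left_mono)
    then have "normal_density 0 s x * indicator {x. \<bar>x\<bar> > R} x \<le> normal_density 0 s x * (exp (- t * R) * exp (t * \<bar>x\<bar>))"
      by (intro mult_left_mono) auto
    then have "ennreal (normal_density 0 s x * indicator {x. \<bar>x\<bar> > R} x) \<le> ennreal (exp (- t * R) * (normal_density 0 s x * exp (t * \<bar>x - 0\<bar>)))"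
      by (intro ennreal_leI) (simp add: mult_ac)
    then show "ennreal (normal_density 0 s x) * indicator {x. \<bar>x\<bar> > R} x
      \<le> ennreal (exp (- t * R)) * (ennreal (normal_density 0 s x) * ennreal (exp (t * \<bar>x - 0\<bar>)))"
      by (auto simp: ennreal_mult indicator_def)
  qed
  also have "\<dots> \<le> ennreal (exp (- t * R)) * ennreal (2 * exp (t\<^sup>2 * s\<^sup>2 / 2))"
    using s by (subst nn_integral_cmult) (use nn_integral_normal_exp_abs_le[OF s, of 0 t] in \<open>auto intro!: mult_left_mono\<close>)
  also have "\<dots> = ennreal (2 * exp (t\<^sup>2 * s\<^sup>2 / 2 - t * R))"
  proof -
    have "exp (- t * R) * (2 * exp (t\<^sup>2 * s\<^sup>2 / 2)) = 2 * (exp (- t * R) * exp (t\<^sup>2 * s\<^sup>2 / 2))"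
      by simp
    also have "\<dots> = 2 * exp (t\<^sup>2 * s\<^sup>2 / 2 - t * R)"
      unfolding exp_add[symmetric] by simp
    finally show ?thesis by (simp add: ennreal_mult[symmetric])
  qed
  finally show ?thesis .
qed

lemma nn_integral_PiM_component:
  assumes "finite I" "i \<in> I" and "\<And>i. i \<in> I \<Longrightarrow> prob_space (M i)"
    and [measurable]: "g \<in> borel_measurable (M i)"
  shows "(\<integral>\<^sup>+x. g (x i) \<partial>PiM I M) = (\<integral>\<^sup>+y. g y \<partial>M i)"
proof -
  have "(\<integral>\<^sup>+y. g y \<partial>M i) = (\<integral>\<^sup>+y. g y \<partial>distr (PiM I M) (M i) (\<lambda>x. x i))"
    using assms by (subst distr_PiM_component) auto
  also have "\<dots> = (\<integral>\<^sup>+x. g (x i) \<partial>PiM I M)"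
    using assms by (subst nn_integral_distr) auto
  finally show ?thesis by simp
qed

section \<open>Product normal densities on the parameter space\<close>

lemma measurable_param_component [measurable]:
  "i \<le> nparam p k \<Longrightarrow> (\<lambda>\<omega>. \<omega> i) \<in> borel_measurable (param_space p k)"
  unfolding param_space_def by measurable

lemma borel_measurable_vdens [measurable]: "vdens p k m s \<in> borel_measurable (param_space p k)"
  unfolding vdens_def [abs_def] by measurable

lemma vdens_pos:
  assumes "\<And>i. i \<le> nparam p k \<Longrightarrow> s i > 0"
  shows "vdens p k m s \<omega> > 0"
  unfolding vdens_def using assms by (intro prod_pos) (auto intro: normal_density_pos)

lemma sigma_finite_param_space: "sigma_finite_measure (param_space p k)"
proof -
  interpret product_sigma_finite "\<lambda>_. lborel :: real measure" by standard
  show ?thesis unfolding param_space_def by (rule sigma_finite) simp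
qed

lemma nn_integral_vdens_prod:
  assumes [measurable]: "\<And>i. i \<le> nparam p k \<Longrightarrow> g i \<in> borel_measurable borel"
  shows "(\<integral>\<^sup>+\<omega>. ennreal (vdens p k m s \<omega>) * (\<Prod>i\<le>nparam p k. g i (\<omega> i)) \<partial>param_space p k)
    = (\<Prod>i\<le>nparam p k. \<integral>\<^sup>+x. ennreal (normal_density (m i) (s i) x) * g i x \<partial>lborel)"
proof -
  interpret product_sigma_finite "\<lambda>_. lborel :: real measure" by standard
  have "(\<integral>\<^sup>+\<omega>. (\<Prod>i\<le>nparam p k. ennreal (normal_density (m i) (s i) (\<omega> i)) * g i (\<omega> i)) \<partial>param_space p k)
    = (\<Prod>i\<le>nparam p k. \<integral>\<^sup>+x. ennreal (normal_density (m i) (s i) x) * g i x \<partial>lborel)"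
    unfolding param_space_def by (rule product_nn_integral_prod) auto
  then show ?thesis
    by (simp add: vdens_def prod.distrib prod_ennreal)
qed

lemma nn_integral_vdens [simp]:
  assumes "\<And>i. i \<le> nparam p k \<Longrightarrow> s i > 0"
  shows "(\<integral>\<^sup>+\<omega>. ennreal (vdens p k m s \<omega>) \<partial>param_space p k) = 1"
  using nn_integral_vdens_prod[of p k "\<lambda>_ _. 1" m s] assms by simp

lemma nn_integral_vdens_component:
  assumes s: "\<And>i. i \<le> nparam p k \<Longrightarrow> s i > 0" and i: "i \<le> nparam p k"
    and [measurable]: "g \<in> borel_measurable borel"
  shows "(\<integral>\<^sup>+\<omega>. ennreal (vdens p k m s \<omega>) * g (\<omega> i) \<partial>param_space p k)
    = (\<integral>\<^sup>+x. ennreal (normal_density (m i) (s i) x) * g x \<partial>lborel)"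
proof -
  have "(\<integral>\<^sup>+\<omega>. ennreal (vdens p k m s \<omega>) * g (\<omega> i) \<partial>param_space p k)
    = (\<integral>\<^sup>+\<omega>. ennreal (vdens p k m s \<omega>) * (\<Prod>j\<le>nparam p k. if j = i then g (\<omega> j) else 1) \<partial>param_space p k)"
    using i by (simp add: prod.delta)
  also have "\<dots> = (\<Prod>j\<le>nparam p k. \<integral>\<^sup>+x. ennreal (normal_density (m j) (s j) x) * (if j = i then g x else 1) \<partial>lborel)"
    by (rule nn_integral_vdens_prod[where g="\<lambda>j x. if j = i then g x else 1"]) auto
  also have "\<dots> = (\<Prod>j\<le>nparam p k. if j = i then (\<integral>\<^sup>+x. ennreal (normal_density (m i) (s i) x) * g x \<partial>lborel) else 1)"
    using s by (intro prod.cong) auto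
  finally show ?thesis using i by (simp add: prod.delta)
qed

text \<open>The competitor's loss multiplies an exponential in the scale coordinate by a square in a
  network coordinate; independence under the product density separates them.\<close>

lemma nn_integral_vdens_two_components:
  assumes s: "\<And>i. i \<le> nparam p k \<Longrightarrow> s i > 0"
    and i: "i \<le> nparam p k" and j: "j \<le> nparam p k" and ij: "i \<noteq> j"
    and [measurable]: "g \<in> borel_measurable borel" "h \<in> borel_measurable borel"
  shows "(\<integral>\<^sup>+\<omega>. ennreal (vdens p k m s \<omega>) * (g (\<omega> i) * h (\<omega> j)) \<partial>param_space p k)
    = (\<integral>\<^sup>+x. ennreal (normal_density (m i) (s i) x) * g x \<partial>lborel)
      * (\<integral>\<^sup>+x. ennreal (normal_density (m j) (s j) x) * h x \<partial>lborel)"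
proof -
  let ?f = "\<lambda>l x. (if l = i then g x else 1) * (if l = j then h x else 1)"
  have "(\<integral>\<^sup>+\<omega>. ennreal (vdens p k m s \<omega>) * (g (\<omega> i) * h (\<omega> j)) \<partial>param_space p k)
    = (\<integral>\<^sup>+\<omega>. ennreal (vdens p k m s \<omega>) * (\<Prod>l\<le>nparam p k. ?f l (\<omega> l)) \<partial>param_space p k)"
    using i j by (simp add: prod.distrib prod.delta)
  also have "\<dots> = (\<Prod>l\<le>nparam p k. \<integral>\<^sup>+x. ennreal (normal_density (m l) (s l) x) * ?f l x \<partial>lborel)"
    by (rule nn_integral_vdens_prod) auto
  also have "\<dots> = (\<Prod>l\<le>nparam p k. (if l = i then (\<integral>\<^sup>+x. ennreal (normal_density (m i) (s i) x) * g x \<partial>lborel) else 1)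
      * (if l = j then (\<integral>\<^sup>+x. ennreal (normal_density (m j) (s j) x) * h x \<partial>lborel) else 1))"
    using s ij by (intro prod.cong) auto
  finally show ?thesis using i j by (simp add: prod.distrib prod.delta)
qed

text \<open>With these scales and means 0 the prior is itself a member of the variational family, so
  every integral identity for \<open>vdens\<close> covers it.\<close>

definition prior_scale :: "real \<Rightarrow> real \<Rightarrow> nat \<Rightarrow> real" where
  "prior_scale \<eta> \<zeta> i = (if i = 0 then \<eta> else \<zeta>)"

lemma prior_dens_eq_vdens: "prior_dens p k \<eta> \<zeta> = vdens p k (\<lambda>_. 0) (prior_scale \<eta> \<zeta>)"
proof
  fix \<omega>
  have "{..nparam p k} = insert 0 {1..nparam p k}" by auto
  then show "prior_dens p k \<eta> \<zeta> \<omega> = vdens p k (\<lambda>_. 0) (prior_scale \<eta> \<zeta>) \<omega>"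
    by (simp add: prior_dens_def vdens_def prior_scale_def)
qed

text \<open>Each coordinate contributes an explicit quadratic. Splitting \<omega> i into its mean
  and a deviation leaves only the square (\<omega> i - m i)^2, whose integral against the density is
  a variance.\<close>

lemma abs_ln_vdens_ratio_le:
  assumes s: "\<And>i. i \<le> nparam p k \<Longrightarrow> s i > 0" and t: "\<And>i. i \<le> nparam p k \<Longrightarrow> t i > 0"
  shows "\<bar>ln (vdens p k m s \<omega> / vdens p k (\<lambda>_. 0) t \<omega>)\<bar>
    \<le> (\<Sum>i\<le>nparam p k. \<bar>ln (t i / s i)\<bar> + (m i)\<^sup>2 / (t i)\<^sup>2 + (1 / (2 * (s i)\<^sup>2) + 1 / (t i)\<^sup>2) * (\<omega> i - m i)\<^sup>2)"
proof -
  have "vdens p k m s \<omega> / vdens p k (\<lambda>_. 0) t \<omega> = (\<Prod>i\<le>nparam p k. normal_density (m i) (s i) (\<omega> i) / normal_density 0 (t i) (\<omega> i))"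
    by (simp add: vdens_def prod_dividef)
  then have ln_eq: "ln (vdens p k m s \<omega> / vdens p k (\<lambda>_. 0) t \<omega>) = (\<Sum>i\<le>nparam p k. ln (normal_density (m i) (s i) (\<omega> i) / normal_density 0 (t i) (\<omega> i)))"
    using s t by (simp, subst ln_prod) (auto simp: normal_density_neq_0)
  show ?thesis
    unfolding ln_eq
  proof (rule order.trans[OF sum_abs], rule sum_mono)
    fix i assume "i \<in> {..nparam p k}"
    then have pos: "s i > 0" "t i > 0" using s t by auto
    let ?x = "\<omega> i"
    have eq: "ln (normal_density (m i) (s i) ?x / normal_density 0 (t i) ?x)
       = ln (t i / s i) + (?x\<^sup>2 / (2 * (t i)\<^sup>2) - (?x - m i)\<^sup>2 / (2 * (s i)\<^sup>2))"
    proof -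
      have "normal_density (m i) (s i) ?x / normal_density 0 (t i) ?x
        = t i / s i * exp (?x\<^sup>2 / (2 * (t i)\<^sup>2) - (?x - m i)\<^sup>2 / (2 * (s i)\<^sup>2))"
      proof -
        have nd: "normal_density \<mu> \<sigma> ?x = exp (- ((?x - \<mu>)\<^sup>2 / (2 * \<sigma>\<^sup>2))) / (sqrt (2 * pi) * \<sigma>)" if "\<sigma> > 0" for \<mu> \<sigma>
          using that by (simp add: normal_density_def real_sqrt_mult)
        show ?thesis
          unfolding nd[OF pos(1)] nd[OF pos(2)] using pos
          by (simp add: exp_diff exp_minus) (simp add: divide_simps)
      qed
      moreover have "t i / s i > 0" using pos by simp
      ultimately show ?thesis by (simp only: ln_mult_pos exp_gt_zero ln_exp)
    qed
    have le: "?x\<^sup>2 / (2 * (t i)\<^sup>2) \<le> (m i)\<^sup>2 / (t i)\<^sup>2 + (?x - m i)\<^sup>2 / (t i)\<^sup>2"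
    proof -
      have "?x\<^sup>2 \<le> 2 * (m i)\<^sup>2 + 2 * (?x - m i)\<^sup>2"
        using square_sum_le_weighted[of 1 "m i" "?x - m i"] by simp
      then have "?x\<^sup>2 / (2 * (t i)\<^sup>2) \<le> (2 * (m i)\<^sup>2 + 2 * (?x - m i)\<^sup>2) / (2 * (t i)\<^sup>2)"
        by (intro divide_right_mono) auto
      then show ?thesis by (simp add: add_divide_distrib)
    qed
    have *: "\<bar>l + (X - Y)\<bar> \<le> \<bar>l\<bar> + M + (Y + Z)"
      if "X \<le> M + Z" "0 \<le> X" "0 \<le> Y" "0 \<le> Z" "0 \<le> M" for l X Y M Z :: real
      using that by linarith
    show "\<bar>ln (normal_density (m i) (s i) ?x / normal_density 0 (t i) ?x)\<bar>
      \<le> \<bar>ln (t i / s i)\<bar> + (m i)\<^sup>2 / (t i)\<^sup>2 + (1 / (2 * (s i)\<^sup>2) + 1 / (t i)\<^sup>2) * (?x - m i)\<^sup>2"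
      unfolding eq distrib_right times_divide_eq_left mult_1
      by (rule *[OF le]) auto
  qed
qed

text \<open>The 1/2 is the deviation term s^2 / (2 s^2). Shrinking s therefore costs only a
  logarithm per parameter, and the means enter through their squares, which is how (A2) is
  used.\<close>

lemma nn_integral_vdens_abs_ln_ratio_le:
  assumes s: "s > 0" and t: "\<And>i. i \<le> nparam p k \<Longrightarrow> t i > 0"
  shows "(\<integral>\<^sup>+\<omega>. ennreal (vdens p k m (\<lambda>_. s) \<omega>) * ennreal \<bar>ln (vdens p k m (\<lambda>_. s) \<omega> / vdens p k (\<lambda>_. 0) t \<omega>)\<bar> \<partial>param_space p k)
    \<le> ennreal (\<Sum>i\<le>nparam p k. \<bar>ln (t i / s)\<bar> + (m i)\<^sup>2 / (t i)\<^sup>2 + 1 / 2 + s\<^sup>2 / (t i)\<^sup>2)"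
proof -
  let ?a = "\<lambda>i. \<bar>ln (t i / s)\<bar> + (m i)\<^sup>2 / (t i)\<^sup>2"
  let ?b = "\<lambda>i. 1 / (2 * s\<^sup>2) + 1 / (t i)\<^sup>2"
  let ?v = "vdens p k m (\<lambda>_. s)"
  have a0: "0 \<le> ?a i" "0 \<le> ?b i" for i by auto
  have "(\<integral>\<^sup>+\<omega>. ennreal (?v \<omega>) * ennreal \<bar>ln (?v \<omega> / vdens p k (\<lambda>_. 0) t \<omega>)\<bar> \<partial>param_space p k)
    \<le> (\<integral>\<^sup>+\<omega>. (\<Sum>i\<le>nparam p k. ennreal (?a i) * ennreal (?v \<omega>)
        + ennreal (?b i) * (ennreal (?v \<omega>) * ennreal ((\<omega> i - m i)\<^sup>2))) \<partial>param_space p k)"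
  proof (rule nn_integral_mono)
    fix \<omega>
    have v0: "?v \<omega> \<ge> 0" using vdens_pos[of p k "\<lambda>_. s" m \<omega>] s by auto
    have "?v \<omega> * \<bar>ln (?v \<omega> / vdens p k (\<lambda>_. 0) t \<omega>)\<bar> \<le> ?v \<omega> * (\<Sum>i\<le>nparam p k. ?a i + ?b i * (\<omega> i - m i)\<^sup>2)"
      using abs_ln_vdens_ratio_le[of p k "\<lambda>_. s" t m \<omega>] s t v0 by (intro mult_left_mono) auto
    also have "\<dots> = (\<Sum>i\<le>nparam p k. ?a i * ?v \<omega> + ?b i * (?v \<omega> * (\<omega> i - m i)\<^sup>2))"
      by (simp add: sum_distrib_left algebra_simps)
    finally have "ennreal (?v \<omega> * \<bar>ln (?v \<omega> / vdens p k (\<lambda>_. 0) t \<omega>)\<bar>)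
        \<le> ennreal (\<Sum>i\<le>nparam p k. ?a i * ?v \<omega> + ?b i * (?v \<omega> * (\<omega> i - m i)\<^sup>2))"
      by (rule ennreal_leI)
    also have "\<dots> = (\<Sum>i\<le>nparam p k. ennreal (?a i * ?v \<omega> + ?b i * (?v \<omega> * (\<omega> i - m i)\<^sup>2)))"
      using v0 a0 by (intro sum_ennreal[symmetric] add_nonneg_nonneg mult_nonneg_nonneg) auto
    also have "\<dots> = (\<Sum>i\<le>nparam p k. ennreal (?a i) * ennreal (?v \<omega>) + ennreal (?b i) * (ennreal (?v \<omega>) * ennreal ((\<omega> i - m i)\<^sup>2)))"
      using v0 a0 by (intro sum.cong refl) (simp only: ennreal_plus ennreal_mult mult_nonneg_nonneg zero_le_power2)
    finally show "ennreal (?v \<omega>) * ennreal \<bar>ln (?v \<omega> / vdens p k (\<lambda>_. 0) t \<omega>)\<bar> \<le> \<dots>"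
      using v0 by (simp add: ennreal_mult)
  qed
  also have "\<dots> = (\<Sum>i\<le>nparam p k. ennreal (?a i) + ennreal (?b i) * ennreal (s\<^sup>2))"
  proof (subst nn_integral_sum)
    show "(\<Sum>i\<le>nparam p k. \<integral>\<^sup>+\<omega>. ennreal (?a i) * ennreal (?v \<omega>)
        + ennreal (?b i) * (ennreal (?v \<omega>) * ennreal ((\<omega> i - m i)\<^sup>2)) \<partial>param_space p k)
      = (\<Sum>i\<le>nparam p k. ennreal (?a i) + ennreal (?b i) * ennreal (s\<^sup>2))"
    proof (rule sum.cong[OF refl])
      fix i assume i: "i \<in> {..nparam p k}"
      then have [measurable]: "(\<lambda>\<omega>. \<omega> i) \<in> borel_measurable (param_space p k)" by simp
      have "(\<integral>\<^sup>+\<omega>. ennreal (?v \<omega>) * ennreal ((\<omega> i - m i)\<^sup>2) \<partial>param_space p k) = ennreal (s\<^sup>2)"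
        using i s by (subst nn_integral_vdens_component[where g="\<lambda>x. ennreal ((x - m i)\<^sup>2)"]) (auto simp: nn_integral_normal_square)
      then show "(\<integral>\<^sup>+\<omega>. ennreal (?a i) * ennreal (?v \<omega>)
        + ennreal (?b i) * (ennreal (?v \<omega>) * ennreal ((\<omega> i - m i)\<^sup>2)) \<partial>param_space p k) = ennreal (?a i) + ennreal (?b i) * ennreal (s\<^sup>2)"
        using s by (subst nn_integral_add) (auto simp: nn_integral_cmult)
    qed
  qed auto
  also have "\<dots> = (\<Sum>i\<le>nparam p k. ennreal (?a i + ?b i * s\<^sup>2))"
    using a0 by (intro sum.cong refl) (simp only: ennreal_plus ennreal_mult mult_nonneg_nonneg zero_le_power2)
  also have "\<dots> = ennreal (\<Sum>i\<le>nparam p k. ?a i + ?b i * s\<^sup>2)"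
    by (intro sum_ennreal) (use a0 in auto)
  also have "(\<Sum>i\<le>nparam p k. ?a i + ?b i * s\<^sup>2) = (\<Sum>i\<le>nparam p k. \<bar>ln (t i / s)\<bar> + (m i)\<^sup>2 / (t i)\<^sup>2 + 1 / 2 + s\<^sup>2 / (t i)\<^sup>2)"
    using s by (intro sum.cong refl) (simp add: field_simps)
  finally show ?thesis .
qed

subsection \<open>The data-generating law\<close>

lemma prob_space_cube_unif: "prob_space (cube_unif p)"
  unfolding cube_unif_def
  by (intro prob_space_PiM prob_space_uniform_measure) auto

lemma sigma_finite_cube_unif: "sigma_finite_measure (cube_unif p)"
  by (rule prob_space_imp_sigma_finite[OF prob_space_cube_unif])

lemma measurable_cube_component [measurable]:
  "h < p \<Longrightarrow> (\<lambda>x. x h) \<in> borel_measurable (cube_unif p)"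
proof -
  assume "h < p"
  then have "(\<lambda>x. x h) \<in> measurable (cube_unif p) (uniform_measure lborel {0..1::real})"
    unfolding cube_unif_def by (intro measurable_component_singleton) simp
  then show ?thesis by (simp cong: measurable_cong_sets)
qed

text \<open>\<open>uniform_measure lborel {0..1}\<close> has the whole line as its space, so inputs
  lie in the cube only almost surely. Uses of the network's Lipschitz bound carry this null set
  along.\<close>

lemma AE_cube_unif: "AE x in cube_unif p. \<forall>h<p. 0 \<le> x h \<and> x h \<le> 1"
proof -
  have 1: "AE y in uniform_measure lborel {0..1::real}. 0 \<le> y \<and> y \<le> 1"
    by (rule AE_uniform_measureI) auto
  have "AE x in cube_unif p. 0 \<le> x h \<and> x h \<le> 1" if "h \<in> {..<p}" for h
    unfolding cube_unif_def
    by (rule AE_PiM_component[OF _ that 1]) (auto intro!: prob_space_uniform_measure)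
  then have "AE x in cube_unif p. \<forall>h\<in>{..<p}. 0 \<le> x h \<and> x h \<le> 1"
    by (intro AE_finite_allI) auto
  then show ?thesis by (simp add: Ball_def)
qed

lemma borel_measurable_net [measurable (raw)]:
  assumes t: "\<And>i. i < nparam p k \<Longrightarrow> (\<lambda>w. t w i) \<in> borel_measurable N"
    and x: "\<And>h. h < p \<Longrightarrow> (\<lambda>w. x w h) \<in> borel_measurable N"
  shows "(\<lambda>w. net p k (t w) (x w)) \<in> borel_measurable N"
proof -
  have 0: "0 < nparam p k" by (simp add: nparam_def)
  have idx: "1 + j < nparam p k" if "j < k" for j
  proof -
    have "k * 1 \<le> k * (p + 2)" by (intro mult_left_mono) auto
    then show ?thesis using that by (simp add: nparam_def)
  qed
  show ?thesis
    unfolding net_def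
  proof (intro borel_measurable_add borel_measurable_sum borel_measurable_times t 0
      measurable_compose[OF _ borel_measurable_sigmoid] x)
    fix j assume j: "j \<in> {..<k}"
    then show "1 + j < nparam p k" using idx by simp
    show "1 + k + j * (p + 1) < nparam p k"
      using nparam_weight_index[of j k 0 p] j by simp
    fix h assume h: "h \<in> {..<p}"
    then show "1 + k + j * (p + 1) + 1 + h < nparam p k"
      using nparam_weight_index[of j k "1 + h" p] j by simp
    show "h < p" using h by simp
  qed
qed

lemma abs_net_le: "\<bar>net p k \<theta> x\<bar> \<le> \<bar>\<theta> 0\<bar> + (\<Sum>j<k. \<bar>\<theta> (1 + j)\<bar>)"
  unfolding net_def
  by (intro order.trans[OF abs_triangle_ineq] add_mono order.refl order.trans[OF sum_abs] sum_mono)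
    (use sigmoid_bounds in \<open>auto simp: abs_mult intro!: mult_left_le\<close>)

text \<open>Parameter and observation may both depend on the variable, because exchanging the
  integrals over data and parameters requires joint measurability.\<close>

lemma borel_measurable_model_dens [measurable (raw)]:
  assumes w: "w \<in> measurable N (param_space p k)"
    and z: "z \<in> measurable N (lborel \<Otimes>\<^sub>M cube_unif p)"
  shows "(\<lambda>v. model_dens p k (w v) (z v)) \<in> borel_measurable N"
proof -
  have wi: "(\<lambda>v. w v i) \<in> borel_measurable N" if "i \<le> nparam p k" for i
    using measurable_compose[OF w measurable_param_component[OF that]] .
  have w0: "(\<lambda>v. w v 0) \<in> borel_measurable N" by (rule wi) simp
  have zi: "(\<lambda>v. fst (z v)) \<in> borel_measurable N" "(\<lambda>v. snd (z v)) \<in> measurable N (cube_unif p)"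
    using measurable_compose[OF z measurable_fst] measurable_compose[OF z measurable_snd] by simp_all
  have "(\<lambda>v. net p k (theta_of (w v)) (snd (z v))) \<in> borel_measurable N"
    using zi(2) by (intro borel_measurable_net) (auto simp: theta_of_def intro: wi measurable_compose)
  then show ?thesis
    unfolding model_dens_def normal_density_def
    using w0 zi(1) by measurable
qed

lemma borel_measurable_model_dens_data [measurable]:
  "model_dens p k \<omega> \<in> borel_measurable (lborel \<Otimes>\<^sub>M cube_unif p)"
  unfolding model_dens_def [abs_def] normal_density_def by measurable

lemma borel_measurable_true_dens:
  assumes [measurable]: "f0 \<in> borel_measurable (cube_unif p)"
  shows "true_dens f0 \<sigma> \<in> borel_measurable (lborel \<Otimes>\<^sub>M cube_unif p)"
  unfolding true_dens_def [abs_def] normal_density_def by measurable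

lemma model_dens_pos: "model_dens p k \<omega> z > 0"
  by (simp add: model_dens_def normal_density_pos)

lemma true_dens_pos: "\<sigma> > 0 \<Longrightarrow> true_dens f0 \<sigma> z > 0"
  by (simp add: true_dens_def normal_density_pos)

lemma nn_integral_data:
  assumes [measurable]: "F \<in> borel_measurable (lborel \<Otimes>\<^sub>M cube_unif p)"
  shows "(\<integral>\<^sup>+z. F z \<partial>(lborel \<Otimes>\<^sub>M cube_unif p)) = (\<integral>\<^sup>+x. \<integral>\<^sup>+y. F (y, x) \<partial>lborel \<partial>cube_unif p)"
proof -
  interpret pair_sigma_finite lborel "cube_unif p"
    by (intro pair_sigma_finite.intro sigma_finite_cube_unif) (rule lborel.sigma_finite_measure_axioms)
  show ?thesis
    by (rule nn_integral_snd[symmetric]) measurable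
qed

lemma nn_integral_true_dens:
  assumes [measurable]: "f0 \<in> borel_measurable (cube_unif p)" and "\<sigma> > 0"
  shows "(\<integral>\<^sup>+z. ennreal (true_dens f0 \<sigma> z) \<partial>(lborel \<Otimes>\<^sub>M cube_unif p)) = 1"
proof -
  interpret prob_space "cube_unif p" by (rule prob_space_cube_unif)
  have [measurable]: "true_dens f0 \<sigma> \<in> borel_measurable (lborel \<Otimes>\<^sub>M cube_unif p)"
    by (rule borel_measurable_true_dens) fact
  show ?thesis
    using assms(2) by (subst nn_integral_data, measurable) (simp add: true_dens_def emeasure_space_1)
qed

lemma nn_integral_model_dens:
  "(\<integral>\<^sup>+z. ennreal (model_dens p k \<omega> z) \<partial>(lborel \<Otimes>\<^sub>M cube_unif p)) = 1"
proof -
  interpret prob_space "cube_unif p" by (rule prob_space_cube_unif)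
  show ?thesis
    by (subst nn_integral_data, measurable) (simp add: model_dens_def emeasure_space_1)
qed

lemma sets_P0: "sets (P0 p f0 \<sigma>) = sets (lborel \<Otimes>\<^sub>M cube_unif p)"
  by (simp add: P0_def)

lemma prob_space_P0:
  assumes [measurable]: "f0 \<in> borel_measurable (cube_unif p)" and "\<sigma> > 0"
  shows "prob_space (P0 p f0 \<sigma>)"
proof
  have [measurable]: "true_dens f0 \<sigma> \<in> borel_measurable (lborel \<Otimes>\<^sub>M cube_unif p)"
    by (rule borel_measurable_true_dens) fact
  let ?Z = "lborel \<Otimes>\<^sub>M cube_unif p"
  have "emeasure (P0 p f0 \<sigma>) (space (P0 p f0 \<sigma>)) = (\<integral>\<^sup>+z. ennreal (true_dens f0 \<sigma> z) * indicator (space ?Z) z \<partial>?Z)"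
    unfolding P0_def space_density
    by (rule emeasure_density[OF measurable_compose[OF borel_measurable_true_dens[OF assms(1)] measurable_ennreal] sets.top])
  also have "\<dots> = (\<integral>\<^sup>+z. ennreal (true_dens f0 \<sigma> z) \<partial>?Z)"
    by (rule nn_integral_cong) simp
  also have "\<dots> = 1"
    by (rule nn_integral_true_dens[OF assms])
  finally show "emeasure (P0 p f0 \<sigma>) (space (P0 p f0 \<sigma>)) = 1" .
qed

lemma prob_space_P0n:
  assumes "f0 \<in> borel_measurable (cube_unif p)" and "\<sigma> > 0"
  shows "prob_space (P0n p f0 \<sigma> n)"
  unfolding P0n_def by (intro prob_space_PiM prob_space_P0 assms)

lemma nn_integral_P0:
  assumes [measurable]: "f0 \<in> borel_measurable (cube_unif p)" "F \<in> borel_measurable (lborel \<Otimes>\<^sub>M cube_unif p)"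
  shows "(\<integral>\<^sup>+z. F z \<partial>P0 p f0 \<sigma>) = (\<integral>\<^sup>+z. ennreal (true_dens f0 \<sigma> z) * F z \<partial>(lborel \<Otimes>\<^sub>M cube_unif p))"
proof -
  have [measurable]: "true_dens f0 \<sigma> \<in> borel_measurable (lborel \<Otimes>\<^sub>M cube_unif p)"
    by (rule borel_measurable_true_dens) fact
  show ?thesis unfolding P0_def by (rule nn_integral_density) measurable
qed

lemma nn_integral_P0n_prod:
  assumes f0: "f0 \<in> borel_measurable (cube_unif p)" and \<sigma>: "\<sigma> > 0"
    and [measurable]: "F \<in> borel_measurable (lborel \<Otimes>\<^sub>M cube_unif p)"
  shows "(\<integral>\<^sup>+D. (\<Prod>i<n. F (D i)) \<partial>P0n p f0 \<sigma> n) = (\<integral>\<^sup>+z. F z \<partial>P0 p f0 \<sigma>) ^ n"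
proof -
  interpret prob_space "P0 p f0 \<sigma>" by (rule prob_space_P0[OF f0 \<sigma>])
  interpret product_sigma_finite "\<lambda>_::nat. P0 p f0 \<sigma>" by standard
  have "(\<integral>\<^sup>+D. (\<Prod>i<n. F (D i)) \<partial>P0n p f0 \<sigma> n) = (\<Prod>i<n. \<integral>\<^sup>+z. F z \<partial>P0 p f0 \<sigma>)"
    unfolding P0n_def
  proof (rule product_nn_integral_prod)
    show "F \<in> borel_measurable (P0 p f0 \<sigma>)" for i :: nat
      using assms(3) by (simp add: sets_P0 cong: measurable_cong_sets)
  qed simp
  then show ?thesis by simp
qed

lemma measurable_P0n_component [measurable]:
  "i < n \<Longrightarrow> (\<lambda>D. D i) \<in> measurable (P0n p f0 \<sigma> n) (lborel \<Otimes>\<^sub>M cube_unif p)"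
proof -
  assume "i < n"
  then have "(\<lambda>D. D i) \<in> measurable (P0n p f0 \<sigma> n) (P0 p f0 \<sigma>)"
    unfolding P0n_def by (intro measurable_component_singleton) simp
  then show ?thesis by (simp add: sets_P0 cong: measurable_cong_sets)
qed

lemma AE_data_cube: "AE z in (lborel :: real measure) \<Otimes>\<^sub>M cube_unif p. \<forall>h<p. 0 \<le> snd z h \<and> snd z h \<le> 1"
proof -
  interpret pair_sigma_finite "lborel :: real measure" "cube_unif p"
    by (intro pair_sigma_finite.intro sigma_finite_cube_unif) (rule lborel.sigma_finite_measure_axioms)
  let ?Z = "(lborel :: real measure) \<Otimes>\<^sub>M cube_unif p"
  have 1: "(\<lambda>z. snd z h) \<in> borel_measurable ?Z" if "h < p" for h
    by (rule measurable_compose[OF measurable_snd measurable_cube_component[OF that]])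
  have m1: "{z \<in> space ?Z. \<forall>h\<in>{..<p}. 0 \<le> snd z h \<and> snd z h \<le> 1} \<in> sets ?Z"
  proof (rule sets.sets_Collect_finite_All)
    fix h assume "h \<in> {..<p}"
    then have [measurable]: "(\<lambda>z. snd z h) \<in> borel_measurable ?Z" using 1 by simp
    show "{z \<in> space ?Z. 0 \<le> snd z h \<and> snd z h \<le> 1} \<in> sets ?Z"
      by measurable
  qed simp
  have m2: "AE y in lborel :: real measure. AE x in cube_unif p. \<forall>h\<in>{..<p}. 0 \<le> snd (y, x) h \<and> snd (y, x) h \<le> 1"
    using AE_cube_unif[of p] by (simp only: snd_conv Ball_def lessThan_iff AE_I2)
  have "AE z in ?Z. \<forall>h\<in>{..<p}. 0 \<le> snd z h \<and> snd z h \<le> 1"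
    by (rule AE_pair_measure[OF m1 m2])
  then show ?thesis by (rule eventually_mono) auto
qed

lemma AE_P0n_cube:
  assumes f0: "f0 \<in> borel_measurable (cube_unif p)" and \<sigma>: "\<sigma> > 0"
  shows "AE D in P0n p f0 \<sigma> n. \<forall>i<n. \<forall>h<p. 0 \<le> snd (D i) h \<and> snd (D i) h \<le> 1"
proof -
  have [measurable]: "true_dens f0 \<sigma> \<in> borel_measurable (lborel \<Otimes>\<^sub>M cube_unif p)"
    by (rule borel_measurable_true_dens) fact
  have "AE z in lborel \<Otimes>\<^sub>M cube_unif p. 0 < ennreal (true_dens f0 \<sigma> z) \<longrightarrow> (\<forall>h<p. 0 \<le> snd z h \<and> snd z h \<le> 1)"
    using AE_data_cube by (rule eventually_mono) auto
  then have AE_P0: "AE z in P0 p f0 \<sigma>. \<forall>h<p. 0 \<le> snd z h \<and> snd z h \<le> 1"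
    unfolding P0_def by (subst AE_density) measurable
  have "AE D in P0n p f0 \<sigma> n. \<forall>h<p. 0 \<le> snd (D i) h \<and> snd (D i) h \<le> 1" if "i \<in> {..<n}" for i
    unfolding P0n_def by (rule AE_PiM_component[OF _ that AE_P0]) (rule prob_space_P0[OF f0 \<sigma>])
  then have "AE D in P0n p f0 \<sigma> n. \<forall>i\<in>{..<n}. \<forall>h<p. 0 \<le> snd (D i) h \<and> snd (D i) h \<le> 1"
    by (intro AE_finite_allI) auto
  then show ?thesis by (simp add: Ball_def)
qed

text \<open>Under the truth (y - f0 x)^2 has mean \<sigma>0^2. The scale error thus contributes e -
  1 from the constant term and half of that from the quadratic one, which makes the 3/2.\<close>

lemma nn_integral_P0_abs_ln_ratio_le:
  fixes \<rho>0 :: real and \<omega> :: "nat \<Rightarrow> real"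
  assumes f0 [measurable]: "f0 \<in> borel_measurable (cube_unif p)"
    and \<tau>: "\<tau> > 0" and G: "G \<ge> 0"
    and G_bound: "(\<integral>\<^sup>+x. ennreal ((f0 x - net p k (theta_of \<omega>) x)\<^sup>2) \<partial>cube_unif p) \<le> ennreal G"
  defines "\<sigma>0 \<equiv> softplus \<rho>0" and "e \<equiv> exp (2 * \<bar>\<omega> 0 - \<rho>0\<bar>)"
  shows "(\<integral>\<^sup>+z. ennreal \<bar>ln (true_dens f0 \<sigma>0 z / model_dens p k \<omega> z)\<bar> \<partial>P0 p f0 \<sigma>0)
    \<le> ennreal (3 / 2 * (e - 1) + e * (\<tau> / 2 + (1 + 1 / \<tau>) * G / (2 * \<sigma>0\<^sup>2)))"
proof -
  interpret prob_space "cube_unif p" by (rule prob_space_cube_unif)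
  have \<sigma>0: "\<sigma>0 > 0" by (simp add: \<sigma>0_def)
  have e: "e \<ge> 1" by (simp add: e_def)
  have [measurable]: "true_dens f0 \<sigma>0 \<in> borel_measurable (lborel \<Otimes>\<^sub>M cube_unif p)"
    by (rule borel_measurable_true_dens) fact
  define g where "g = (\<lambda>x. (f0 x - net p k (theta_of \<omega>) x)\<^sup>2)"
  have [measurable]: "g \<in> borel_measurable (cube_unif p)" unfolding g_def by measurable
  define c1 c2 c3 where "c1 = e - 1" and "c2 = ((e - 1) + e * \<tau>) / (2 * \<sigma>0\<^sup>2)"
    and "c3 = e * (1 + 1 / \<tau>) / (2 * \<sigma>0\<^sup>2)"
  have c: "c1 \<ge> 0" "c2 \<ge> 0" "c3 \<ge> 0"
    using e \<tau> by (auto simp: c1_def c2_def c3_def)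
  have "(\<integral>\<^sup>+z. ennreal \<bar>ln (true_dens f0 \<sigma>0 z / model_dens p k \<omega> z)\<bar> \<partial>P0 p f0 \<sigma>0)
    = (\<integral>\<^sup>+z. ennreal (true_dens f0 \<sigma>0 z) * ennreal \<bar>ln (true_dens f0 \<sigma>0 z / model_dens p k \<omega> z)\<bar> \<partial>(lborel \<Otimes>\<^sub>M cube_unif p))"
    by (rule nn_integral_P0) measurable
  also have "\<dots> = (\<integral>\<^sup>+x. \<integral>\<^sup>+y. ennreal (true_dens f0 \<sigma>0 (y, x)) * ennreal \<bar>ln (true_dens f0 \<sigma>0 (y, x) / model_dens p k \<omega> (y, x))\<bar> \<partial>lborel \<partial>cube_unif p)"
    by (rule nn_integral_data) measurable
  also have "\<dots> \<le> (\<integral>\<^sup>+x. ennreal (c1 + c2 * \<sigma>0\<^sup>2) + ennreal c3 * ennreal (g x) \<partial>cube_unif p)"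
  proof (rule nn_integral_mono)
    fix x
    let ?N = "\<lambda>y. normal_density (f0 x) \<sigma>0 y"
    have "(\<integral>\<^sup>+y. ennreal (true_dens f0 \<sigma>0 (y, x)) * ennreal \<bar>ln (true_dens f0 \<sigma>0 (y, x) / model_dens p k \<omega> (y, x))\<bar> \<partial>lborel)
      \<le> (\<integral>\<^sup>+y. ennreal (c1 + c3 * g x) * ennreal (?N y) + ennreal c2 * (ennreal (?N y) * ennreal ((y - f0 x)\<^sup>2)) \<partial>lborel)"
    proof (rule nn_integral_mono)
      fix y
      have "\<bar>ln (true_dens f0 \<sigma>0 (y, x) / model_dens p k \<omega> (y, x))\<bar>
        \<le> c1 + c3 * g x + c2 * (y - f0 x)\<^sup>2"
        using abs_ln_normal_density_ratio_le[OF \<sigma>0 softplus_pos \<tau>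
            ln_softplus_lipschitz[of "\<omega> 0" \<rho>0, folded \<sigma>0_def], of "f0 x" y "net p k (theta_of \<omega>) x"]
        by (simp add: true_dens_def model_dens_def c1_def c2_def c3_def g_def e_def[symmetric]
            add_divide_distrib diff_divide_distrib algebra_simps)
      then have "?N y * \<bar>ln (true_dens f0 \<sigma>0 (y, x) / model_dens p k \<omega> (y, x))\<bar>
        \<le> ?N y * (c1 + c3 * g x + c2 * (y - f0 x)\<^sup>2)"
        by (intro mult_left_mono) auto
      also have "\<dots> = (c1 + c3 * g x) * ?N y + c2 * (?N y * (y - f0 x)\<^sup>2)"
        by (simp add: algebra_simps)
      finally have "ennreal (?N y * \<bar>ln (true_dens f0 \<sigma>0 (y, x) / model_dens p k \<omega> (y, x))\<bar>)
         \<le> ennreal ((c1 + c3 * g x) * ?N y + c2 * (?N y * (y - f0 x)\<^sup>2))"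
        by (rule ennreal_leI)
      then show "ennreal (true_dens f0 \<sigma>0 (y, x)) * ennreal \<bar>ln (true_dens f0 \<sigma>0 (y, x) / model_dens p k \<omega> (y, x))\<bar>
        \<le> ennreal (c1 + c3 * g x) * ennreal (?N y) + ennreal c2 * (ennreal (?N y) * ennreal ((y - f0 x)\<^sup>2))"
        using c by (simp add: true_dens_def ennreal_mult[symmetric] ennreal_plus[symmetric] g_def del: ennreal_plus)
    qed
    also have "\<dots> = ennreal (c1 + c3 * g x) + ennreal c2 * ennreal (\<sigma>0\<^sup>2)"
      using \<sigma>0 by (subst nn_integral_add) (auto simp: nn_integral_cmult nn_integral_normal_square)
    also have "\<dots> = ennreal (c1 + c2 * \<sigma>0\<^sup>2) + ennreal c3 * ennreal (g x)"
      using c by (simp add: ennreal_mult[symmetric] ennreal_plus[symmetric] g_def algebra_simps del: ennreal_plus)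
    finally show "(\<integral>\<^sup>+y. ennreal (true_dens f0 \<sigma>0 (y, x)) * ennreal \<bar>ln (true_dens f0 \<sigma>0 (y, x) / model_dens p k \<omega> (y, x))\<bar> \<partial>lborel)
      \<le> ennreal (c1 + c2 * \<sigma>0\<^sup>2) + ennreal c3 * ennreal (g x)" .
  qed
  also have "\<dots> = ennreal (c1 + c2 * \<sigma>0\<^sup>2) + ennreal c3 * (\<integral>\<^sup>+x. ennreal (g x) \<partial>cube_unif p)"
    by (subst nn_integral_add) (auto simp: nn_integral_cmult emeasure_space_1)
  also have "\<dots> \<le> ennreal (c1 + c2 * \<sigma>0\<^sup>2) + ennreal c3 * ennreal G"
    using G_bound unfolding g_def by (intro add_left_mono mult_left_mono) auto
  also have "\<dots> = ennreal (c1 + c2 * \<sigma>0\<^sup>2 + c3 * G)"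
    using c G by (simp add: ennreal_mult[symmetric] ennreal_plus[symmetric] del: ennreal_plus)
  also have "c1 + c2 * \<sigma>0\<^sup>2 + c3 * G = 3 / 2 * (e - 1) + e * (\<tau> / 2 + (1 + 1 / \<tau>) * G / (2 * \<sigma>0\<^sup>2))"
    using \<sigma>0 by (simp add: c1_def c2_def c3_def add_divide_distrib diff_divide_distrib algebra_simps)
  finally show ?thesis .
qed

text \<open>Integrability has to be checked: otherwise L2norm would be the junk value 0.\<close>
lemma nn_integral_net_error:
  assumes f0 [measurable]: "f0 \<in> borel_measurable (cube_unif p)"
    and f0_sq: "integrable (cube_unif p) (\<lambda>x. (f0 x)\<^sup>2)"
  shows "(\<integral>\<^sup>+x. ennreal ((f0 x - net p k \<theta> x)\<^sup>2) \<partial>cube_unif p) = ennreal ((L2norm p (\<lambda>x. net p k \<theta> x - f0 x))\<^sup>2)"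
proof -
  interpret prob_space "cube_unif p" by (rule prob_space_cube_unif)
  define C where "C = \<bar>\<theta> 0\<bar> + (\<Sum>j<k. \<bar>\<theta> (1 + j)\<bar>)"
  have "integrable (cube_unif p) (\<lambda>x. (net p k \<theta> x - f0 x)\<^sup>2)"
  proof (rule Bochner_Integration.integrable_bound)
    show "integrable (cube_unif p) (\<lambda>x. 2 * C\<^sup>2 + 2 * (f0 x)\<^sup>2)"
      using f0_sq by simp
    show "AE x in cube_unif p. norm ((net p k \<theta> x - f0 x)\<^sup>2) \<le> norm (2 * C\<^sup>2 + 2 * (f0 x)\<^sup>2)"
    proof (rule AE_I2)
      fix x
      have "(net p k \<theta> x)\<^sup>2 \<le> C\<^sup>2"
        using power_mono[OF abs_net_le[of p k \<theta> x, folded C_def], of 2] by simp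
      then show "norm ((net p k \<theta> x - f0 x)\<^sup>2) \<le> norm (2 * C\<^sup>2 + 2 * (f0 x)\<^sup>2)"
        using square_sum_le_weighted[of 1 "net p k \<theta> x" "- f0 x"] by simp
    qed
  qed measurable
  then have "(\<integral>\<^sup>+x. ennreal ((net p k \<theta> x - f0 x)\<^sup>2) \<partial>cube_unif p) = ennreal (\<integral>x. (net p k \<theta> x - f0 x)\<^sup>2 \<partial>cube_unif p)"
    by (intro nn_integral_eq_integral) auto
  then show ?thesis
    by (simp add: L2norm_def power2_commute)
qed

text \<open>The Euclidean norm sqrt S of the shift dominates every coordinate, so
  \<open>net_lipschitz\<close> applies with it. Its square is a sum of coordinate squares, which a
  product of normal densities integrates to variances; the maximum over the coordinates has no such
  formula.\<close>

lemma nn_integral_net_perturbed_error_le: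
  assumes f0 [measurable]: "f0 \<in> borel_measurable (cube_unif p)"
    and f0_sq: "integrable (cube_unif p) (\<lambda>x. (f0 x)\<^sup>2)"
    and B: "\<And>i. i < nparam p k \<Longrightarrow> \<bar>\<theta> i\<bar> \<le> B"
  shows "(\<integral>\<^sup>+x. ennreal ((f0 x - net p k (theta_of \<omega>) x)\<^sup>2) \<partial>cube_unif p)
    \<le> ennreal (2 * (L2norm p (\<lambda>x. net p k \<theta> x - f0 x))\<^sup>2
        + 2 * (real (nparam p k) * (1 + B))\<^sup>2 * (\<Sum>i<nparam p k. (\<omega> (Suc i) - \<theta> i)\<^sup>2))"
proof -
  interpret prob_space "cube_unif p" by (rule prob_space_cube_unif)
  define S where "S = (\<Sum>i<nparam p k. (\<omega> (Suc i) - \<theta> i)\<^sup>2)"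
  define H where "H = (real (nparam p k) * (1 + B))\<^sup>2"
  have S: "S \<ge> 0" unfolding S_def by (intro sum_nonneg) auto
  have "(\<integral>\<^sup>+x. ennreal ((f0 x - net p k (theta_of \<omega>) x)\<^sup>2) \<partial>cube_unif p)
    \<le> (\<integral>\<^sup>+x. ennreal 2 * ennreal ((f0 x - net p k \<theta> x)\<^sup>2) + ennreal (2 * (H * S)) \<partial>cube_unif p)"
  proof (rule nn_integral_mono_AE, use AE_cube_unif[of p] in eventually_elim)
    case (elim x)
    have "\<bar>net p k (theta_of \<omega>) x - net p k \<theta> x\<bar> \<le> real (nparam p k) * (1 + B) * sqrt S"
    proof (rule net_lipschitz)
      fix i assume "i < nparam p k"
      then have "(\<omega> (Suc i) - \<theta> i)\<^sup>2 \<le> S"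
        unfolding S_def by (intro member_le_sum) auto
      then show "\<bar>theta_of \<omega> i - \<theta> i\<bar> \<le> sqrt S"
        by (simp add: theta_of_def real_le_rsqrt)
    qed (use elim B in auto)
    from power_mono[OF this, of 2] have "(net p k (theta_of \<omega>) x - net p k \<theta> x)\<^sup>2 \<le> H * S"
      using S by (simp add: H_def power_mult_distrib)
    moreover have "(f0 x - net p k (theta_of \<omega>) x)\<^sup>2 \<le> 2 * (f0 x - net p k \<theta> x)\<^sup>2 + 2 * (net p k (theta_of \<omega>) x - net p k \<theta> x)\<^sup>2"
      using square_sum_le_weighted[of 1 "f0 x - net p k \<theta> x" "net p k \<theta> x - net p k (theta_of \<omega>) x"]
      by (simp add: power2_commute[of "net p k \<theta> x"])
    ultimately have "(f0 x - net p k (theta_of \<omega>) x)\<^sup>2 \<le> 2 * (f0 x - net p k \<theta> x)\<^sup>2 + 2 * (H * S)"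
      by linarith
    then have "ennreal ((f0 x - net p k (theta_of \<omega>) x)\<^sup>2) \<le> ennreal (2 * (f0 x - net p k \<theta> x)\<^sup>2 + 2 * (H * S))"
      by (rule ennreal_leI)
    also have "\<dots> = ennreal 2 * ennreal ((f0 x - net p k \<theta> x)\<^sup>2) + ennreal (2 * (H * S))"
      using S by (subst ennreal_plus) (auto simp: ennreal_mult H_def)
    finally show ?case .
  qed
  also have "\<dots> = ennreal 2 * ennreal ((L2norm p (\<lambda>x. net p k \<theta> x - f0 x))\<^sup>2) + ennreal (2 * (H * S))"
    by (subst nn_integral_add)
      (auto simp: nn_integral_cmult emeasure_space_1 nn_integral_net_error[OF f0 f0_sq] simp del: ennreal_numeral)
  also have "\<dots> = ennreal (2 * (L2norm p (\<lambda>x. net p k \<theta> x - f0 x))\<^sup>2 + 2 * H * S)"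
    using S by (subst ennreal_plus) (auto simp: ennreal_mult H_def mult.assoc)
  finally show ?thesis by (simp add: H_def S_def)
qed

subsection \<open>The variational inequality\<close>

text \<open>Dividing by the truth leaves the posterior unchanged, as the factor is free of \<omega>,
  and gives a quantity of mean 1 under the truth for every \<omega>.\<close>

definition lratio :: "nat \<Rightarrow> nat \<Rightarrow> ((nat \<Rightarrow> real) \<Rightarrow> real) \<Rightarrow> real \<Rightarrow> nat
    \<Rightarrow> (nat \<Rightarrow> real \<times> (nat \<Rightarrow> real)) \<Rightarrow> (nat \<Rightarrow> real) \<Rightarrow> real" where
  "lratio p k f0 \<sigma> n D \<omega> = (\<Prod>i<n. model_dens p k \<omega> (D i) / true_dens f0 \<sigma> (D i))"

lemma lratio_pos: "\<sigma> > 0 \<Longrightarrow> lratio p k f0 \<sigma> n D \<omega> > 0"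
  by (simp add: lratio_def prod_pos model_dens_pos true_dens_pos)

lemma lik_eq_lratio:
  assumes "\<sigma> > 0"
  shows "lik p k n D \<omega> = (\<Prod>i<n. true_dens f0 \<sigma> (D i)) * lratio p k f0 \<sigma> n D \<omega>"
proof -
  have "true_dens f0 \<sigma> z \<noteq> 0" for z using true_dens_pos[OF assms, of f0 z] by simp
  then show ?thesis by (simp add: lik_def lratio_def prod.distrib[symmetric])
qed

lemma borel_measurable_lratio:
  assumes f0: "f0 \<in> borel_measurable (cube_unif p)"
    and w: "w \<in> measurable N (param_space p k)"
    and d: "d \<in> measurable N (P0n p f0 \<sigma> n)"
  shows "(\<lambda>v. lratio p k f0 \<sigma> n (d v) (w v)) \<in> borel_measurable N"
  unfolding lratio_def
proof (intro borel_measurable_prod borel_measurable_divide)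
  fix i assume "i \<in> {..<n}"
  then have di: "(\<lambda>v. d v i) \<in> measurable N (lborel \<Otimes>\<^sub>M cube_unif p)"
    using measurable_compose[OF d measurable_P0n_component] by simp
  show "(\<lambda>v. model_dens p k (w v) (d v i)) \<in> borel_measurable N"
    by (rule borel_measurable_model_dens[OF w di])
  show "(\<lambda>v. true_dens f0 \<sigma> (d v i)) \<in> borel_measurable N"
    by (rule measurable_compose[OF di borel_measurable_true_dens[OF f0]])
qed

text \<open>Comparing with the unnormalised weight r makes a lower bound for the evidence unnecessary.\<close>
lemma variational_tail_bound:
  fixes q q0 r :: "'a \<Rightarrow> real"
  assumes meas [measurable]: "q \<in> borel_measurable M" "q0 \<in> borel_measurable M" "A \<in> sets M"
    and pos: "\<And>\<omega>. q \<omega> > 0" "\<And>\<omega>. q0 \<omega> > 0" "\<And>\<omega>. r \<omega> > 0"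
    and q: "(\<integral>\<^sup>+\<omega>. ennreal (q \<omega>) \<partial>M) = 1" and q0: "(\<integral>\<^sup>+\<omega>. ennreal (q0 \<omega>) \<partial>M) = 1"
    and r: "integrable M r"
    and min: "dKL M q (\<lambda>\<omega>. r \<omega> / integral\<^sup>L M r) \<le> dKL M q0 (\<lambda>\<omega>. r \<omega> / integral\<^sup>L M r)"
    and int: "integrable M (\<lambda>\<omega>. q0 \<omega> * ln (q0 \<omega> / r \<omega>))"
  shows "t * (\<integral>\<omega>. q \<omega> * indicator A \<omega> \<partial>M)
    \<le> (\<integral>\<omega>. q0 \<omega> * ln (q0 \<omega> / r \<omega>) \<partial>M) + (\<integral>\<omega>. r \<omega> \<partial>M) + exp t * (\<integral>\<omega>. r \<omega> * indicator A \<omega> \<partial>M)"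
proof -
  define z where "z = integral\<^sup>L M r"
  have q_int: "integrable M q" "integral\<^sup>L M q = 1"
    and q0_int: "integrable M q0" "integral\<^sup>L M q0 = 1"
    using q q0 pos by (auto simp: integrable_iff_bounded integral_eq_nn_integral less_imp_le)
  \<comment> \<open>\<open>r\<close> is positive everywhere, so z = 0 would make M a null measure,
    against the total mass 1 of \<open>q\<close>.\<close>
  have z: "z > 0"
  proof -
    have "z \<ge> 0" unfolding z_def using pos(3) by (intro integral_nonneg_AE) (auto simp: less_imp_le)
    moreover have "z \<noteq> 0"
    proof
      assume "z = 0"
      then have "AE \<omega> in M. r \<omega> = 0"
        using integral_nonneg_eq_0_iff_AE[OF r] pos(3) by (auto simp: z_def less_imp_le)
      then have "AE \<omega> in M. q \<omega> = 0"
        by (rule eventually_mono) (use pos(3) in \<open>metis less_irrefl\<close>)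
      then have "integral\<^sup>L M q = integral\<^sup>L M (\<lambda>_. 0)"
        by (intro integral_cong_AE) auto
      then show False using q_int by simp
    qed
    ultimately show ?thesis by simp
  qed
  \<comment> \<open>As \<open>q\<close> and \<open>q0\<close> both have mass 1, ln z enters the two
    divergences as the same additive constant and cancels.\<close>
  have ln_shift: "f \<omega> * ln (f \<omega> / (r \<omega> / z)) = f \<omega> * ln (f \<omega> / r \<omega>) + ln z * f \<omega>" if "f \<omega> > 0" for f \<omega>
    using that pos(3)[of \<omega>] z by (simp add: ln_div ln_mult algebra_simps)
  have int0: "integrable M (\<lambda>\<omega>. q0 \<omega> * ln (q0 \<omega> / (r \<omega> / z)))"
    and KL0: "(\<integral>\<omega>. q0 \<omega> * ln (q0 \<omega> / (r \<omega> / z)) \<partial>M) = (\<integral>\<omega>. q0 \<omega> * ln (q0 \<omega> / r \<omega>) \<partial>M) + ln z"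
    unfolding ln_shift[of q0, OF pos(2)] using int q0_int by simp_all
  have "dKL M q (\<lambda>\<omega>. r \<omega> / z) \<le> ereal (\<integral>\<omega>. q0 \<omega> * ln (q0 \<omega> / (r \<omega> / z)) \<partial>M)"
    using min int0 by (simp add: dKL_def z_def)
  \<comment> \<open>\<open>dKL\<close> is infinite exactly when its integrand is not integrable, so
    a finite value at the competitor forces integrability at the minimiser.\<close>
  then have int1: "integrable M (\<lambda>\<omega>. q \<omega> * ln (q \<omega> / (r \<omega> / z)))"
    and KL1: "(\<integral>\<omega>. q \<omega> * ln (q \<omega> / (r \<omega> / z)) \<partial>M) \<le> (\<integral>\<omega>. q0 \<omega> * ln (q0 \<omega> / (r \<omega> / z)) \<partial>M)"
    by (auto simp: dKL_def split: if_splits)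
  have rA: "integrable M (\<lambda>\<omega>. r \<omega> * indicator A \<omega>)" and qA: "integrable M (\<lambda>\<omega>. q \<omega> * indicator A \<omega>)"
    using r q_int meas(3) by (auto intro: integrable_real_mult_indicator)
  have pw: "t * (q \<omega> * indicator A \<omega>)
    \<le> (q \<omega> * ln (q \<omega> / (r \<omega> / z)) - ln z * q \<omega>) + r \<omega> + exp t * (r \<omega> * indicator A \<omega>) - q \<omega>" for \<omega>
  proof -
    \<comment> \<open>The Donsker-Varadhan inequality in pointwise form, for the test function that
      is t on \<open>A\<close> and 0 elsewhere.\<close>
    define h :: real where "h = t * indicator A \<omega>"
    have "ln (exp h * r \<omega> / q \<omega>) \<le> exp h * r \<omega> / q \<omega> - 1"
      using pos by (intro ln_le_minus_one) auto
    then have "q \<omega> * ln (exp h * r \<omega> / q \<omega>) \<le> q \<omega> * (exp h * r \<omega> / q \<omega> - 1)"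
      using pos(1)[of \<omega>] by (intro mult_left_mono) auto
    moreover have "q \<omega> * ln (exp h * r \<omega> / q \<omega>) = h * q \<omega> - q \<omega> * ln (q \<omega> / r \<omega>)"
      using pos(1)[of \<omega>] pos(3)[of \<omega>] by (simp add: ln_div ln_mult algebra_simps)
    moreover have "q \<omega> * (exp h * r \<omega> / q \<omega> - 1) = exp h * r \<omega> - q \<omega>"
      using pos(1)[of \<omega>] by (simp add: algebra_simps)
    moreover have "exp h * r \<omega> \<le> r \<omega> + exp t * (r \<omega> * indicator A \<omega>)"
      using pos(3)[of \<omega>] by (cases "\<omega> \<in> A") (auto simp: h_def)
    ultimately have "h * q \<omega> \<le> q \<omega> * ln (q \<omega> / r \<omega>) + r \<omega> + exp t * (r \<omega> * indicator A \<omega>) - q \<omega>"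
      by linarith
    then show ?thesis
      unfolding ln_shift[of q, OF pos(1)] by (simp add: h_def mult_ac)
  qed
  have "(\<integral>\<omega>. t * (q \<omega> * indicator A \<omega>) \<partial>M)
    \<le> (\<integral>\<omega>. (q \<omega> * ln (q \<omega> / (r \<omega> / z)) - ln z * q \<omega>) + r \<omega> + exp t * (r \<omega> * indicator A \<omega>) - q \<omega> \<partial>M)"
    by (intro integral_mono pw Bochner_Integration.integrable_add Bochner_Integration.integrable_diff
        integrable_mult_right int1 q_int r rA qA)
  also have "\<dots> = (\<integral>\<omega>. q \<omega> * ln (q \<omega> / (r \<omega> / z)) \<partial>M) - ln z + (\<integral>\<omega>. r \<omega> \<partial>M) + exp t * (\<integral>\<omega>. r \<omega> * indicator A \<omega> \<partial>M) - 1"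
    using int1 q_int r rA by simp
  finally show ?thesis
    using KL0 KL1 by simp
qed

definition weight :: "nat \<Rightarrow> nat \<Rightarrow> ((nat \<Rightarrow> real) \<Rightarrow> real) \<Rightarrow> real \<Rightarrow> real \<Rightarrow> real \<Rightarrow> nat
    \<Rightarrow> (nat \<Rightarrow> real \<times> (nat \<Rightarrow> real)) \<Rightarrow> (nat \<Rightarrow> real) \<Rightarrow> real" where
  "weight p k f0 \<sigma> \<eta> \<zeta> n D \<omega> = lratio p k f0 \<sigma> n D \<omega> * prior_dens p k \<eta> \<zeta> \<omega>"

lemma prior_scale_pos: "\<eta> > 0 \<Longrightarrow> \<zeta> > 0 \<Longrightarrow> prior_scale \<eta> \<zeta> i > 0"
  by (simp add: prior_scale_def)

lemma prior_dens_pos: "\<eta> > 0 \<Longrightarrow> \<zeta> > 0 \<Longrightarrow> prior_dens p k \<eta> \<zeta> \<omega> > 0"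
  by (simp add: prior_dens_eq_vdens vdens_pos prior_scale_pos)

lemma borel_measurable_prior_dens [measurable]: "prior_dens p k \<eta> \<zeta> \<in> borel_measurable (param_space p k)"
  by (simp add: prior_dens_eq_vdens)

lemma weight_pos: "\<sigma> > 0 \<Longrightarrow> \<eta> > 0 \<Longrightarrow> \<zeta> > 0 \<Longrightarrow> weight p k f0 \<sigma> \<eta> \<zeta> n D \<omega> > 0"
  by (simp add: weight_def lratio_pos prior_dens_pos)

lemma borel_measurable_weight:
  assumes f0: "f0 \<in> borel_measurable (cube_unif p)"
    and w: "w \<in> measurable N (param_space p k)"
    and d: "d \<in> measurable N (P0n p f0 \<sigma> n)"
  shows "(\<lambda>v. weight p k f0 \<sigma> \<eta> \<zeta> n (d v) (w v)) \<in> borel_measurable N"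
  unfolding weight_def
  by (intro borel_measurable_times borel_measurable_lratio assms measurable_compose[OF w borel_measurable_prior_dens])

lemma post_dens_eq_weight:
  assumes "\<sigma> > 0"
  shows "post_dens p k \<eta> \<zeta> n D = (\<lambda>\<omega>. weight p k f0 \<sigma> \<eta> \<zeta> n D \<omega> / integral\<^sup>L (param_space p k) (weight p k f0 \<sigma> \<eta> \<zeta> n D))"
proof -
  define L where "L = (\<Prod>i<n. true_dens f0 \<sigma> (D i))"
  have L: "L > 0" unfolding L_def using assms by (intro prod_pos) (simp add: true_dens_pos)
  have eq: "lik p k n D \<omega> * prior_dens p k \<eta> \<zeta> \<omega> = L * weight p k f0 \<sigma> \<eta> \<zeta> n D \<omega>" for \<omega>
    unfolding weight_def lik_eq_lratio[OF assms, of p k n D \<omega> f0] L_def by simp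
  show ?thesis
    unfolding post_dens_def eq using L by (simp add: fun_eq_iff)
qed

text \<open>The right side contains the competitor and the weight but neither m nor s. Written with
  nonnegative integrals it is measurable in the data, which prepares Markov's inequality; the
  finiteness conditions then hold for all data outside a small exceptional set.\<close>

lemma vmeasure_tail_bound:
  fixes m0 :: "nat \<Rightarrow> real"
  assumes f0: "f0 \<in> borel_measurable (cube_unif p)"
    and \<sigma>: "\<sigma> > 0" and \<eta>: "\<eta> > 0" and \<zeta>: "\<zeta> > 0" and t: "t \<ge> 0"
    and D: "D \<in> space (P0n p f0 \<sigma> n)"
    and vb: "vb_minimizer p k \<eta> \<zeta> n D m s"
    and s0: "\<And>i. i \<le> nparam p k \<Longrightarrow> s0 i > 0"
  defines "w \<equiv> weight p k f0 \<sigma> \<eta> \<zeta> n D" and "q0 \<equiv> vdens p k m0 s0" and "N \<equiv> param_space p k"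
  assumes fin: "(\<integral>\<^sup>+\<omega>. ennreal (q0 \<omega>) * ennreal \<bar>ln (q0 \<omega> / w \<omega>)\<bar> \<partial>N) < \<infinity>" "(\<integral>\<^sup>+\<omega>. ennreal (w \<omega>) \<partial>N) < \<infinity>"
  shows "ennreal (t * measure (vmeasure p k m s) A)
    \<le> (\<integral>\<^sup>+\<omega>. ennreal (q0 \<omega>) * ennreal \<bar>ln (q0 \<omega> / w \<omega>)\<bar> \<partial>N) + (\<integral>\<^sup>+\<omega>. ennreal (w \<omega>) \<partial>N)
      + ennreal (exp t) * (\<integral>\<^sup>+\<omega>. ennreal (w \<omega>) * indicator A \<omega> \<partial>N)"
proof (cases "A \<in> sets N")
  \<comment> \<open>\<open>measure\<close> takes the default value 0 off the sigma-algebra, so the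
    bound is trivial there.\<close>
  case False
  then have "measure (vmeasure p k m s) A = 0"
    by (simp add: measure_notin_sets vmeasure_def N_def)
  then show ?thesis by simp
next
  case A: True
  have s: "s i > 0" if "i \<le> nparam p k" for i using vb that by (simp add: vb_minimizer_def)
  let ?q = "vdens p k m s"
  have [measurable]: "?q \<in> borel_measurable N" "q0 \<in> borel_measurable N" by (simp_all add: q0_def N_def)
  have w_meas [measurable]: "w \<in> borel_measurable N"
    unfolding w_def N_def using borel_measurable_weight[OF f0 measurable_ident_sets[OF refl] measurable_const[OF D]] by simp
  have q_pos: "?q \<omega> > 0" "q0 \<omega> > 0" "w \<omega> > 0" for \<omega>
    using s s0 \<sigma> \<eta> \<zeta> by (auto simp: q0_def w_def intro!: vdens_pos weight_pos)
  have q1: "(\<integral>\<^sup>+\<omega>. ennreal (?q \<omega>) \<partial>N) = 1" "(\<integral>\<^sup>+\<omega>. ennreal (q0 \<omega>) \<partial>N) = 1"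
    using s s0 by (simp_all add: N_def q0_def)
  have w_int: "integrable N w"
    using fin(2) q_pos(3) by (intro integrableI_bounded) (auto simp: less_imp_le)
  have absint: "(\<integral>\<^sup>+\<omega>. ennreal (norm (q0 \<omega> * ln (q0 \<omega> / w \<omega>))) \<partial>N) = (\<integral>\<^sup>+\<omega>. ennreal (q0 \<omega>) * ennreal \<bar>ln (q0 \<omega> / w \<omega>)\<bar> \<partial>N)"
    using q_pos(2) by (intro nn_integral_cong) (simp add: abs_mult ennreal_mult less_imp_le)
  have int: "integrable N (\<lambda>\<omega>. q0 \<omega> * ln (q0 \<omega> / w \<omega>))"
    using fin(1) absint by (intro integrableI_bounded) auto
  have "dKL N ?q (\<lambda>\<omega>. w \<omega> / integral\<^sup>L N w) \<le> dKL N q0 (\<lambda>\<omega>. w \<omega> / integral\<^sup>L N w)"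
    using vb s0 unfolding vb_minimizer_def post_dens_eq_weight[OF \<sigma>, of p k \<eta> \<zeta> n D f0] w_def N_def q0_def by blast
  note bound = variational_tail_bound[OF _ _ A q_pos q1 w_int this int, of t]
  have "measure (vmeasure p k m s) A = (\<integral>\<omega>. ?q \<omega> * indicator A \<omega> \<partial>N)"
  proof -
    have "emeasure (vmeasure p k m s) A = (\<integral>\<^sup>+\<omega>. ennreal (?q \<omega>) * indicator A \<omega> \<partial>N)"
      unfolding vmeasure_def using A by (subst emeasure_density) (auto simp: N_def)
    also have "\<dots> = (\<integral>\<^sup>+\<omega>. ennreal (?q \<omega> * indicator A \<omega>) \<partial>N)"
      by (intro nn_integral_cong) (auto simp: indicator_def)
    finally show ?thesis
      unfolding measure_def using A q_pos(1)
      by (subst integral_eq_nn_integral) (auto simp: less_imp_le)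
  qed
  then have "t * measure (vmeasure p k m s) A \<le> (\<integral>\<omega>. q0 \<omega> * ln (q0 \<omega> / w \<omega>) \<partial>N) + (\<integral>\<omega>. w \<omega> \<partial>N) + exp t * (\<integral>\<omega>. w \<omega> * indicator A \<omega> \<partial>N)"
    using bound by simp
  also have "(\<integral>\<omega>. q0 \<omega> * ln (q0 \<omega> / w \<omega>) \<partial>N) \<le> (\<integral>\<omega>. norm (q0 \<omega> * ln (q0 \<omega> / w \<omega>)) \<partial>N)"
    using int by (intro integral_mono) auto
  finally have "ennreal (t * measure (vmeasure p k m s) A)
     \<le> ennreal ((\<integral>\<omega>. norm (q0 \<omega> * ln (q0 \<omega> / w \<omega>)) \<partial>N) + (\<integral>\<omega>. w \<omega> \<partial>N) + exp t * (\<integral>\<omega>. w \<omega> * indicator A \<omega> \<partial>N))"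
    by (intro ennreal_leI) simp
  also have "\<dots> = ennreal (\<integral>\<omega>. norm (q0 \<omega> * ln (q0 \<omega> / w \<omega>)) \<partial>N) + ennreal (\<integral>\<omega>. w \<omega> \<partial>N) + ennreal (exp t) * ennreal (\<integral>\<omega>. w \<omega> * indicator A \<omega> \<partial>N)"
    using q_pos(3) by (simp add: ennreal_plus ennreal_mult integral_nonneg_AE less_imp_le)
  also have "ennreal (\<integral>\<omega>. norm (q0 \<omega> * ln (q0 \<omega> / w \<omega>)) \<partial>N) = (\<integral>\<^sup>+\<omega>. ennreal (q0 \<omega>) * ennreal \<bar>ln (q0 \<omega> / w \<omega>)\<bar> \<partial>N)"
    unfolding absint[symmetric] using int by (intro nn_integral_eq_integral[symmetric]) auto
  also have "ennreal (\<integral>\<omega>. w \<omega> \<partial>N) = (\<integral>\<^sup>+\<omega>. ennreal (w \<omega>) \<partial>N)"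
    using w_int q_pos(3) by (intro nn_integral_eq_integral[symmetric]) (auto simp: less_imp_le)
  also have "ennreal (\<integral>\<omega>. w \<omega> * indicator A \<omega> \<partial>N) = (\<integral>\<^sup>+\<omega>. ennreal (w \<omega> * indicator A \<omega>) \<partial>N)"
    using w_int q_pos(3) A by (intro nn_integral_eq_integral[symmetric]) (auto simp: less_imp_le integrable_real_mult_indicator)
  also have "\<dots> = (\<integral>\<^sup>+\<omega>. ennreal (w \<omega>) * indicator A \<omega> \<partial>N)"
    by (intro nn_integral_cong) (auto simp: indicator_def)
  finally show ?thesis .
qed

section \<open>Expectations of the likelihood ratio and of the weight under the truth\<close>

lemma nn_integral_lratio:
  assumes f0: "f0 \<in> borel_measurable (cube_unif p)" and \<sigma>: "\<sigma> > 0"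
  shows "(\<integral>\<^sup>+D. ennreal (lratio p k f0 \<sigma> n D \<omega>) \<partial>P0n p f0 \<sigma> n) = 1"
proof -
  let ?Z = "(lborel :: real measure) \<Otimes>\<^sub>M cube_unif p"
  let ?F = "\<lambda>z. model_dens p k \<omega> z / true_dens f0 \<sigma> z"
  have [measurable]: "true_dens f0 \<sigma> \<in> borel_measurable ?Z"
    by (rule borel_measurable_true_dens[OF f0])
  have F [measurable]: "(\<lambda>z. ennreal (?F z)) \<in> borel_measurable ?Z"
    by measurable
  have pos: "0 < model_dens p k \<omega> z" "0 < true_dens f0 \<sigma> z" for z
    using \<sigma> by (simp_all add: model_dens_pos true_dens_pos)
  have "(\<integral>\<^sup>+D. ennreal (lratio p k f0 \<sigma> n D \<omega>) \<partial>P0n p f0 \<sigma> n) = (\<integral>\<^sup>+D. (\<Prod>i<n. ennreal (?F (D i))) \<partial>P0n p f0 \<sigma> n)"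
    unfolding lratio_def using pos by (intro nn_integral_cong) (simp add: prod_ennreal less_imp_le)
  also have "\<dots> = (\<integral>\<^sup>+z. ennreal (?F z) \<partial>P0 p f0 \<sigma>) ^ n"
    by (rule nn_integral_P0n_prod[OF f0 \<sigma> F])
  also have "(\<integral>\<^sup>+z. ennreal (?F z) \<partial>P0 p f0 \<sigma>) = (\<integral>\<^sup>+z. ennreal (true_dens f0 \<sigma> z) * ennreal (?F z) \<partial>?Z)"
    by (rule nn_integral_P0[OF f0 F])
  also have "\<dots> = (\<integral>\<^sup>+z. ennreal (model_dens p k \<omega> z) \<partial>?Z)"
    using pos by (intro nn_integral_cong) (simp add: ennreal_mult[symmetric] less_imp_le less_imp_neq[THEN not_sym])
  finally show ?thesis by (simp add: nn_integral_model_dens)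
qed

text \<open>Tonelli, and mean 1 of the likelihood ratio. For g = 1 this gives mean 1 to the
  normaliser of the weight; for g the indicator of the sieve's complement it trades likelihood for
  prior mass, which settles the parameters off the sieve without any bound on their
  likelihood.\<close>

lemma nn_integral_weight:
  assumes f0: "f0 \<in> borel_measurable (cube_unif p)" and pos: "\<sigma> > 0" "\<eta> > 0" "\<zeta> > 0"
    and [measurable]: "g \<in> borel_measurable (param_space p k)"
  shows "(\<integral>\<^sup>+D. \<integral>\<^sup>+\<omega>. ennreal (weight p k f0 \<sigma> \<eta> \<zeta> n D \<omega>) * g \<omega> \<partial>param_space p k \<partial>P0n p f0 \<sigma> n)
    = (\<integral>\<^sup>+\<omega>. ennreal (prior_dens p k \<eta> \<zeta> \<omega>) * g \<omega> \<partial>param_space p k)"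
proof -
  interpret P: prob_space "P0n p f0 \<sigma> n" by (rule prob_space_P0n[OF f0 pos(1)])
  interpret pair_sigma_finite "param_space p k" "P0n p f0 \<sigma> n"
    by (intro pair_sigma_finite.intro sigma_finite_param_space P.sigma_finite_measure_axioms)
  have [measurable]: "(\<lambda>x. weight p k f0 \<sigma> \<eta> \<zeta> n (snd x) (fst x)) \<in> borel_measurable (param_space p k \<Otimes>\<^sub>M P0n p f0 \<sigma> n)"
    by (rule borel_measurable_weight[OF f0 measurable_fst measurable_snd])
  have [measurable]: "(\<lambda>D. lratio p k f0 \<sigma> n D \<omega>) \<in> borel_measurable (P0n p f0 \<sigma> n)" if "\<omega> \<in> space (param_space p k)" for \<omega>
    by (rule borel_measurable_lratio[OF f0 measurable_const[OF that] measurable_ident_sets[OF refl]])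
  have "(\<integral>\<^sup>+D. \<integral>\<^sup>+\<omega>. ennreal (weight p k f0 \<sigma> \<eta> \<zeta> n D \<omega>) * g \<omega> \<partial>param_space p k \<partial>P0n p f0 \<sigma> n)
    = (\<integral>\<^sup>+\<omega>. \<integral>\<^sup>+D. ennreal (weight p k f0 \<sigma> \<eta> \<zeta> n D \<omega>) * g \<omega> \<partial>P0n p f0 \<sigma> n \<partial>param_space p k)"
    by (rule Fubini') (simp add: case_prod_beta')
  also have "\<dots> = (\<integral>\<^sup>+\<omega>. ennreal (prior_dens p k \<eta> \<zeta> \<omega>) * g \<omega> \<partial>param_space p k)"
  proof (rule nn_integral_cong)
    fix \<omega> assume \<omega>: "\<omega> \<in> space (param_space p k)"
    have "(\<integral>\<^sup>+D. ennreal (weight p k f0 \<sigma> \<eta> \<zeta> n D \<omega>) * g \<omega> \<partial>P0n p f0 \<sigma> n)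
      = (\<integral>\<^sup>+D. (ennreal (prior_dens p k \<eta> \<zeta> \<omega>) * g \<omega>) * ennreal (lratio p k f0 \<sigma> n D \<omega>) \<partial>P0n p f0 \<sigma> n)"
      unfolding weight_def using pos
      by (intro nn_integral_cong) (simp add: ennreal_mult lratio_pos prior_dens_pos less_imp_le mult_ac)
    also have "\<dots> = (ennreal (prior_dens p k \<eta> \<zeta> \<omega>) * g \<omega>) * (\<integral>\<^sup>+D. ennreal (lratio p k f0 \<sigma> n D \<omega>) \<partial>P0n p f0 \<sigma> n)"
      using \<omega> by (intro nn_integral_cmult) measurable
    finally show "(\<integral>\<^sup>+D. ennreal (weight p k f0 \<sigma> \<eta> \<zeta> n D \<omega>) * g \<omega> \<partial>P0n p f0 \<sigma> n) = ennreal (prior_dens p k \<eta> \<zeta> \<omega>) * g \<omega>"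
      by (simp add: nn_integral_lratio[OF f0 pos(1)])
  qed
  finally show ?thesis .
qed

subsection \<open>Cost of the competitor\<close>

text \<open>The scale coordinate is independent of each network coordinate, and 2 e^2 bounds the
  mean of the exponential factor since s \<le> 1. The first summand is kept apart because the
  exponential minus 1 has mean O(s), while the exponential itself is not small.\<close>

lemma nn_integral_competitor_loss_le:
  fixes \<rho>0 :: real and \<theta> :: "nat \<Rightarrow> real"
  assumes s: "0 < s" "s \<le> 1" and a: "a \<ge> 0" "b \<ge> 0" "c \<ge> 0"
  defines "m \<equiv> case_nat \<rho>0 \<theta>"
  shows "(\<integral>\<^sup>+\<omega>. ennreal (vdens p k m (\<lambda>_. s) \<omega>)
        * ennreal (a * (exp (2 * \<bar>\<omega> 0 - \<rho>0\<bar>) - 1)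
            + exp (2 * \<bar>\<omega> 0 - \<rho>0\<bar>) * (b + c * (\<Sum>i<nparam p k. (\<omega> (Suc i) - \<theta> i)\<^sup>2))) \<partial>param_space p k)
    \<le> ennreal (a * (s * (1 + 2 * exp 8)) + 2 * exp 2 * (b + c * (real (nparam p k) * s\<^sup>2)))"
proof -
  let ?K = "nparam p k"
  let ?N = "param_space p k"
  let ?q = "vdens p k m (\<lambda>_. s)"
  let ?e = "\<lambda>\<omega>. exp (2 * \<bar>\<omega> 0 - \<rho>0\<bar>)"
  let ?d = "\<lambda>i \<omega>. (\<omega> (Suc i) - \<theta> i)\<^sup>2"
  have q0: "?q \<omega> \<ge> 0" for \<omega> using vdens_pos[of p k "\<lambda>_. s" m \<omega>] s by simp
  have [measurable]: "(\<lambda>\<omega>. \<omega> 0) \<in> borel_measurable ?N" by simp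
  have meas_d: "(\<lambda>\<omega>. \<omega> (Suc i)) \<in> borel_measurable ?N" if "i < ?K" for i using that by simp
  have m0: "m 0 = \<rho>0" "m (Suc i) = \<theta> i" for i by (simp_all add: m_def)
  have E: "(\<integral>\<^sup>+x. ennreal (normal_density \<rho>0 s x) * ennreal (exp (2 * \<bar>x - \<rho>0\<bar>)) \<partial>lborel) \<le> ennreal (2 * exp 2)"
  proof -
    have "s\<^sup>2 \<le> 1" using s by (simp add: power_le_one)
    then have "ennreal (2 * exp (2\<^sup>2 * s\<^sup>2 / 2)) \<le> ennreal (2 * exp 2)" by (intro ennreal_leI) simp
    then show ?thesis using nn_integral_normal_exp_abs_le[OF s(1), of \<rho>0 2] by (rule order.trans[rotated])
  qed
  have I1: "(\<integral>\<^sup>+\<omega>. ennreal (?q \<omega>) * ennreal (?e \<omega> - 1) \<partial>?N) \<le> ennreal (s * (1 + 2 * exp 8))"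
    using nn_integral_vdens_component[of p k "\<lambda>_. s" 0 "\<lambda>x. ennreal (exp (2 * \<bar>x - \<rho>0\<bar>) - 1)" m] s
      nn_integral_normal_exp_abs_minus_one_le[OF s, of \<rho>0] by (simp add: m0)
  have I2: "(\<integral>\<^sup>+\<omega>. ennreal (?q \<omega>) * ennreal (?e \<omega>) \<partial>?N) \<le> ennreal (2 * exp 2)"
    using nn_integral_vdens_component[of p k "\<lambda>_. s" 0 "\<lambda>x. ennreal (exp (2 * \<bar>x - \<rho>0\<bar>))" m] s E by (simp add: m0)
  have I3: "(\<integral>\<^sup>+\<omega>. ennreal (?q \<omega>) * (ennreal (?e \<omega>) * ennreal (?d i \<omega>)) \<partial>?N) \<le> ennreal (2 * exp 2) * ennreal (s\<^sup>2)"
    if i: "i < ?K" for i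
  proof -
    have "(\<integral>\<^sup>+\<omega>. ennreal (?q \<omega>) * (ennreal (?e \<omega>) * ennreal (?d i \<omega>)) \<partial>?N)
      = (\<integral>\<^sup>+x. ennreal (normal_density \<rho>0 s x) * ennreal (exp (2 * \<bar>x - \<rho>0\<bar>)) \<partial>lborel)
       * (\<integral>\<^sup>+x. ennreal (normal_density (\<theta> i) s x) * ennreal ((x - \<theta> i)\<^sup>2) \<partial>lborel)"
      using nn_integral_vdens_two_components[of p k "\<lambda>_. s" 0 "Suc i" "\<lambda>x. ennreal (exp (2 * \<bar>x - \<rho>0\<bar>))" "\<lambda>x. ennreal ((x - \<theta> i)\<^sup>2)" m] i s
      by (simp add: m0)
    also have "\<dots> \<le> ennreal (2 * exp 2) * ennreal (s\<^sup>2)"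
      unfolding nn_integral_normal_square[OF s(1)] by (intro mult_right_mono E) simp
    finally show ?thesis .
  qed
  have "(\<integral>\<^sup>+\<omega>. ennreal (?q \<omega>) * ennreal (a * (?e \<omega> - 1) + ?e \<omega> * (b + c * (\<Sum>i<?K. ?d i \<omega>))) \<partial>?N)
    = (\<integral>\<^sup>+\<omega>. ennreal a * (ennreal (?q \<omega>) * ennreal (?e \<omega> - 1))
        + ennreal b * (ennreal (?q \<omega>) * ennreal (?e \<omega>))
        + ennreal c * (\<Sum>i<?K. ennreal (?q \<omega>) * (ennreal (?e \<omega>) * ennreal (?d i \<omega>))) \<partial>?N)"
  proof (rule nn_integral_cong)
    fix \<omega>
    have "(\<Sum>i<?K. ennreal (?q \<omega>) * (ennreal (?e \<omega>) * ennreal (?d i \<omega>))) = (\<Sum>i<?K. ennreal (?q \<omega> * (?e \<omega> * ?d i \<omega>)))"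
      using q0 by (intro sum.cong refl) (simp add: ennreal_mult)
    also have "\<dots> = ennreal (\<Sum>i<?K. ?q \<omega> * (?e \<omega> * ?d i \<omega>))"
      using q0 by (intro sum_ennreal) auto
    finally have sum_eq: "(\<Sum>i<?K. ennreal (?q \<omega>) * (ennreal (?e \<omega>) * ennreal (?d i \<omega>))) = ennreal (\<Sum>i<?K. ?q \<omega> * (?e \<omega> * ?d i \<omega>))" .
    have nn: "0 \<le> (\<Sum>i<?K. ?q \<omega> * (?e \<omega> * ?d i \<omega>))" "0 \<le> ?e \<omega> - 1"
      using q0 by (auto intro!: sum_nonneg)
    have "ennreal (?q \<omega>) * ennreal (a * (?e \<omega> - 1) + ?e \<omega> * (b + c * (\<Sum>i<?K. ?d i \<omega>)))
      = ennreal (?q \<omega> * (a * (?e \<omega> - 1) + ?e \<omega> * (b + c * (\<Sum>i<?K. ?d i \<omega>))))"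
      using q0 by (simp add: ennreal_mult')
    also have "?q \<omega> * (a * (?e \<omega> - 1) + ?e \<omega> * (b + c * (\<Sum>i<?K. ?d i \<omega>)))
      = a * (?q \<omega> * (?e \<omega> - 1)) + b * (?q \<omega> * ?e \<omega>) + c * (\<Sum>i<?K. ?q \<omega> * (?e \<omega> * ?d i \<omega>))"
      by (simp add: sum_distrib_left algebra_simps)
    also have "ennreal \<dots> = ennreal a * (ennreal (?q \<omega>) * ennreal (?e \<omega> - 1))
        + ennreal b * (ennreal (?q \<omega>) * ennreal (?e \<omega>))
        + ennreal c * ennreal (\<Sum>i<?K. ?q \<omega> * (?e \<omega> * ?d i \<omega>))"
      using q0[of \<omega>] a nn by (simp add: ennreal_plus ennreal_mult)
    finally show "ennreal (?q \<omega>) * ennreal (a * (?e \<omega> - 1) + ?e \<omega> * (b + c * (\<Sum>i<?K. ?d i \<omega>)))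
      = ennreal a * (ennreal (?q \<omega>) * ennreal (?e \<omega> - 1))
        + ennreal b * (ennreal (?q \<omega>) * ennreal (?e \<omega>))
        + ennreal c * (\<Sum>i<?K. ennreal (?q \<omega>) * (ennreal (?e \<omega>) * ennreal (?d i \<omega>)))"
      unfolding sum_eq .
  qed
  also have "\<dots> = ennreal a * (\<integral>\<^sup>+\<omega>. ennreal (?q \<omega>) * ennreal (?e \<omega> - 1) \<partial>?N)
      + ennreal b * (\<integral>\<^sup>+\<omega>. ennreal (?q \<omega>) * ennreal (?e \<omega>) \<partial>?N)
      + ennreal c * (\<Sum>i<?K. \<integral>\<^sup>+\<omega>. ennreal (?q \<omega>) * (ennreal (?e \<omega>) * ennreal (?d i \<omega>)) \<partial>?N)"
  proof -
    have meas: "(\<lambda>\<omega>. ennreal (?q \<omega>) * (ennreal (?e \<omega>) * ennreal (?d i \<omega>))) \<in> borel_measurable ?N" if "i < ?K" for i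
    proof -
      note [measurable] = meas_d[OF that]
      show ?thesis by measurable
    qed
    have [measurable]: "(\<lambda>\<omega>. \<Sum>i<?K. ennreal (?q \<omega>) * (ennreal (?e \<omega>) * ennreal (?d i \<omega>))) \<in> borel_measurable ?N"
      using meas by (intro borel_measurable_sum) simp
    have "(\<integral>\<^sup>+\<omega>. (\<Sum>i<?K. ennreal (?q \<omega>) * (ennreal (?e \<omega>) * ennreal (?d i \<omega>))) \<partial>?N)
      = (\<Sum>i<?K. \<integral>\<^sup>+\<omega>. ennreal (?q \<omega>) * (ennreal (?e \<omega>) * ennreal (?d i \<omega>)) \<partial>?N)"
      using meas by (intro nn_integral_sum) simp
    then show ?thesis by (simp add: nn_integral_add nn_integral_cmult)
  qed
  also have "\<dots> \<le> ennreal a * ennreal (s * (1 + 2 * exp 8)) + ennreal b * ennreal (2 * exp 2)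
      + ennreal c * (\<Sum>i<?K. ennreal (2 * exp 2) * ennreal (s\<^sup>2))"
    by (intro add_mono mult_left_mono sum_mono I1 I2 I3) auto
  also have "\<dots> = ennreal (a * (s * (1 + 2 * exp 8)) + 2 * exp 2 * (b + c * (real ?K * s\<^sup>2)))"
  proof -
    have "(\<Sum>i<?K. ennreal (2 * exp 2) * ennreal (s\<^sup>2)) = ennreal (real ?K * (2 * exp 2 * s\<^sup>2))"
      by (simp add: ennreal_mult ennreal_of_nat_eq_real_of_nat)
    then show ?thesis
      using a s by (simp add: ennreal_plus[symmetric] ennreal_mult[symmetric] algebra_simps del: ennreal_plus)
  qed
  finally show ?thesis .
qed

lemma nn_integral_P0n_component:
  assumes f0: "f0 \<in> borel_measurable (cube_unif p)" and \<sigma>: "\<sigma> > 0" and i: "i < n"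
    and g: "g \<in> borel_measurable (lborel \<Otimes>\<^sub>M cube_unif p)"
  shows "(\<integral>\<^sup>+D. g (D i) \<partial>P0n p f0 \<sigma> n) = (\<integral>\<^sup>+z. g z \<partial>P0 p f0 \<sigma>)"
  unfolding P0n_def using i g
  by (intro nn_integral_PiM_component prob_space_P0 f0 \<sigma>) (auto simp: sets_P0 cong: measurable_cong_sets)

text \<open>The logarithm of the weight is a prior term plus one term per observation. The triangle
  inequality, Tonelli and identical distribution reduce the average over the data to n copies of the
  loss for one observation.\<close>

lemma nn_integral_P0n_abs_ln_weight_le:
  fixes m :: "nat \<Rightarrow> real"
  assumes f0: "f0 \<in> borel_measurable (cube_unif p)" and pos: "\<sigma> > 0" "\<eta> > 0" "\<zeta> > 0"
    and s: "\<And>i. i \<le> nparam p k \<Longrightarrow> s i > 0"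
  defines "q \<equiv> vdens p k m s" and "N \<equiv> param_space p k"
  shows "(\<integral>\<^sup>+D. \<integral>\<^sup>+\<omega>. ennreal (q \<omega>) * ennreal \<bar>ln (q \<omega> / weight p k f0 \<sigma> \<eta> \<zeta> n D \<omega>)\<bar> \<partial>N \<partial>P0n p f0 \<sigma> n)
    \<le> (\<integral>\<^sup>+\<omega>. ennreal (q \<omega>) * ennreal \<bar>ln (q \<omega> / prior_dens p k \<eta> \<zeta> \<omega>)\<bar> \<partial>N)
      + of_nat n * (\<integral>\<^sup>+\<omega>. ennreal (q \<omega>) * (\<integral>\<^sup>+z. ennreal \<bar>ln (true_dens f0 \<sigma> z / model_dens p k \<omega> z)\<bar> \<partial>P0 p f0 \<sigma>) \<partial>N)"
proof -
  let ?P = "P0n p f0 \<sigma> n"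
  interpret P: prob_space ?P by (rule prob_space_P0n[OF f0 pos(1)])
  interpret P0: prob_space "P0 p f0 \<sigma>" by (rule prob_space_P0[OF f0 pos(1)])
  interpret pair_sigma_finite N ?P
    unfolding N_def by (intro pair_sigma_finite.intro sigma_finite_param_space P.sigma_finite_measure_axioms)
  define l where "l = (\<lambda>\<omega> z. \<bar>ln (true_dens f0 \<sigma> z / model_dens p k \<omega> z)\<bar>)"
  define g where "g = (\<lambda>\<omega>. \<bar>ln (q \<omega> / prior_dens p k \<eta> \<zeta> \<omega>)\<bar>)"
  have q_pos: "q \<omega> > 0" for \<omega> unfolding q_def using s by (rule vdens_pos)
  have [measurable]: "q \<in> borel_measurable N" by (simp add: q_def N_def)
  have [measurable]: "prior_dens p k \<eta> \<zeta> \<in> borel_measurable N" by (simp add: N_def)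
  have [measurable]: "true_dens f0 \<sigma> \<in> borel_measurable (lborel \<Otimes>\<^sub>M cube_unif p)"
    by (rule borel_measurable_true_dens[OF f0])
  have [measurable]: "g \<in> borel_measurable N" unfolding g_def by measurable
  have l_meas: "(\<lambda>v. l (w v) (z v)) \<in> borel_measurable M"
    if "w \<in> measurable M N" and z [measurable]: "z \<in> measurable M (lborel \<Otimes>\<^sub>M cube_unif p)" for w z and M :: "'b measure"
  proof -
    have [measurable]: "(\<lambda>v. model_dens p k (w v) (z v)) \<in> borel_measurable M"
      by (rule borel_measurable_model_dens) (use that in \<open>auto simp: N_def\<close>)
    show ?thesis unfolding l_def by measurable
  qed
  have le: "\<bar>ln (q \<omega> / weight p k f0 \<sigma> \<eta> \<zeta> n D \<omega>)\<bar> \<le> g \<omega> + (\<Sum>i<n. l \<omega> (D i))" for \<omega> D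
  proof -
    have nz: "model_dens p k \<omega> z \<noteq> 0" "true_dens f0 \<sigma> z \<noteq> 0" for z
      using model_dens_pos[of p k \<omega> z] true_dens_pos[OF pos(1), of f0 z] by auto
    have ln_lr: "- ln (lratio p k f0 \<sigma> n D \<omega>) = (\<Sum>i<n. ln (true_dens f0 \<sigma> (D i) / model_dens p k \<omega> (D i)))"
      unfolding lratio_def using nz
      by (subst ln_prod) (auto simp: ln_div sum_negf[symmetric] intro!: sum.cong)
    have "ln (q \<omega> / weight p k f0 \<sigma> \<eta> \<zeta> n D \<omega>) = ln (q \<omega> / prior_dens p k \<eta> \<zeta> \<omega>) + - ln (lratio p k f0 \<sigma> n D \<omega>)"
      using q_pos[of \<omega>] lratio_pos[OF pos(1), of p k f0 n D \<omega>] prior_dens_pos[OF pos(2,3), of p k \<omega>]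
      by (simp add: weight_def ln_div ln_mult)
    then show ?thesis
      unfolding ln_lr g_def l_def
      by (auto intro!: order.trans[OF abs_triangle_ineq] add_mono sum_abs)
  qed
  have "(\<integral>\<^sup>+D. \<integral>\<^sup>+\<omega>. ennreal (q \<omega>) * ennreal \<bar>ln (q \<omega> / weight p k f0 \<sigma> \<eta> \<zeta> n D \<omega>)\<bar> \<partial>N \<partial>?P)
    \<le> (\<integral>\<^sup>+D. \<integral>\<^sup>+\<omega>. ennreal (q \<omega>) * (ennreal (g \<omega>) + (\<Sum>i<n. ennreal (l \<omega> (D i)))) \<partial>N \<partial>?P)"
  proof (intro nn_integral_mono mult_left_mono)
    fix D \<omega>
    have "ennreal \<bar>ln (q \<omega> / weight p k f0 \<sigma> \<eta> \<zeta> n D \<omega>)\<bar> \<le> ennreal (g \<omega> + (\<Sum>i<n. l \<omega> (D i)))"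
      by (intro ennreal_leI le)
    also have "\<dots> = ennreal (g \<omega>) + (\<Sum>i<n. ennreal (l \<omega> (D i)))"
      by (subst ennreal_plus) (auto simp: g_def l_def intro!: sum_nonneg sum_ennreal[symmetric])
    finally show "ennreal \<bar>ln (q \<omega> / weight p k f0 \<sigma> \<eta> \<zeta> n D \<omega>)\<bar> \<le> ennreal (g \<omega>) + (\<Sum>i<n. ennreal (l \<omega> (D i)))" .
  qed auto
  also have "\<dots> = (\<integral>\<^sup>+\<omega>. \<integral>\<^sup>+D. ennreal (q \<omega>) * (ennreal (g \<omega>) + (\<Sum>i<n. ennreal (l \<omega> (D i)))) \<partial>?P \<partial>N)"
  proof (rule Fubini')
    have "(\<lambda>x. l (fst x) (snd x i)) \<in> borel_measurable (N \<Otimes>\<^sub>M ?P)" if "i \<in> {..<n}" for i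
      using that by (intro l_meas measurable_fst measurable_compose[OF measurable_snd measurable_P0n_component]) simp
    then have [measurable]: "(\<lambda>x. \<Sum>i<n. ennreal (l (fst x) (snd x i))) \<in> borel_measurable (N \<Otimes>\<^sub>M ?P)"
      by (intro borel_measurable_sum measurable_compose[OF _ measurable_ennreal])
    show "(\<lambda>(\<omega>, D). ennreal (q \<omega>) * (ennreal (g \<omega>) + (\<Sum>i<n. ennreal (l \<omega> (D i))))) \<in> borel_measurable (N \<Otimes>\<^sub>M ?P)"
      unfolding case_prod_beta' by measurable
  qed
  also have "\<dots> = (\<integral>\<^sup>+\<omega>. ennreal (q \<omega>) * ennreal (g \<omega>)
      + of_nat n * (ennreal (q \<omega>) * (\<integral>\<^sup>+z. ennreal (l \<omega> z) \<partial>P0 p f0 \<sigma>)) \<partial>N)"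
  proof (rule nn_integral_cong)
    fix \<omega> assume \<omega>: "\<omega> \<in> space N"
    have lz: "l \<omega> \<in> borel_measurable (lborel \<Otimes>\<^sub>M cube_unif p)"
      using l_meas[OF measurable_const[OF \<omega>] measurable_ident_sets[OF refl]] by simp
    have li: "(\<lambda>D. ennreal (l \<omega> (D i))) \<in> borel_measurable ?P" if "i < n" for i
      using measurable_compose[OF measurable_P0n_component[OF that] lz] by simp
    have "(\<integral>\<^sup>+D. ennreal (q \<omega>) * (ennreal (g \<omega>) + (\<Sum>i<n. ennreal (l \<omega> (D i)))) \<partial>?P)
      = ennreal (q \<omega>) * (ennreal (g \<omega>) + (\<Sum>i<n. \<integral>\<^sup>+D. ennreal (l \<omega> (D i)) \<partial>?P))"
    proof -
      have [measurable]: "(\<lambda>D. \<Sum>i<n. ennreal (l \<omega> (D i))) \<in> borel_measurable ?P"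
        using li by (intro borel_measurable_sum) simp
      have "(\<integral>\<^sup>+D. (\<Sum>i<n. ennreal (l \<omega> (D i))) \<partial>?P) = (\<Sum>i<n. \<integral>\<^sup>+D. ennreal (l \<omega> (D i)) \<partial>?P)"
        using li by (intro nn_integral_sum) simp
      then show ?thesis
        by (simp add: nn_integral_cmult nn_integral_add P.emeasure_space_1)
    qed
    also have "(\<Sum>i<n. \<integral>\<^sup>+D. ennreal (l \<omega> (D i)) \<partial>?P) = (\<Sum>i<n. \<integral>\<^sup>+z. ennreal (l \<omega> z) \<partial>P0 p f0 \<sigma>)"
    proof (rule sum.cong[OF refl])
      fix i assume "i \<in> {..<n}"
      then show "(\<integral>\<^sup>+D. ennreal (l \<omega> (D i)) \<partial>?P) = (\<integral>\<^sup>+z. ennreal (l \<omega> z) \<partial>P0 p f0 \<sigma>)"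
        using nn_integral_P0n_component[OF f0 pos(1), of i n "\<lambda>z. ennreal (l \<omega> z)"] measurable_compose[OF lz measurable_ennreal] by simp
    qed
    also have "\<dots> = of_nat n * (\<integral>\<^sup>+z. ennreal (l \<omega> z) \<partial>P0 p f0 \<sigma>)" by simp
    finally show "(\<integral>\<^sup>+D. ennreal (q \<omega>) * (ennreal (g \<omega>) + (\<Sum>i<n. ennreal (l \<omega> (D i)))) \<partial>?P)
      = ennreal (q \<omega>) * ennreal (g \<omega>) + of_nat n * (ennreal (q \<omega>) * (\<integral>\<^sup>+z. ennreal (l \<omega> z) \<partial>P0 p f0 \<sigma>))"
      by (simp add: distrib_left mult.left_commute)
  qed
  also have "\<dots> = (\<integral>\<^sup>+\<omega>. ennreal (q \<omega>) * ennreal (g \<omega>) \<partial>N)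
      + of_nat n * (\<integral>\<^sup>+\<omega>. ennreal (q \<omega>) * (\<integral>\<^sup>+z. ennreal (l \<omega> z) \<partial>P0 p f0 \<sigma>) \<partial>N)"
  proof -
    have "(\<lambda>x. ennreal (l (fst x) (snd x))) \<in> borel_measurable (N \<Otimes>\<^sub>M P0 p f0 \<sigma>)"
      by (intro measurable_compose[OF l_meas measurable_ennreal] measurable_fst)
        (simp add: sets_P0 cong: measurable_cong_sets)
    then have [measurable]: "(\<lambda>\<omega>. \<integral>\<^sup>+z. ennreal (l \<omega> z) \<partial>P0 p f0 \<sigma>) \<in> borel_measurable N"
      by (intro P0.borel_measurable_nn_integral) (simp add: case_prod_beta')
    show ?thesis by (simp add: nn_integral_add nn_integral_cmult)
  qed
  finally show ?thesis by (simp add: g_def l_def)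
qed

text \<open>Writing the true scale as \<open>softplus \<rho>0\<close> lets
  \<open>case_nat \<rho>0 \<theta>\<close> centre coordinate 0 of the competitor on it. The weight
  \<tau> stays free until it can be tied to the approximation error r.\<close>

lemma nn_integral_P0n_competitor_le:
  fixes \<rho>0 :: real and \<theta> :: "nat \<Rightarrow> real"
  assumes f0: "f0 \<in> borel_measurable (cube_unif p)"
    and f0_sq: "integrable (cube_unif p) (\<lambda>x. (f0 x)\<^sup>2)"
    and pos: "\<eta> > 0" "\<zeta> > 0" and \<tau>: "\<tau> > 0" and s: "0 < s" "s \<le> 1"
    and B: "\<And>i. i < nparam p k \<Longrightarrow> \<bar>\<theta> i\<bar> \<le> B"
  defines "\<sigma> \<equiv> softplus \<rho>0" and "m \<equiv> case_nat \<rho>0 \<theta>" and "N \<equiv> param_space p k"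
    and "q \<equiv> vdens p k (case_nat \<rho>0 \<theta>) (\<lambda>_. s)" and "K \<equiv> real (nparam p k)"
    and "r \<equiv> L2norm p (\<lambda>x. net p k \<theta> x - f0 x)" and "t \<equiv> prior_scale \<eta> \<zeta>"
  shows "(\<integral>\<^sup>+D. \<integral>\<^sup>+\<omega>. ennreal (q \<omega>) * ennreal \<bar>ln (q \<omega> / weight p k f0 \<sigma> \<eta> \<zeta> n D \<omega>)\<bar> \<partial>N \<partial>P0n p f0 \<sigma> n)
    \<le> ennreal ((\<Sum>i\<le>nparam p k. \<bar>ln (t i / s)\<bar> + (m i)\<^sup>2 / (t i)\<^sup>2 + 1 / 2 + s\<^sup>2 / (t i)\<^sup>2)
      + real n * (3 / 2 * (s * (1 + 2 * exp 8))
          + 2 * exp 2 * (\<tau> / 2 + (1 + 1 / \<tau>) * r\<^sup>2 / \<sigma>\<^sup>2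
              + (1 + 1 / \<tau>) * (K * (1 + B))\<^sup>2 / \<sigma>\<^sup>2 * (K * s\<^sup>2))))"
proof -
  have \<sigma>: "\<sigma> > 0" by (simp add: \<sigma>_def)
  define b c where "b = \<tau> / 2 + (1 + 1 / \<tau>) * r\<^sup>2 / \<sigma>\<^sup>2" and "c = (1 + 1 / \<tau>) * (K * (1 + B))\<^sup>2 / \<sigma>\<^sup>2"
  have bc: "b \<ge> 0" "c \<ge> 0" using \<tau> by (auto simp: b_def c_def)
  have t: "t i > 0" for i using pos by (simp add: t_def prior_scale_pos)
  let ?S = "\<lambda>\<omega>. \<Sum>i<nparam p k. (\<omega> (Suc i) - \<theta> i)\<^sup>2"
  let ?e = "\<lambda>\<omega>. exp (2 * \<bar>\<omega> 0 - \<rho>0\<bar>)"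
  let ?A = "\<Sum>i\<le>nparam p k. \<bar>ln (t i / s)\<bar> + (m i)\<^sup>2 / (t i)\<^sup>2 + 1 / 2 + s\<^sup>2 / (t i)\<^sup>2"
  let ?B = "3 / 2 * (s * (1 + 2 * exp 8)) + 2 * exp 2 * (b + c * (K * s\<^sup>2))"
  have A0: "?A \<ge> 0" by (intro sum_nonneg add_nonneg_nonneg) auto
  have B0: "?B \<ge> 0" using s bc by (auto simp: K_def)
  have 1: "(\<integral>\<^sup>+\<omega>. ennreal (q \<omega>) * ennreal \<bar>ln (q \<omega> / prior_dens p k \<eta> \<zeta> \<omega>)\<bar> \<partial>N) \<le> ennreal ?A"
    unfolding q_def N_def prior_dens_eq_vdens m_def t_def
    by (rule nn_integral_vdens_abs_ln_ratio_le[OF s(1)]) (simp add: prior_scale_pos pos)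
  have 2: "(\<integral>\<^sup>+z. ennreal \<bar>ln (true_dens f0 \<sigma> z / model_dens p k \<omega> z)\<bar> \<partial>P0 p f0 \<sigma>)
      \<le> ennreal (3 / 2 * (?e \<omega> - 1) + ?e \<omega> * (b + c * ?S \<omega>))" for \<omega>
  proof -
    let ?G = "2 * r\<^sup>2 + 2 * (K * (1 + B))\<^sup>2 * ?S \<omega>"
    have S0: "?S \<omega> \<ge> 0" by (intro sum_nonneg) auto
    then have G0: "?G \<ge> 0" by (intro add_nonneg_nonneg mult_nonneg_nonneg) auto
    have G: "\<tau> / 2 + (1 + 1 / \<tau>) * ?G / (2 * \<sigma>\<^sup>2) = b + c * ?S \<omega>"
      using \<sigma> by (simp add: b_def c_def field_simps)
    have "(\<integral>\<^sup>+x. ennreal ((f0 x - net p k (theta_of \<omega>) x)\<^sup>2) \<partial>cube_unif p) \<le> ennreal ?G"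
      unfolding r_def K_def by (rule nn_integral_net_perturbed_error_le[OF f0 f0_sq]) (rule B)
    from nn_integral_P0_abs_ln_ratio_le[OF f0 \<tau> G0 this, of \<rho>0] show ?thesis
      unfolding \<sigma>_def[symmetric] G .
  qed
  have "(\<integral>\<^sup>+\<omega>. ennreal (q \<omega>) * (\<integral>\<^sup>+z. ennreal \<bar>ln (true_dens f0 \<sigma> z / model_dens p k \<omega> z)\<bar> \<partial>P0 p f0 \<sigma>) \<partial>N)
    \<le> (\<integral>\<^sup>+\<omega>. ennreal (q \<omega>) * ennreal (3 / 2 * (?e \<omega> - 1) + ?e \<omega> * (b + c * ?S \<omega>)) \<partial>N)"
    by (intro nn_integral_mono mult_left_mono 2) simp
  also have "\<dots> \<le> ennreal ?B"
    unfolding q_def N_def K_def by (rule nn_integral_competitor_loss_le[OF s _ bc]) simp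
  finally have 3: "(\<integral>\<^sup>+\<omega>. ennreal (q \<omega>) * (\<integral>\<^sup>+z. ennreal \<bar>ln (true_dens f0 \<sigma> z / model_dens p k \<omega> z)\<bar> \<partial>P0 p f0 \<sigma>) \<partial>N) \<le> ennreal ?B" .
  have "(\<integral>\<^sup>+D. \<integral>\<^sup>+\<omega>. ennreal (q \<omega>) * ennreal \<bar>ln (q \<omega> / weight p k f0 \<sigma> \<eta> \<zeta> n D \<omega>)\<bar> \<partial>N \<partial>P0n p f0 \<sigma> n)
    \<le> ennreal ?A + of_nat n * ennreal ?B"
    unfolding q_def N_def
    by (rule order.trans[OF nn_integral_P0n_abs_ln_weight_le[OF f0 \<sigma> pos]])
      (use s 1 3 in \<open>auto intro!: add_mono mult_left_mono simp: q_def N_def\<close>)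
  also have "\<dots> = ennreal (?A + real n * ?B)"
    using A0 B0 by (simp add: ennreal_of_nat_eq_real_of_nat ennreal_plus ennreal_mult)
  finally show ?thesis by (simp add: b_def c_def)
qed

subsection \<open>Upper brackets and the sieve\<close>

text \<open>The bracketing inequality itself controls the Hellinger distance between f and f'
  (by 2 - 2 / sqrt B, where f \<le> B f'), so no distance between normal densities has to be computed.\<close>
lemma affinity_upper_bracket:
  fixes f f' g :: "'a \<Rightarrow> real"
  assumes [measurable]: "f \<in> borel_measurable M" "f' \<in> borel_measurable M" "g \<in> borel_measurable M"
    and nn: "\<And>x. f x \<ge> 0" "\<And>x. f' x \<ge> 0" "\<And>x. g x \<ge> 0"
    and one: "(\<integral>\<^sup>+x. ennreal (f x) \<partial>M) = 1" "(\<integral>\<^sup>+x. ennreal (f' x) \<partial>M) = 1" "(\<integral>\<^sup>+x. ennreal (g x) \<partial>M) = 1"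
    and \<kappa>: "\<kappa> > 0" and le: "AE x in M. f x \<le> exp (7 * \<kappa>) * f' x"
    and \<epsilon>: "\<epsilon> \<le> (\<integral>x. (sqrt (f x) - sqrt (g x))\<^sup>2 \<partial>M)"
  shows "(\<integral>\<^sup>+x. ennreal (sqrt (exp (7 * \<kappa>) * f' x * g x)) \<partial>M) \<le> ennreal (exp (7 / 2 * \<kappa>) * (1 - \<epsilon> / 2 + 4 * sqrt \<kappa>))"
proof -
  have int: "integrable M f" "integrable M f'" "integrable M g"
    and int_1: "integral\<^sup>L M f = 1" "integral\<^sup>L M f' = 1" "integral\<^sup>L M g = 1"
    using one nn by (auto simp: integrable_iff_bounded integral_eq_nn_integral)
  have prod_int: "integrable M (\<lambda>x. sqrt (a x) * sqrt (b x))"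
    if [measurable]: "a \<in> borel_measurable M" "b \<in> borel_measurable M"
      and "integrable M a" "integrable M b" "\<And>x. a x \<ge> 0" "\<And>x. b x \<ge> 0" for a b :: "'a \<Rightarrow> real"
  proof (rule Bochner_Integration.integrable_bound)
    show "integrable M (\<lambda>x. a x + b x)" using that by simp
    show "AE x in M. norm (sqrt (a x) * sqrt (b x)) \<le> norm (a x + b x)"
    proof (rule AE_I2)
      fix x
      have "0 \<le> (sqrt (a x) - sqrt (b x))\<^sup>2" by simp
      then have "2 * (sqrt (a x) * sqrt (b x)) \<le> a x + b x"
        using that by (simp add: power2_diff)
      moreover have "0 \<le> sqrt (a x) * sqrt (b x)" using that by simp
      ultimately show "norm (sqrt (a x) * sqrt (b x)) \<le> norm (a x + b x)" by simp
    qed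
  qed measurable
  note fg = prod_int[of f g] and ff' = prod_int[of f' f] and f'g = prod_int[of f' g]
  have 1: "(\<integral>x. sqrt (f x) * sqrt (g x) \<partial>M) \<le> 1 - \<epsilon> / 2"
  proof -
    have "(\<integral>x. (sqrt (f x) - sqrt (g x))\<^sup>2 \<partial>M) = (\<integral>x. f x + g x - 2 * (sqrt (f x) * sqrt (g x)) \<partial>M)"
      using nn by (intro Bochner_Integration.integral_cong) (auto simp: power2_diff)
    also have "\<dots> = 2 - 2 * (\<integral>x. sqrt (f x) * sqrt (g x) \<partial>M)"
      using int int_1 fg nn by simp
    finally show ?thesis using \<epsilon> by simp
  qed
  have d_int: "integrable M (\<lambda>x. (sqrt (f' x) - sqrt (f x))\<^sup>2)"
    and 2: "(\<integral>x. (sqrt (f' x) - sqrt (f x))\<^sup>2 \<partial>M) \<le> 7 * \<kappa>"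
  proof -
    have eq: "(\<lambda>x. (sqrt (f' x) - sqrt (f x))\<^sup>2) = (\<lambda>x. f' x + f x - 2 * (sqrt (f' x) * sqrt (f x)))"
      using nn by (auto simp: power2_diff)
    show "integrable M (\<lambda>x. (sqrt (f' x) - sqrt (f x))\<^sup>2)"
      unfolding eq using int ff' nn by simp
    \<comment> \<open>The bracketing bounds sqrt f' below by a multiple of sqrt f; multiplied by
      sqrt f and integrated, this puts the affinity of f and f' near 1.\<close>
    have "(\<integral>x. exp (- (7 / 2 * \<kappa>)) * f x \<partial>M) \<le> (\<integral>x. sqrt (f' x) * sqrt (f x) \<partial>M)"
    proof (rule integral_mono_AE)
      show "AE x in M. exp (- (7 / 2 * \<kappa>)) * f x \<le> sqrt (f' x) * sqrt (f x)"
        using le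
      proof eventually_elim
        case (elim x)
        have "sqrt (f x) \<le> sqrt (exp (7 * \<kappa>) * f' x)" using elim by simp
        also have "\<dots> = exp (7 / 2 * \<kappa>) * sqrt (f' x)"
        proof -
          have "exp (7 * \<kappa>) = (exp (7 / 2 * \<kappa>))\<^sup>2" by (simp add: exp_double[symmetric])
          then show ?thesis by (simp add: real_sqrt_mult)
        qed
        finally have "exp (- (7 / 2 * \<kappa>)) * sqrt (f x) \<le> sqrt (f' x)"
          by (simp add: exp_minus field_simps)
        then have "exp (- (7 / 2 * \<kappa>)) * sqrt (f x) * sqrt (f x) \<le> sqrt (f' x) * sqrt (f x)"
          using nn by (intro mult_right_mono) auto
        then show ?case using nn by (simp add: mult.assoc)
      qed
    qed (use int ff' nn in auto)
    then have "exp (- (7 / 2 * \<kappa>)) \<le> (\<integral>x. sqrt (f' x) * sqrt (f x) \<partial>M)" using int_1 by simp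
    moreover have "1 - 7 / 2 * \<kappa> \<le> exp (- (7 / 2 * \<kappa>))" using exp_ge_add_one_self[of "- (7 / 2 * \<kappa>)"] by simp
    moreover have "(\<integral>x. (sqrt (f' x) - sqrt (f x))\<^sup>2 \<partial>M) = 2 - 2 * (\<integral>x. sqrt (f' x) * sqrt (f x) \<partial>M)"
      unfolding eq using int int_1 ff' nn by simp
    ultimately show "(\<integral>x. (sqrt (f' x) - sqrt (f x))\<^sup>2 \<partial>M) \<le> 7 * \<kappa>" by linarith
  qed
  \<comment> \<open>The weight sqrt \<kappa> balances the squared distance, at most 7 \<kappa>,
    against the mass 1 of g: 7/2 + 1/2 = 4 multiples of sqrt \<kappa>.\<close>
  have pw: "sqrt (f' x) * sqrt (g x) \<le> sqrt (f x) * sqrt (g x) + 1 / (2 * sqrt \<kappa>) * (sqrt (f' x) - sqrt (f x))\<^sup>2 + sqrt \<kappa> / 2 * g x" for x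
  proof -
    let ?a = "sqrt (f' x) - sqrt (f x)" and ?b = "sqrt (g x)" and ?l = "sqrt \<kappa>"
    have l: "?l > 0" using \<kappa> by simp
    have "0 \<le> (?a - ?l * ?b)\<^sup>2 / (2 * ?l)" using l by simp
    also have "\<dots> = 1 / (2 * ?l) * ?a\<^sup>2 + ?l / 2 * ?b\<^sup>2 - ?a * ?b"
      using l by (simp add: power2_eq_square field_simps)
    finally show ?thesis using nn(3)[of x] by (simp add: algebra_simps)
  qed
  have "(\<integral>x. sqrt (f' x) * sqrt (g x) \<partial>M) \<le> (\<integral>x. sqrt (f x) * sqrt (g x) + 1 / (2 * sqrt \<kappa>) * (sqrt (f' x) - sqrt (f x))\<^sup>2 + sqrt \<kappa> / 2 * g x \<partial>M)"
    using int fg f'g nn d_int by (intro integral_mono pw) auto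
  also have "\<dots> = (\<integral>x. sqrt (f x) * sqrt (g x) \<partial>M) + 1 / (2 * sqrt \<kappa>) * (\<integral>x. (sqrt (f' x) - sqrt (f x))\<^sup>2 \<partial>M) + sqrt \<kappa> / 2"
    using int int_1 fg nn d_int by simp
  also have "\<dots> \<le> (1 - \<epsilon> / 2) + 1 / (2 * sqrt \<kappa>) * (7 * \<kappa>) + sqrt \<kappa> / 2"
    using 1 2 \<kappa> by (intro add_mono mult_left_mono) auto
  also have "1 / (2 * sqrt \<kappa>) * (7 * \<kappa>) = 7 / 2 * sqrt \<kappa>"
    using \<kappa> by (simp add: field_simps)
  finally have 3: "(\<integral>x. sqrt (f' x) * sqrt (g x) \<partial>M) \<le> 1 - \<epsilon> / 2 + 4 * sqrt \<kappa>" by simp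
  have "(\<integral>\<^sup>+x. ennreal (sqrt (exp (7 * \<kappa>) * f' x * g x)) \<partial>M) = (\<integral>\<^sup>+x. ennreal (exp (7 / 2 * \<kappa>) * (sqrt (f' x) * sqrt (g x))) \<partial>M)"
  proof (rule nn_integral_cong)
    fix x
    have "exp (7 * \<kappa>) = (exp (7 / 2 * \<kappa>))\<^sup>2" by (simp add: exp_double[symmetric])
    then show "ennreal (sqrt (exp (7 * \<kappa>) * f' x * g x)) = ennreal (exp (7 / 2 * \<kappa>) * (sqrt (f' x) * sqrt (g x)))"
      by (simp add: real_sqrt_mult mult.assoc)
  qed
  also have "\<dots> = ennreal (\<integral>x. exp (7 / 2 * \<kappa>) * (sqrt (f' x) * sqrt (g x)) \<partial>M)"
    using f'g int nn by (intro nn_integral_eq_integral) auto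
  also have "\<dots> \<le> ennreal (exp (7 / 2 * \<kappa>) * (1 - \<epsilon> / 2 + 4 * sqrt \<kappa>))"
    using 3 by (intro ennreal_leI) simp
  finally show ?thesis .
qed

text \<open>At \<kappa> = 0 the left side is 1 - \<epsilon>/2 < 1 - \<epsilon>/4 \<le>
  e^(-\<epsilon>/4); by continuity the strict inequality survives for small \<kappa>. The gap left
  by the Hellinger separation pays for the brackets.\<close>

lemma bracket_width_exists:
  assumes "\<epsilon> > (0 :: real)"
  obtains \<kappa> where "0 < \<kappa>" "\<kappa> \<le> 1" "exp (7 / 2 * \<kappa>) * (1 - \<epsilon> / 2 + 4 * sqrt \<kappa>) \<le> exp (- (\<epsilon> / 4))"
proof -
  let ?f = "\<lambda>\<kappa>. exp (7 / 2 * \<kappa>) * (1 - \<epsilon> / 2 + 4 * sqrt \<kappa>)"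
  have "isCont ?f 0" by (intro continuous_intros)
  then have "(?f \<longlongrightarrow> ?f 0) (at_right 0)"
    by (simp add: isCont_def filterlim_at_split)
  moreover have "?f 0 < exp (- (\<epsilon> / 4))"
    using exp_ge_add_one_self[of "- (\<epsilon> / 4)"] assms by simp
  ultimately have "eventually (\<lambda>\<kappa>. ?f \<kappa> < exp (- (\<epsilon> / 4))) (at_right 0)"
    by (rule order_tendstoD)
  moreover have "eventually (\<lambda>\<kappa>::real. 0 < \<kappa> \<and> \<kappa> < 1) (at_right 0)"
    using eventually_at_right_less[of "0::real"] eventually_at_right_real[of 0 "1::real"]
    by (auto elim: eventually_mono)
  ultimately have "eventually (\<lambda>\<kappa>. ?f \<kappa> < exp (- (\<epsilon> / 4)) \<and> 0 < \<kappa> \<and> \<kappa> < 1) (at_right 0)"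
    by (rule eventually_conj)
  then obtain \<kappa> where "?f \<kappa> < exp (- (\<epsilon> / 4))" "0 < \<kappa>" "\<kappa> < 1"
    using eventually_happens[of _ "at_right (0::real)"] by (auto simp: trivial_limit_at_right_real)
  then show ?thesis using that[of \<kappa>] by simp
qed

section \<open>Brackets around parameters and the union bound over a grid\<close>

definition bracket :: "nat \<Rightarrow> nat \<Rightarrow> real \<Rightarrow> (nat \<Rightarrow> real) \<Rightarrow> real \<times> (nat \<Rightarrow> real) \<Rightarrow> real" where
  "bracket p k \<kappa> \<omega> z = exp (7 * \<kappa>)
     * normal_density (net p k (theta_of \<omega>) (snd z)) (softplus (\<omega> 0) * exp \<kappa> * sqrt (1 + \<kappa>)) (fst z)"

lemma borel_measurable_bracket [measurable]:
  "bracket p k \<kappa> \<omega> \<in> borel_measurable (lborel \<Otimes>\<^sub>M cube_unif p)"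
  unfolding bracket_def [abs_def] normal_density_def by measurable

lemma bracket_nonneg: "bracket p k \<kappa> \<omega> z \<ge> 0"
  by (simp add: bracket_def)

text \<open>Means must be resolved relative to the scale, which within distance 1 of the sieve is
  bounded below only by e^(-(R + 1)) / 2. This makes the mesh \<tau> exponentially small in R and
  puts a factor of order R per parameter into the entropy. The bound is R + 1 rather than R because
  grid points may leave the sieve by up to \<tau> \<le> 1.\<close>

lemma model_dens_le_bracket:
  assumes \<kappa>: "0 < \<kappa>" "\<kappa> \<le> 1" and \<tau>: "\<tau> \<le> \<kappa>" and R: "R \<ge> 0"
    and \<tau>_le: "real (nparam p k) * (R + 2) * \<tau> \<le> \<kappa> * exp (- (R + 1)) / 2"
    and near: "\<And>i. i \<le> nparam p k \<Longrightarrow> \<bar>\<omega> i - g i\<bar> \<le> \<tau>"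
    and g: "\<And>i. i \<le> nparam p k \<Longrightarrow> \<bar>g i\<bar> \<le> R + 1"
    and cube: "\<forall>h<p. 0 \<le> snd z h \<and> snd z h \<le> 1"
  shows "model_dens p k \<omega> z \<le> bracket p k \<kappa> g z"
  unfolding model_dens_def bracket_def
proof (rule normal_density_upper_bracket[OF \<kappa> softplus_pos])
  have "\<bar>net p k (theta_of \<omega>) (snd z) - net p k (theta_of g) (snd z)\<bar> \<le> real (nparam p k) * (1 + (R + 1)) * \<tau>"
    by (rule net_lipschitz) (use near g cube in \<open>auto simp: theta_of_def\<close>)
  also have "\<dots> \<le> \<kappa> * (exp (- (R + 1)) / 2)" using \<tau>_le by (simp add: algebra_simps)
  also have "exp (- (R + 1)) / 2 \<le> softplus (- (R + 1))"
    using R by (intro softplus_ge_half_exp) simp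
  also have "\<dots> \<le> softplus (g 0)" using g[of 0] by (intro softplus_mono) auto
  finally show "\<bar>net p k (theta_of \<omega>) (snd z) - net p k (theta_of g) (snd z)\<bar> \<le> \<kappa> * softplus (g 0)"
    using \<kappa> by simp
  have d: "\<bar>\<omega> 0 - g 0\<bar> \<le> \<kappa>" using near[of 0] \<tau> by simp
  have "softplus (g 0) \<le> softplus (\<omega> 0) * exp \<bar>g 0 - \<omega> 0\<bar>" by (rule softplus_ratio)
  also have "\<dots> \<le> softplus (\<omega> 0) * exp \<kappa>"
    using d less_imp_le[OF softplus_pos] by (intro mult_left_mono) auto
  finally show "softplus (g 0) * exp (- \<kappa>) \<le> softplus (\<omega> 0)"
    by (simp add: exp_minus field_simps)
  have "softplus (\<omega> 0) \<le> softplus (g 0) * exp \<bar>\<omega> 0 - g 0\<bar>" by (rule softplus_ratio)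
  also have "\<dots> \<le> softplus (g 0) * exp \<kappa>"
    using d less_imp_le[OF softplus_pos] by (intro mult_left_mono) auto
  finally show "softplus (\<omega> 0) \<le> softplus (g 0) * exp \<kappa>" .
qed

text \<open>The separation from the truth is that of a parameter \<omega> under the bracket, not of
  the centre g, which may be closer to the truth. Averaging sqrt (bracket / truth) under the truth
  gives the integral of sqrt (bracket * truth), to which \<open>affinity_upper_bracket\<close>
  applies.\<close>

lemma nn_integral_P0_sqrt_bracket_le:
  assumes f0: "f0 \<in> borel_measurable (cube_unif p)" and \<sigma>: "\<sigma> > 0"
    and \<kappa>: "0 < \<kappa>" and hell: "hellinger p k f0 \<sigma> \<omega> \<ge> \<epsilon>"
    and le: "\<And>z. \<forall>h<p. 0 \<le> snd z h \<and> snd z h \<le> 1 \<Longrightarrow> model_dens p k \<omega> z \<le> bracket p k \<kappa> g z"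
  shows "(\<integral>\<^sup>+z. ennreal (sqrt (bracket p k \<kappa> g z / true_dens f0 \<sigma> z)) \<partial>P0 p f0 \<sigma>)
    \<le> ennreal (exp (7 / 2 * \<kappa>) * (1 - \<epsilon> / 2 + 4 * sqrt \<kappa>))"
proof -
  let ?Z = "(lborel :: real measure) \<Otimes>\<^sub>M cube_unif p"
  interpret C: prob_space "cube_unif p" by (rule prob_space_cube_unif)
  have true_meas [measurable]: "true_dens f0 \<sigma> \<in> borel_measurable ?Z" by (rule borel_measurable_true_dens[OF f0])
  have true_pos: "true_dens f0 \<sigma> z > 0" for z using \<sigma> by (simp add: true_dens_pos)
  define f' where "f' = (\<lambda>z. normal_density (net p k (theta_of g) (snd z)) (softplus (g 0) * exp \<kappa> * sqrt (1 + \<kappa>)) (fst z))"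
  have s': "softplus (g 0) * exp \<kappa> * sqrt (1 + \<kappa>) > 0" using \<kappa> by simp
  have b: "bracket p k \<kappa> g z = exp (7 * \<kappa>) * f' z" for z by (simp add: bracket_def f'_def)
  have f'_meas [measurable]: "f' \<in> borel_measurable ?Z"
    unfolding f'_def normal_density_def by measurable
  have f'_one: "(\<integral>\<^sup>+z. ennreal (f' z) \<partial>?Z) = 1"
    using s' by (subst nn_integral_data, measurable) (simp add: f'_def C.emeasure_space_1)
  have m: "(\<lambda>z. ennreal (sqrt (bracket p k \<kappa> g z / true_dens f0 \<sigma> z))) \<in> borel_measurable ?Z"
    by measurable
  have "(\<integral>\<^sup>+z. ennreal (sqrt (bracket p k \<kappa> g z / true_dens f0 \<sigma> z)) \<partial>P0 p f0 \<sigma>)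
    = (\<integral>\<^sup>+z. ennreal (true_dens f0 \<sigma> z) * ennreal (sqrt (bracket p k \<kappa> g z / true_dens f0 \<sigma> z)) \<partial>?Z)"
    by (rule nn_integral_P0[OF f0 m])
  also have "\<dots> = (\<integral>\<^sup>+z. ennreal (sqrt (exp (7 * \<kappa>) * f' z * true_dens f0 \<sigma> z)) \<partial>?Z)"
  proof (rule nn_integral_cong)
    fix z
    let ?t = "true_dens f0 \<sigma> z"
    have "?t * sqrt (bracket p k \<kappa> g z / ?t) = sqrt (?t\<^sup>2 * (bracket p k \<kappa> g z / ?t))"
      using true_pos[of z] by (simp only: real_sqrt_mult real_sqrt_abs abs_of_pos)
    also have "?t\<^sup>2 * (bracket p k \<kappa> g z / ?t) = exp (7 * \<kappa>) * f' z * ?t"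
      using true_pos[of z] by (simp add: b power2_eq_square)
    finally show "ennreal ?t * ennreal (sqrt (bracket p k \<kappa> g z / ?t)) = ennreal (sqrt (exp (7 * \<kappa>) * f' z * ?t))"
      using true_pos[of z] by (simp add: ennreal_mult'[symmetric] less_imp_le)
  qed
  also have "\<dots> \<le> ennreal (exp (7 / 2 * \<kappa>) * (1 - \<epsilon> / 2 + 4 * sqrt \<kappa>))"
  proof (rule affinity_upper_bracket[where f="model_dens p k \<omega>"])
    show "AE z in ?Z. model_dens p k \<omega> z \<le> exp (7 * \<kappa>) * f' z"
      using AE_data_cube by (rule eventually_mono) (use le b in simp)
    show "\<epsilon> \<le> (\<integral>z. (sqrt (model_dens p k \<omega> z) - sqrt (true_dens f0 \<sigma> z))\<^sup>2 \<partial>?Z)"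
      using hell by (simp add: hellinger_def)
    show "0 \<le> f' z" for z by (simp add: f'_def)
  qed (use \<kappa> nn_integral_true_dens[OF f0 \<sigma>] nn_integral_model_dens f'_one true_pos model_dens_pos in \<open>auto simp: less_imp_le\<close>)
  finally show ?thesis .
qed

text \<open>The ratio bracket / truth has mean e^(7 \<kappa>) > 1 under the truth, so its products
  do not decay. For the square root the separation brings the mean below e^(-\<epsilon>/4), hence
  below e^(-n \<epsilon>/4) for the product. Half of that exponent is spent in Markov's inequality,
  and squaring restores n \<epsilon>/4 for the ratio itself. The finite grid lets one exceptional
  set serve all \<omega> at once.\<close>

lemma wald_sieve:
  assumes f0: "f0 \<in> borel_measurable (cube_unif p)" and \<sigma>: "\<sigma> > 0"
    and \<kappa>: "0 < \<kappa>" "\<kappa> \<le> 1"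
    and \<kappa>_le: "exp (7 / 2 * \<kappa>) * (1 - \<epsilon> / 2 + 4 * sqrt \<kappa>) \<le> exp (- (\<epsilon> / 4))"
    and R: "R \<ge> 0" and \<tau>: "0 < \<tau>" "\<tau> \<le> \<kappa>"
    and \<tau>_le: "real (nparam p k) * (R + 2) * \<tau> \<le> \<kappa> * exp (- (R + 1)) / 2"
  obtains Bad where "Bad \<in> sets (P0n p f0 \<sigma> n)"
    and "measure (P0n p f0 \<sigma> n) Bad \<le> (2 * R / \<tau> + 3) ^ (nparam p k + 1) * exp (- (real n * \<epsilon> / 8))"
    and "\<forall>D\<in>space (P0n p f0 \<sigma> n) - Bad. (\<forall>i<n. \<forall>h<p. 0 \<le> snd (D i) h \<and> snd (D i) h \<le> 1) \<longrightarrow>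
      (\<forall>\<omega>. (\<forall>i\<le>nparam p k. \<bar>\<omega> i\<bar> \<le> R) \<longrightarrow> hellinger p k f0 \<sigma> \<omega> \<ge> \<epsilon>
        \<longrightarrow> lratio p k f0 \<sigma> n D \<omega> \<le> exp (- (real n * \<epsilon> / 4)))"
proof -
  let ?P = "P0n p f0 \<sigma> n"
  let ?Z = "(lborel :: real measure) \<Otimes>\<^sub>M cube_unif p"
  let ?K = "nparam p k"
  interpret P: prob_space ?P by (rule prob_space_P0n[OF f0 \<sigma>])
  have true_meas [measurable]: "true_dens f0 \<sigma> \<in> borel_measurable ?Z" by (rule borel_measurable_true_dens[OF f0])
  have true_pos: "true_dens f0 \<sigma> z > 0" for z using \<sigma> by (simp add: true_dens_pos)
  \<comment> \<open>The multiples of \<tau> from -M to M contain every floor of \<omega> i / \<tau>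
    with |\<omega> i| \<le> R, and M \<le> R / \<tau> + 1 gives the count 2 M + 1 \<le> 2 R / \<tau>
    + 3.\<close>
  define M where "M = \<lceil>R / \<tau>\<rceil>"
  define grid where "grid = PiE {..?K} (\<lambda>_. (\<lambda>j. \<tau> * real_of_int j) ` {- M..M})"
  have M0: "M \<ge> 0"
  proof -
    have "0 \<le> R / \<tau>" using R \<tau> by simp
    then show ?thesis unfolding M_def by linarith
  qed
  have fin: "finite grid" unfolding grid_def by (intro finite_PiE) auto
  have card: "real (card grid) \<le> (2 * R / \<tau> + 3) ^ (?K + 1)"
  proof -
    have "card grid = card ((\<lambda>j. \<tau> * real_of_int j) ` {- M..M}) ^ (?K + 1)"
      by (simp add: grid_def card_PiE)
    also have "\<dots> \<le> card {- M..M} ^ (?K + 1)" by (intro power_mono card_image_le) auto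
    finally have "real (card grid) \<le> real (card {- M..M} ^ (?K + 1))" by (rule of_nat_mono)
    also have "\<dots> = (2 * real_of_int M + 1) ^ (?K + 1)" using M0 by simp
    also have "\<dots> \<le> (2 * R / \<tau> + 3) ^ (?K + 1)"
    proof (rule power_mono)
      have "real_of_int M \<le> R / \<tau> + 1" unfolding M_def by linarith
      then show "2 * real_of_int M + 1 \<le> 2 * R / \<tau> + 3" by simp
    qed (use M0 in simp)
    finally show ?thesis .
  qed
  define S where "S = (\<lambda>g D. \<Prod>i<n. sqrt (bracket p k \<kappa> g (D i) / true_dens f0 \<sigma> (D i)))"
  have S_meas [measurable]: "S g \<in> borel_measurable ?P" for g
  proof -
    have "(\<lambda>z. sqrt (bracket p k \<kappa> g z / true_dens f0 \<sigma> z)) \<in> borel_measurable ?Z" by measurable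
    then show ?thesis unfolding S_def
      by (intro borel_measurable_prod measurable_compose[OF measurable_P0n_component]) auto
  qed
  \<comment> \<open>A grid point matters only if some parameter far from the truth lies next to it;
    that parameter is the witness that separates the bracket from the truth.\<close>
  define near where "near = (\<lambda>g \<omega>. (\<forall>i\<le>?K. \<bar>\<omega> i - g i\<bar> \<le> \<tau> \<and> \<bar>g i\<bar> \<le> R + 1) \<and> hellinger p k f0 \<sigma> \<omega> \<ge> \<epsilon>)"
  define E where "E = (\<lambda>g. {D \<in> space ?P. S g D \<ge> exp (- (real n * \<epsilon> / 8))})"
  have E_meas: "E g \<in> sets ?P" for g unfolding E_def by measurable
  have E_le: "measure ?P (E g) \<le> exp (- (real n * \<epsilon> / 8))" if near: "near g \<omega>" for g \<omega>
  proof -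
    let ?F = "\<lambda>z. sqrt (bracket p k \<kappa> g z / true_dens f0 \<sigma> z)"
    have F_nn: "?F z \<ge> 0" for z using true_pos[of z] by (simp add: bracket_nonneg)
    have "(\<integral>\<^sup>+D. ennreal (S g D) \<partial>?P) = (\<integral>\<^sup>+D. (\<Prod>i<n. ennreal (?F (D i))) \<partial>?P)"
      unfolding S_def using F_nn by (intro nn_integral_cong) (simp add: prod_ennreal)
    also have "\<dots> = (\<integral>\<^sup>+z. ennreal (?F z) \<partial>P0 p f0 \<sigma>) ^ n"
      by (rule nn_integral_P0n_prod[OF f0 \<sigma>]) measurable
    also have "\<dots> \<le> ennreal (exp (- (\<epsilon> / 4))) ^ n"
    proof (rule power_mono)
      have "model_dens p k \<omega> z \<le> bracket p k \<kappa> g z" if "\<forall>h<p. 0 \<le> snd z h \<and> snd z h \<le> 1" for z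
        by (rule model_dens_le_bracket[OF \<kappa> \<tau>(2) R \<tau>_le]) (use near that in \<open>auto simp: near_def\<close>)
      then have "(\<integral>\<^sup>+z. ennreal (?F z) \<partial>P0 p f0 \<sigma>) \<le> ennreal (exp (7 / 2 * \<kappa>) * (1 - \<epsilon> / 2 + 4 * sqrt \<kappa>))"
        using near by (intro nn_integral_P0_sqrt_bracket_le[OF f0 \<sigma> \<kappa>(1), of \<epsilon> k \<omega>]) (auto simp: near_def)
      also have "\<dots> \<le> ennreal (exp (- (\<epsilon> / 4)))" by (intro ennreal_leI \<kappa>_le)
      finally show "(\<integral>\<^sup>+z. ennreal (?F z) \<partial>P0 p f0 \<sigma>) \<le> ennreal (exp (- (\<epsilon> / 4)))" .
    qed simp
    also have "\<dots> = ennreal (exp (- (real n * \<epsilon> / 4)))"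
      by (simp add: ennreal_power exp_of_nat_mult[symmetric])
    finally have ES: "(\<integral>\<^sup>+D. ennreal (S g D) \<partial>?P) \<le> ennreal (exp (- (real n * \<epsilon> / 4)))" .
    have "emeasure ?P (E g) \<le> emeasure ?P {D \<in> space ?P. 1 \<le> ennreal (exp (real n * \<epsilon> / 8)) * ennreal (S g D)}"
    proof (rule emeasure_mono)
      show "E g \<subseteq> {D \<in> space ?P. 1 \<le> ennreal (exp (real n * \<epsilon> / 8)) * ennreal (S g D)}"
      proof
        fix D assume D: "D \<in> E g"
        then have "exp (real n * \<epsilon> / 8) * exp (- (real n * \<epsilon> / 8)) \<le> exp (real n * \<epsilon> / 8) * S g D"
          unfolding E_def by (intro mult_left_mono) auto
        then have "1 \<le> exp (real n * \<epsilon> / 8) * S g D" by (simp add: exp_minus)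
        then have "ennreal 1 \<le> ennreal (exp (real n * \<epsilon> / 8) * S g D)" by (rule ennreal_leI)
        then show "D \<in> {D \<in> space ?P. 1 \<le> ennreal (exp (real n * \<epsilon> / 8)) * ennreal (S g D)}"
          using D by (simp add: E_def ennreal_mult')
      qed
    qed measurable
    also have "\<dots> \<le> ennreal (exp (real n * \<epsilon> / 8)) * (\<integral>\<^sup>+D. ennreal (S g D) * indicator (space ?P) D \<partial>?P)"
      by (rule nn_integral_Markov_inequality) measurable
    also have "(\<integral>\<^sup>+D. ennreal (S g D) * indicator (space ?P) D \<partial>?P) = (\<integral>\<^sup>+D. ennreal (S g D) \<partial>?P)"
      by (rule nn_integral_cong) simp
    also have "ennreal (exp (real n * \<epsilon> / 8)) * \<dots> \<le> ennreal (exp (real n * \<epsilon> / 8)) * ennreal (exp (- (real n * \<epsilon> / 4)))"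
      by (intro mult_left_mono ES) simp
    also have "\<dots> = ennreal (exp (- (real n * \<epsilon> / 8)))"
      by (simp add: ennreal_mult[symmetric] exp_add[symmetric])
    finally show ?thesis by (simp add: P.emeasure_eq_measure)
  qed
  define G where "G = {g \<in> grid. \<exists>\<omega>. near g \<omega>}"
  define Bad where "Bad = (\<Union>g\<in>G. E g)"
  have finG: "finite G" using fin by (simp add: G_def)
  show ?thesis
  proof (rule that)
    show "Bad \<in> sets ?P" unfolding Bad_def using finG E_meas by (intro sets.finite_UN) auto
    have "measure ?P Bad \<le> (\<Sum>g\<in>G. measure ?P (E g))"
      unfolding Bad_def using finG E_meas by (intro P.finite_measure_subadditive_finite) auto
    also have "\<dots> \<le> (\<Sum>g\<in>G. exp (- (real n * \<epsilon> / 8)))"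
      by (intro sum_mono) (auto simp: G_def intro: E_le)
    also have "\<dots> = real (card G) * exp (- (real n * \<epsilon> / 8))" by simp
    also have "\<dots> \<le> (2 * R / \<tau> + 3) ^ (?K + 1) * exp (- (real n * \<epsilon> / 8))"
    proof (rule mult_right_mono)
      have "card G \<le> card grid" using fin by (intro card_mono) (auto simp: G_def)
      then show "real (card G) \<le> (2 * R / \<tau> + 3) ^ (?K + 1)" using card by linarith
    qed simp
    finally show "measure ?P Bad \<le> (2 * R / \<tau> + 3) ^ (?K + 1) * exp (- (real n * \<epsilon> / 8))" .
    show "\<forall>D\<in>space ?P - Bad. (\<forall>i<n. \<forall>h<p. 0 \<le> snd (D i) h \<and> snd (D i) h \<le> 1) \<longrightarrow>
      (\<forall>\<omega>. (\<forall>i\<le>?K. \<bar>\<omega> i\<bar> \<le> R) \<longrightarrow> hellinger p k f0 \<sigma> \<omega> \<ge> \<epsilon> \<longrightarrow> lratio p k f0 \<sigma> n D \<omega> \<le> exp (- (real n * \<epsilon> / 4)))"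
    proof (intro ballI impI allI)
      fix D \<omega>
      assume D: "D \<in> space ?P - Bad" and cube: "\<forall>i<n. \<forall>h<p. 0 \<le> snd (D i) h \<and> snd (D i) h \<le> 1"
        and \<omega>': "\<forall>i\<le>?K. \<bar>\<omega> i\<bar> \<le> R" and hell: "hellinger p k f0 \<sigma> \<omega> \<ge> \<epsilon>"
      have \<omega>: "\<bar>\<omega> i\<bar> \<le> R" if "i \<le> ?K" for i using \<omega>' that by simp
      define g where "g = (\<lambda>i\<in>{..?K}. \<tau> * real_of_int \<lfloor>\<omega> i / \<tau>\<rfloor>)"
      have g_eq: "g i = \<tau> * real_of_int \<lfloor>\<omega> i / \<tau>\<rfloor>" if "i \<le> ?K" for i using that by (simp add: g_def)
      have d: "\<bar>\<omega> i - g i\<bar> \<le> \<tau>" if "i \<le> ?K" for i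
      proof -
        have "\<tau> * real_of_int \<lfloor>\<omega> i / \<tau>\<rfloor> \<le> \<tau> * (\<omega> i / \<tau>)" "\<tau> * (\<omega> i / \<tau>) \<le> \<tau> * (real_of_int \<lfloor>\<omega> i / \<tau>\<rfloor> + 1)"
          using \<tau> by (intro mult_left_mono; linarith)+
        then show ?thesis using \<tau> g_eq[OF that] by (simp add: algebra_simps)
      qed
      have g_le: "\<bar>g i\<bar> \<le> R + 1" if "i \<le> ?K" for i
        using d[OF that] \<omega>[OF that] \<tau> \<kappa> by linarith
      have near: "near g \<omega>" using d g_le hell by (simp add: near_def)
      have "g \<in> grid"
        unfolding grid_def g_def
      proof (rule restrict_PiE_iff[THEN iffD2], rule ballI, rule imageI)
        fix i assume "i \<in> {..?K}"
        then have "\<bar>\<omega> i / \<tau>\<bar> \<le> R / \<tau>" using \<omega> \<tau> by (simp add: abs_divide divide_right_mono)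
        then have "\<omega> i / \<tau> \<le> R / \<tau>" "- (\<omega> i / \<tau>) \<le> R / \<tau>"
          by (rule abs_le_D1, rule abs_le_D2)
        then have "\<lfloor>\<omega> i / \<tau>\<rfloor> \<le> \<lceil>R / \<tau>\<rceil>" "- \<lceil>R / \<tau>\<rceil> \<le> \<lfloor>\<omega> i / \<tau>\<rfloor>" by linarith+
        then show "\<lfloor>\<omega> i / \<tau>\<rfloor> \<in> {- M..M}" unfolding M_def by simp
      qed
      then have "g \<in> G" using near by (auto simp: G_def)
      then have S_lt: "S g D < exp (- (real n * \<epsilon> / 8))"
        using D by (auto simp: Bad_def E_def not_le)
      have "lratio p k f0 \<sigma> n D \<omega> \<le> (\<Prod>i<n. bracket p k \<kappa> g (D i) / true_dens f0 \<sigma> (D i))"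
        unfolding lratio_def
      proof (intro prod_mono conjI divide_right_mono)
        fix i assume "i \<in> {..<n}"
        then show "model_dens p k \<omega> (D i) \<le> bracket p k \<kappa> g (D i)"
          using cube d g_le by (intro model_dens_le_bracket[OF \<kappa> \<tau>(2) R \<tau>_le]) auto
      qed (use true_pos model_dens_pos in \<open>auto simp: less_imp_le\<close>)
      also have "\<dots> = (S g D)\<^sup>2"
        unfolding S_def prod_power_distrib
        using true_pos by (intro prod.cong) (auto simp: bracket_nonneg less_imp_le)
      also have "\<dots> \<le> (exp (- (real n * \<epsilon> / 8)))\<^sup>2"
        using S_lt by (intro power_mono) (auto simp: S_def bracket_nonneg true_pos less_imp_le intro!: prod_nonneg)
      also have "\<dots> = exp (- (real n * \<epsilon> / 4))" by (simp add: exp_double[symmetric])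
      finally show "lratio p k f0 \<sigma> n D \<omega> \<le> exp (- (real n * \<epsilon> / 4))" .
    qed
  qed
qed

subsection \<open>A bound for finite samples\<close>

text \<open>Chernoff's bound in each coordinate and a union bound; \<eta>^2 + \<zeta>^2 dominates
  both prior variances.\<close>

lemma nn_integral_prior_tail_le:
  assumes pos: "\<eta> > 0" "\<zeta> > 0" and u: "u \<ge> 0"
  shows "(\<integral>\<^sup>+\<omega>. ennreal (prior_dens p k \<eta> \<zeta> \<omega>) * indicator {\<omega>. \<exists>i\<le>nparam p k. \<bar>\<omega> i\<bar> > R} \<omega> \<partial>param_space p k)
    \<le> ennreal (real (nparam p k + 1) * (2 * exp (u\<^sup>2 * (\<eta>\<^sup>2 + \<zeta>\<^sup>2) / 2 - u * R)))"
proof -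
  let ?K = "nparam p k" and ?N = "param_space p k" and ?q = "prior_dens p k \<eta> \<zeta>"
  let ?I = "\<lambda>i \<omega>. indicator {x. \<bar>x\<bar> > R} (\<omega> i) :: ennreal"
  let ?b = "2 * exp (u\<^sup>2 * (\<eta>\<^sup>2 + \<zeta>\<^sup>2) / 2 - u * R)"
  have I_meas: "(\<lambda>\<omega>. ennreal (?q \<omega>) * ?I i \<omega>) \<in> borel_measurable ?N" if "i \<le> ?K" for i
  proof -
    have [measurable]: "(\<lambda>\<omega>. \<omega> i) \<in> borel_measurable ?N" using that by simp
    show ?thesis by measurable
  qed
  have "(\<integral>\<^sup>+\<omega>. ennreal (?q \<omega>) * indicator {\<omega>. \<exists>i\<le>?K. \<bar>\<omega> i\<bar> > R} \<omega> \<partial>?N)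
    \<le> (\<integral>\<^sup>+\<omega>. (\<Sum>i\<le>?K. ennreal (?q \<omega>) * ?I i \<omega>) \<partial>?N)"
  proof (rule nn_integral_mono)
    fix \<omega> :: "nat \<Rightarrow> real"
    have "indicator {\<omega>. \<exists>i\<le>?K. \<bar>\<omega> i\<bar> > R} \<omega> \<le> (\<Sum>i\<le>?K. ?I i \<omega>)"
    proof (cases "\<exists>i\<le>?K. \<bar>\<omega> i\<bar> > R")
      case True
      then obtain i where i: "i \<le> ?K" "\<bar>\<omega> i\<bar> > R" by blast
      then have "?I i \<omega> \<le> (\<Sum>i\<le>?K. ?I i \<omega>)" by (intro member_le_sum) auto
      then show ?thesis using True i by simp
    qed simp
    then have "ennreal (?q \<omega>) * indicator {\<omega>. \<exists>i\<le>?K. \<bar>\<omega> i\<bar> > R} \<omega> \<le> ennreal (?q \<omega>) * (\<Sum>i\<le>?K. ?I i \<omega>)"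
      by (intro mult_left_mono) auto
    then show "ennreal (?q \<omega>) * indicator {\<omega>. \<exists>i\<le>?K. \<bar>\<omega> i\<bar> > R} \<omega> \<le> (\<Sum>i\<le>?K. ennreal (?q \<omega>) * ?I i \<omega>)"
      by (simp add: sum_distrib_left)
  qed
  also have "\<dots> = (\<Sum>i\<le>?K. \<integral>\<^sup>+\<omega>. ennreal (?q \<omega>) * ?I i \<omega> \<partial>?N)"
    using I_meas by (intro nn_integral_sum) simp
  also have "\<dots> \<le> (\<Sum>i\<le>?K. ennreal ?b)"
  proof (rule sum_mono)
    fix i assume i: "i \<in> {..?K}"
    let ?s = "prior_scale \<eta> \<zeta> i"
    have s: "?s > 0" using pos by (rule prior_scale_pos)
    have "(\<integral>\<^sup>+\<omega>. ennreal (?q \<omega>) * ?I i \<omega> \<partial>?N) = (\<integral>\<^sup>+x. ennreal (normal_density 0 ?s x) * indicator {x. \<bar>x\<bar> > R} x \<partial>lborel)"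
      unfolding prior_dens_eq_vdens using i pos
      by (intro nn_integral_vdens_component) (auto simp: prior_scale_pos)
    also have "\<dots> \<le> ennreal (2 * exp (u\<^sup>2 * ?s\<^sup>2 / 2 - u * R))"
      by (rule nn_integral_normal_tail_le[OF s u])
    also have "\<dots> \<le> ennreal ?b"
    proof -
      have "u\<^sup>2 * ?s\<^sup>2 \<le> u\<^sup>2 * (\<eta>\<^sup>2 + \<zeta>\<^sup>2)"
        by (intro mult_left_mono) (auto simp: prior_scale_def)
      then show ?thesis by (intro ennreal_leI) simp
    qed
    finally show "(\<integral>\<^sup>+\<omega>. ennreal (?q \<omega>) * ?I i \<omega> \<partial>?N) \<le> ennreal ?b" .
  qed
  also have "\<dots> = ennreal (real (?K + 1) * ?b)"
    by (simp add: ennreal_of_nat_eq_real_of_nat ennreal_mult[symmetric] del: of_nat_Suc)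
  finally show ?thesis .
qed

lemma outer_prob_le_measure:
  assumes "B \<in> sets M" "S \<subseteq> B"
  shows "outer_prob M S \<le> measure M B"
  unfolding outer_prob_def using assms
  by (intro cInf_lower) (auto intro!: bdd_belowI[of _ 0])

lemma outer_prob_nonneg:
  assumes "S \<subseteq> space M"
  shows "0 \<le> outer_prob M S"
  unfolding outer_prob_def
proof (rule cInf_greatest)
  show "{measure M B |B. B \<in> sets M \<and> S \<subseteq> B} \<noteq> {}"
    using assms sets.top[of M] by blast
qed auto

text \<open>\<open>ms\<close> and \<open>ss\<close> are arbitrary functions of the data, so the
  event may fail to be measurable. It is covered by three measurable sets: \<open>Bad\<close> from
  the sieve, \<open>Big\<close> from Markov's inequality and a null set \<open>Z\<close>. The 1 in c
  t - 1 is the total prior mass, which bounds the contribution of the sieve to the third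
  term.\<close>

lemma outer_prob_vmeasure_tail_le:
  fixes ms ss :: "(nat \<Rightarrow> real \<times> (nat \<Rightarrow> real)) \<Rightarrow> nat \<Rightarrow> real" and m0 s0 :: "nat \<Rightarrow> real" and n :: nat
  assumes f0: "f0 \<in> borel_measurable (cube_unif p)"
    and pos: "\<sigma> > 0" "\<eta> > 0" "\<zeta> > 0"
    and s0: "\<And>i. i \<le> nparam p k \<Longrightarrow> s0 i > 0"
  defines "q \<equiv> vdens p k m0 s0" and "N \<equiv> param_space p k" and "P \<equiv> P0n p f0 \<sigma> n" and "K \<equiv> nparam p k"
  assumes E1: "(\<integral>\<^sup>+D. \<integral>\<^sup>+\<omega>. ennreal (q \<omega>) * ennreal \<bar>ln (q \<omega> / weight p k f0 \<sigma> \<eta> \<zeta> n D \<omega>)\<bar> \<partial>N \<partial>P) \<le> ennreal E1"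
      "E1 \<ge> 0"
    and \<kappa>: "0 < \<kappa>" "\<kappa> \<le> 1" "exp (7 / 2 * \<kappa>) * (1 - \<epsilon> / 2 + 4 * sqrt \<kappa>) \<le> exp (- (\<epsilon> / 4))"
    and R: "R \<ge> 0" and \<tau>: "0 < \<tau>" "\<tau> \<le> \<kappa>" "real K * (R + 2) * \<tau> \<le> \<kappa> * exp (- (R + 1)) / 2"
    and t: "0 \<le> t" "t \<le> real n * \<epsilon> / 4" and u: "u \<ge> 0" and c: "c * t > 1"
    and VB: "AE D in P. vb_minimizer p k \<eta> \<zeta> n D (ms D) (ss D)"
  shows "outer_prob P {D \<in> space P. \<bar>measure (vmeasure p k (ms D) (ss D))
              {\<omega> \<in> space N. hellinger p k f0 \<sigma> \<omega> \<ge> \<epsilon>}\<bar> > c}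
    \<le> (2 * R / \<tau> + 3) ^ (K + 1) * exp (- (real n * \<epsilon> / 8))
      + (E1 + 1 + exp t * (real (K + 1) * (2 * exp (u\<^sup>2 * (\<eta>\<^sup>2 + \<zeta>\<^sup>2) / 2 - u * R)))) / (c * t - 1)"
    (is "outer_prob P ?S \<le> ?b1 + ?E / (c * t - 1)")
proof -
  interpret P: prob_space P unfolding P_def by (rule prob_space_P0n[OF f0 pos(1)])
  interpret N: sigma_finite_measure N unfolding N_def by (rule sigma_finite_param_space)
  let ?w = "weight p k f0 \<sigma> \<eta> \<zeta> n"
  let ?F = "{\<omega>. \<exists>i\<le>K. \<bar>\<omega> i\<bar> > R}"
  let ?A = "{\<omega> \<in> space N. hellinger p k f0 \<sigma> \<omega> \<ge> \<epsilon>}"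
  obtain Bad where Bad: "Bad \<in> sets P" "measure P Bad \<le> ?b1"
    and Bad_lr: "\<forall>D\<in>space P - Bad. (\<forall>i<n. \<forall>h<p. 0 \<le> snd (D i) h \<and> snd (D i) h \<le> 1) \<longrightarrow>
      (\<forall>\<omega>. (\<forall>i\<le>K. \<bar>\<omega> i\<bar> \<le> R) \<longrightarrow> hellinger p k f0 \<sigma> \<omega> \<ge> \<epsilon> \<longrightarrow> lratio p k f0 \<sigma> n D \<omega> \<le> exp (- (real n * \<epsilon> / 4)))"
    by (rule wald_sieve[OF f0 pos(1) \<kappa> R \<tau>[unfolded K_def], of n, folded P_def K_def]) (rule that)
  have q_meas [measurable]: "q \<in> borel_measurable N" by (simp add: q_def N_def)
  have w_meas [measurable]: "(\<lambda>x. ?w (fst x) (snd x)) \<in> borel_measurable (P \<Otimes>\<^sub>M N)"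
    unfolding P_def N_def by (rule borel_measurable_weight[OF f0 measurable_snd measurable_fst])
  have F_meas [measurable]: "(\<lambda>\<omega>. indicator ?F \<omega> :: ennreal) \<in> borel_measurable N"
  proof -
    have "{\<omega> \<in> space N. \<exists>i\<in>{..K}. \<bar>\<omega> i\<bar> > R} \<in> sets N"
    proof (rule sets.sets_Collect_finite_Ex)
      fix i assume "i \<in> {..K}"
      then have [measurable]: "(\<lambda>\<omega>. \<omega> i) \<in> borel_measurable N" by (simp add: N_def K_def)
      show "{\<omega> \<in> space N. \<bar>\<omega> i\<bar> > R} \<in> sets N" by measurable
    qed simp
    also have "{\<omega> \<in> space N. \<exists>i\<in>{..K}. \<bar>\<omega> i\<bar> > R} = ?F \<inter> space N" by auto
    finally show ?thesis by (subst borel_measurable_indicator_iff)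
  qed
  define T1 where "T1 = (\<lambda>D. \<integral>\<^sup>+\<omega>. ennreal (q \<omega>) * ennreal \<bar>ln (q \<omega> / ?w D \<omega>)\<bar> \<partial>N)"
  define T2 where "T2 = (\<lambda>D. \<integral>\<^sup>+\<omega>. ennreal (?w D \<omega>) \<partial>N)"
  define T3 where "T3 = (\<lambda>D. \<integral>\<^sup>+\<omega>. ennreal (?w D \<omega>) * indicator ?F \<omega> \<partial>N)"
  \<comment> \<open>Only the competitor and the weight occur in \<open>T\<close>, so it is
    measurable in the data even where the minimiser is not.\<close>
  define T where "T = (\<lambda>D. T1 D + T2 D + ennreal (exp t) * T3 D)"
  have q_snd [measurable]: "(\<lambda>x. q (snd x)) \<in> borel_measurable (P \<Otimes>\<^sub>M N)"
    by (rule measurable_compose[OF measurable_snd q_meas])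
  have F_snd [measurable]: "(\<lambda>x. indicator ?F (snd x) :: ennreal) \<in> borel_measurable (P \<Otimes>\<^sub>M N)"
    by (rule measurable_compose[OF measurable_snd F_meas])
  have T_parts [measurable]: "T1 \<in> borel_measurable P" "T2 \<in> borel_measurable P" "T3 \<in> borel_measurable P"
  proof -
    have "(\<lambda>x. ennreal (q (snd x)) * ennreal \<bar>ln (q (snd x) / ?w (fst x) (snd x))\<bar>) \<in> borel_measurable (P \<Otimes>\<^sub>M N)"
      by (intro borel_measurable_times_ennreal measurable_compose[OF _ measurable_ennreal] borel_measurable_abs
          borel_measurable_ln borel_measurable_divide q_snd w_meas)
    then show "T1 \<in> borel_measurable P"
      unfolding T1_def by (intro N.borel_measurable_nn_integral) (simp only: case_prod_beta')
    have "(\<lambda>x. ennreal (?w (fst x) (snd x))) \<in> borel_measurable (P \<Otimes>\<^sub>M N)"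
      by (rule measurable_compose[OF w_meas measurable_ennreal])
    then show "T2 \<in> borel_measurable P"
      unfolding T2_def by (intro N.borel_measurable_nn_integral) (simp only: case_prod_beta')
    have "(\<lambda>x. ennreal (?w (fst x) (snd x)) * indicator ?F (snd x)) \<in> borel_measurable (P \<Otimes>\<^sub>M N)"
      by (intro borel_measurable_times_ennreal measurable_compose[OF _ measurable_ennreal] w_meas F_snd)
    then show "T3 \<in> borel_measurable P"
      unfolding T3_def by (intro N.borel_measurable_nn_integral) (simp only: case_prod_beta')
  qed
  have T_meas [measurable]: "T \<in> borel_measurable P" unfolding T_def by measurable
  have ET: "(\<integral>\<^sup>+D. T D \<partial>P) \<le> ennreal ?E"
  proof -
    have 2: "(\<integral>\<^sup>+D. T2 D \<partial>P) = 1"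
      using nn_integral_weight[OF f0 pos, of "\<lambda>_. 1" k n] pos
      by (simp add: T2_def N_def P_def prior_dens_eq_vdens prior_scale_pos)
    have 3: "(\<integral>\<^sup>+D. T3 D \<partial>P) \<le> ennreal (real (K + 1) * (2 * exp (u\<^sup>2 * (\<eta>\<^sup>2 + \<zeta>\<^sup>2) / 2 - u * R)))"
      unfolding T3_def N_def P_def
      using nn_integral_weight[OF f0 pos F_meas[unfolded N_def], of n] nn_integral_prior_tail_le[OF pos(2,3) u, of p k R]
      by (simp add: K_def)
    have "(\<integral>\<^sup>+D. T D \<partial>P) = (\<integral>\<^sup>+D. T1 D \<partial>P) + (\<integral>\<^sup>+D. T2 D \<partial>P) + ennreal (exp t) * (\<integral>\<^sup>+D. T3 D \<partial>P)"
      unfolding T_def by (simp add: nn_integral_add nn_integral_cmult)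
    also have "\<dots> \<le> ennreal E1 + 1 + ennreal (exp t) * ennreal (real (K + 1) * (2 * exp (u\<^sup>2 * (\<eta>\<^sup>2 + \<zeta>\<^sup>2) / 2 - u * R)))"
      using E1(1) 2 3 by (intro add_mono mult_left_mono) (auto simp: T1_def)
    also have "\<dots> = ennreal ?E"
      using E1(2) by (simp add: ennreal_plus ennreal_mult del: of_nat_add of_nat_Suc)
    finally show ?thesis .
  qed
  have E0: "?E \<ge> 0" using E1(2) by simp
  have "AE D in P. vb_minimizer p k \<eta> \<zeta> n D (ms D) (ss D) \<and> (\<forall>i<n. \<forall>h<p. 0 \<le> snd (D i) h \<and> snd (D i) h \<le> 1)"
    using VB AE_P0n_cube[OF f0 pos(1), of n] unfolding P_def by (rule AE_conjI)
  \<comment> \<open>The data without a minimiser may form a non-measurable set; the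
    almost-everywhere filter supplies a measurable null set that contains it.\<close>
  then obtain Z where Z: "Z \<in> null_sets P"
    and Z_sub: "{D \<in> space P. \<not> (vb_minimizer p k \<eta> \<zeta> n D (ms D) (ss D) \<and> (\<forall>i<n. \<forall>h<p. 0 \<le> snd (D i) h \<and> snd (D i) h \<le> 1))} \<subseteq> Z"
    unfolding eventually_ae_filter by (elim bexE) (rule that)
  define Big where "Big = {D \<in> space P. 1 \<le> ennreal (1 / (c * t - 1)) * T D}"
  have Big_meas: "Big \<in> sets P" unfolding Big_def by measurable
  have Big_le: "measure P Big \<le> ?E / (c * t - 1)"
  proof -
    have "emeasure P Big \<le> ennreal (1 / (c * t - 1)) * (\<integral>\<^sup>+D. T D * indicator (space P) D \<partial>P)"
      unfolding Big_def by (rule nn_integral_Markov_inequality) measurable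
    also have "(\<integral>\<^sup>+D. T D * indicator (space P) D \<partial>P) = (\<integral>\<^sup>+D. T D \<partial>P)"
      by (rule nn_integral_cong) simp
    also have "ennreal (1 / (c * t - 1)) * \<dots> \<le> ennreal (1 / (c * t - 1)) * ennreal ?E"
      by (intro mult_left_mono ET) simp
    also have "\<dots> = ennreal (?E / (c * t - 1))"
      using c E0 by (subst ennreal_mult[symmetric]) auto
    finally show ?thesis using c E0 by (simp add: P.emeasure_eq_measure)
  qed
  have "?S \<subseteq> Bad \<union> Big \<union> Z"
  proof
    fix D assume D: "D \<in> ?S"
    show "D \<in> Bad \<union> Big \<union> Z"
    proof (rule ccontr)
      assume not: "D \<notin> Bad \<union> Big \<union> Z"
      have sp: "D \<in> space P" using D by simp
      then have vb: "vb_minimizer p k \<eta> \<zeta> n D (ms D) (ss D)"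
        and cube: "\<forall>i<n. \<forall>h<p. 0 \<le> snd (D i) h \<and> snd (D i) h \<le> 1"
        using not Z_sub by blast+
      have "ennreal (1 / (c * t - 1)) * T D < 1" using not sp by (auto simp: Big_def not_le)
      then have "ennreal (c * t - 1) * (ennreal (1 / (c * t - 1)) * T D) < ennreal (c * t - 1) * 1"
        using c by (intro ennreal_mult_strict_left_mono) auto
      moreover have "ennreal (c * t - 1) * ennreal (1 / (c * t - 1)) = 1"
        using c by (subst ennreal_mult[symmetric]) auto
      ultimately have T_lt: "T D < ennreal (c * t - 1)" by (simp add: mult.assoc[symmetric])
      also have "\<dots> < \<infinity>" by simp
      \<comment> \<open>Lying outside \<open>Big\<close> also yields the finiteness that
        \<open>vmeasure_tail_bound\<close> asks for.\<close>
      finally have fin: "T1 D < \<infinity>" "T2 D < \<infinity>" by (auto simp: T_def)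
      have w_pos: "?w D \<omega> > 0" for \<omega> using pos by (rule weight_pos)
      have wD_meas [measurable]: "?w D \<in> borel_measurable N"
        using measurable_compose[OF measurable_Pair1'[OF sp] w_meas] by simp
      have wF_meas: "(\<lambda>\<omega>. ennreal (?w D \<omega>) * indicator ?F \<omega>) \<in> borel_measurable N"
        by (intro borel_measurable_times_ennreal measurable_compose[OF wD_meas measurable_ennreal] F_meas)
      have prior_meas: "(\<lambda>\<omega>. ennreal (prior_dens p k \<eta> \<zeta> \<omega>)) \<in> borel_measurable N"
        unfolding N_def by (rule measurable_compose[OF borel_measurable_prior_dens measurable_ennreal])
      \<comment> \<open>On the sieve the ratio is at most e^(-n \<epsilon>/4) \<le> e^(-t), which
        cancels e^t and leaves the prior density. Off the sieve the weight is kept, to be averaged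
        over the data.\<close>
      have sieve: "ennreal (exp t) * (ennreal (?w D \<omega>) * indicator ?A \<omega>) \<le> ennreal (exp t) * (ennreal (?w D \<omega>) * indicator ?F \<omega>) + ennreal (prior_dens p k \<eta> \<zeta> \<omega>)" for \<omega>
      proof (cases "\<omega> \<in> ?A \<and> \<omega> \<notin> ?F")
        case True
        then have "lratio p k f0 \<sigma> n D \<omega> \<le> exp (- (real n * \<epsilon> / 4))"
          using not sp cube Bad_lr by (auto simp: not_less)
        also have "\<dots> \<le> exp (- t)" using t by simp
        finally have "exp t * (lratio p k f0 \<sigma> n D \<omega> * prior_dens p k \<eta> \<zeta> \<omega>) \<le> exp t * (exp (- t) * prior_dens p k \<eta> \<zeta> \<omega>)"
          using prior_dens_pos[OF pos(2,3), of p k \<omega>] by (intro mult_left_mono mult_right_mono) auto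
        also have "\<dots> = prior_dens p k \<eta> \<zeta> \<omega>" by (simp add: exp_minus)
        finally have "ennreal (exp t * ?w D \<omega>) \<le> ennreal (prior_dens p k \<eta> \<zeta> \<omega>)"
          unfolding weight_def by (rule ennreal_leI)
        then show ?thesis using True by (auto simp: ennreal_mult')
      next
        case False
        then show ?thesis by (cases "\<omega> \<in> ?A") (auto intro!: add_increasing2)
      qed
      have "ennreal (exp t) * (\<integral>\<^sup>+\<omega>. ennreal (?w D \<omega>) * indicator ?A \<omega> \<partial>N) \<le> ennreal (exp t) * T3 D + 1"
        if A: "?A \<in> sets N"
      proof -
        have "ennreal (exp t) * (\<integral>\<^sup>+\<omega>. ennreal (?w D \<omega>) * indicator ?A \<omega> \<partial>N)
          = (\<integral>\<^sup>+\<omega>. ennreal (exp t) * (ennreal (?w D \<omega>) * indicator ?A \<omega>) \<partial>N)"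
          by (intro nn_integral_cmult[symmetric] borel_measurable_times_ennreal
              measurable_compose[OF wD_meas measurable_ennreal] borel_measurable_indicator A)
        also have "\<dots> \<le> (\<integral>\<^sup>+\<omega>. ennreal (exp t) * (ennreal (?w D \<omega>) * indicator ?F \<omega>) + ennreal (prior_dens p k \<eta> \<zeta> \<omega>) \<partial>N)"
          by (intro nn_integral_mono sieve)
        also have "\<dots> = (\<integral>\<^sup>+\<omega>. ennreal (exp t) * (ennreal (?w D \<omega>) * indicator ?F \<omega>) \<partial>N) + (\<integral>\<^sup>+\<omega>. ennreal (prior_dens p k \<eta> \<zeta> \<omega>) \<partial>N)"
          by (intro nn_integral_add borel_measurable_times_ennreal borel_measurable_const wF_meas prior_meas)
        also have "(\<integral>\<^sup>+\<omega>. ennreal (exp t) * (ennreal (?w D \<omega>) * indicator ?F \<omega>) \<partial>N) = ennreal (exp t) * T3 D"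
          unfolding T3_def by (rule nn_integral_cmult[OF wF_meas])
        also have "(\<integral>\<^sup>+\<omega>. ennreal (prior_dens p k \<eta> \<zeta> \<omega>) \<partial>N) = 1"
          using pos by (simp add: N_def prior_dens_eq_vdens prior_scale_pos)
        finally show ?thesis .
      qed
      moreover have "ennreal (t * measure (vmeasure p k (ms D) (ss D)) ?A)
        \<le> T1 D + T2 D + ennreal (exp t) * (\<integral>\<^sup>+\<omega>. ennreal (?w D \<omega>) * indicator ?A \<omega> \<partial>N)"
        unfolding T1_def T2_def q_def N_def
        by (rule vmeasure_tail_bound[OF f0 pos t(1) sp[unfolded P_def] vb s0])
          (use fin in \<open>simp_all add: T1_def T2_def q_def N_def\<close>)
      \<comment> \<open>The default value 0 settles the case of a far set outside the
        sigma-algebra.\<close>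
      moreover have "measure (vmeasure p k (ms D) (ss D)) ?A = 0" if "?A \<notin> sets N"
        using that by (simp add: measure_notin_sets vmeasure_def N_def)
      ultimately have "ennreal (t * measure (vmeasure p k (ms D) (ss D)) ?A) \<le> T D + 1"
        by (cases "?A \<in> sets N") (auto simp: T_def add.assoc intro: order.trans add_left_mono)
      also have "\<dots> < ennreal (c * t - 1) + 1"
        using T_lt by (simp add: add.commute[of _ 1] ennreal_add_left_cancel_less)
      also have "\<dots> = ennreal (c * t)"
        using c by (simp add: ennreal_plus[symmetric] ennreal_1[symmetric] del: ennreal_plus ennreal_1)
      finally have "t * measure (vmeasure p k (ms D) (ss D)) ?A < c * t"
        using t by (subst (asm) ennreal_less_iff) auto
      moreover have "t * c \<le> t * measure (vmeasure p k (ms D) (ss D)) ?A"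
        using D t by (intro mult_left_mono) auto
      ultimately show False by (simp add: mult.commute)
    qed
  qed
  moreover have "Bad \<union> Big \<union> Z \<in> sets P" using Bad(1) Big_meas Z by auto
  ultimately have "outer_prob P ?S \<le> measure P (Bad \<union> Big \<union> Z)"
    by (intro outer_prob_le_measure)
  also have "\<dots> = measure P (Bad \<union> Big)"
    using Z Bad(1) Big_meas by (intro measure_Un_null_set) auto
  also have "\<dots> \<le> measure P Bad + measure P Big"
    using Bad(1) Big_meas by (intro measure_Un_le)
  also have "\<dots> \<le> ?b1 + ?E / (c * t - 1)"
    using Bad(2) Big_le by simp
  finally show ?thesis .
qed

subsection \<open>Asymptotics\<close>

text \<open>The base is eventually at most e^((V + 1) sqrt n), where the extra sqrt n absorbs all
  polynomial factors, and the power is O(n^a). The resulting exponent of order n^(a + 1/2) loses to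
  n \<epsilon>/8 because a < 1/2.\<close>

lemma sieve_entropy_tendsto_0:
  fixes K :: "nat \<Rightarrow> nat" and V C \<kappa> \<epsilon> a :: real
  assumes a: "0 < a" "a < 1 / 2" and pos: "V > 0" "C > 0" "\<kappa> > 0" "\<epsilon> > 0"
    and K: "\<And>n. K n \<ge> 1" "\<forall>\<^sub>F n in sequentially. real (K n) \<le> C * real n powr a"
  defines "\<tau> \<equiv> (\<lambda>n. \<kappa> * exp (- (V * sqrt (real n) + 1)) / (2 * real (K n) * (V * sqrt (real n) + 2)))"
  shows "(\<lambda>n. (2 * (V * sqrt (real n)) / \<tau> n + 3) ^ (K n + 1) * exp (- (real n * \<epsilon> / 8))) \<longlonglongrightarrow> 0"
proof (rule tendsto_sandwich[OF _ _ tendsto_const])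
  let ?R = "\<lambda>n. V * sqrt (real n)"
  have \<tau>_pos: "\<tau> n > 0" for n
    using pos K(1)[of n] by (simp add: \<tau>_def add_nonneg_pos)
  have base: "2 * ?R n / \<tau> n = 4 * ?R n * (?R n + 2) * real (K n) * exp (?R n + 1) / \<kappa>" for n
    unfolding \<tau>_def exp_minus using pos K(1)[of n] by (simp add: field_simps)
  have base_pos: "1 \<le> 2 * ?R n / \<tau> n + 3" for n
    using \<tau>_pos[of n] pos by (simp add: add_nonneg_nonneg)
  show "\<forall>\<^sub>F n in sequentially. 0 \<le> (2 * ?R n / \<tau> n + 3) ^ (K n + 1) * exp (- (real n * \<epsilon> / 8))"
    by (intro always_eventually allI mult_nonneg_nonneg zero_le_power
        order.trans[OF zero_le_one base_pos]) simp
  \<comment> \<open>Inside the base the crude bound K \<le> C n suffices; K \<le> C n^a matters only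
    in the power.\<close>
  have growth: "\<forall>\<^sub>F n in sequentially. 4 * ?R n * (?R n + 2) * (C * real n) * exp (?R n + 1) / \<kappa> + 3 \<le> exp ((V + 1) * sqrt (real n))"
    using pos by real_asymp
  show "\<forall>\<^sub>F n in sequentially. (2 * ?R n / \<tau> n + 3) ^ (K n + 1) * exp (- (real n * \<epsilon> / 8))
     \<le> exp ((V + 1) * sqrt (real n) * (C * real n powr a + 1) - real n * \<epsilon> / 8)"
    using K(2) growth eventually_ge_at_top[of 1]
  proof eventually_elim
    case (elim n)
    have "real n powr a \<le> real n powr 1" using elim(3) a(2) by (intro powr_mono) auto
    then have "real (K n) \<le> C * real n" using elim(1,3) pos by (smt (verit) mult_left_mono powr_one of_nat_0_le_iff)
    then have "2 * ?R n / \<tau> n + 3 \<le> 4 * ?R n * (?R n + 2) * (C * real n) * exp (?R n + 1) / \<kappa> + 3"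
      unfolding base using pos by (intro add_right_mono divide_right_mono mult_right_mono mult_left_mono) auto
    also have "\<dots> \<le> exp ((V + 1) * sqrt (real n))" by (rule elim(2))
    finally have "(2 * ?R n / \<tau> n + 3) ^ (K n + 1) \<le> exp ((V + 1) * sqrt (real n)) ^ (K n + 1)"
      using base_pos[of n] by (intro power_mono) auto
    also have "\<dots> = exp ((V + 1) * sqrt (real n) * (real (K n) + 1))"
      by (simp only: exp_of_nat_mult[symmetric]) (simp add: algebra_simps)
    also have "\<dots> \<le> exp ((V + 1) * sqrt (real n) * (C * real n powr a + 1))"
      using elim(1) pos by (simp add: mult_left_mono)
    finally show ?case
      unfolding diff_conv_add_uminus exp_add by (intro mult_right_mono) simp_all
  qed
  show "(\<lambda>n. exp ((V + 1) * sqrt (real n) * (C * real n powr a + 1) - real n * \<epsilon> / 8)) \<longlonglongrightarrow> 0"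
    using pos a by real_asymp
qed

text \<open>Eventually k \<le> 2 n^a and 1 \<le> n^a, so 1 + k (p + 2) is at most (1 + 2 (p + 2))
  n^a.\<close>

lemma nparam_eventually_le:
  assumes "(\<lambda>n. real (k n)) \<sim>[at_top] (\<lambda>n. real n powr a)" and a: "a \<ge> 0"
  shows "\<forall>\<^sub>F n in sequentially. real (nparam p (k n)) \<le> (2 * real p + 5) * real n powr a"
proof -
  \<comment> \<open>\<open>asymp_equiv_def\<close> gives the quotient 0 / 0 the value 1; for n > 0
    the denominator is positive and the case disappears.\<close>
  have "(\<lambda>n. if real (k n) = 0 \<and> real n powr a = 0 then 1 else real (k n) / real n powr a) \<longlonglongrightarrow> 1"
    using assms(1) by (simp only: asymp_equiv_def)
  then have "(\<lambda>n. real (k n) / real n powr a) \<longlonglongrightarrow> 1"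
  proof (rule Lim_transform_eventually)
    show "\<forall>\<^sub>F n in sequentially. (if real (k n) = 0 \<and> real n powr a = 0 then 1 else real (k n) / real n powr a) = real (k n) / real n powr a"
      using eventually_gt_at_top[of 0] by eventually_elim simp
  qed
  then have "\<forall>\<^sub>F n in sequentially. real (k n) / real n powr a < 2"
    by (rule order_tendstoD) simp
  then show ?thesis
    using eventually_ge_at_top[of 1]
  proof eventually_elim
    case (elim n)
    have 1: "1 \<le> real n powr a" using elim(2) a by (intro ge_one_powr_ge_zero) auto
    then have "real (k n) \<le> 2 * real n powr a"
      using elim by (simp add: pos_divide_less_eq)
    then have "real (k n) * (real p + 2) \<le> 2 * real n powr a * (real p + 2)" by (intro mult_right_mono) auto
    then show ?case using 1 by (simp add: nparam_def algebra_simps)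
  qed
qed

lemma competitor_prior_cost_le:
  assumes pos: "\<eta> > 0" "\<zeta> > 0" and n: "n \<ge> 1"
  shows "(\<Sum>i\<le>K. \<bar>ln (prior_scale \<eta> \<zeta> i / (1 / real n ^ 3))\<bar> + (case_nat \<rho> \<theta> i)\<^sup>2 / (prior_scale \<eta> \<zeta> i)\<^sup>2
        + 1 / 2 + (1 / real n ^ 3)\<^sup>2 / (prior_scale \<eta> \<zeta> i)\<^sup>2)
    \<le> (real K + 1) * (\<bar>ln \<eta>\<bar> + \<bar>ln \<zeta>\<bar> + 1 / 2 + (1 / \<eta>\<^sup>2 + 1 / \<zeta>\<^sup>2) + 3 * ln (real n))
      + (1 / \<eta>\<^sup>2 + 1 / \<zeta>\<^sup>2) * (\<rho>\<^sup>2 + (\<Sum>i<K. (\<theta> i)\<^sup>2))"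
proof -
  let ?Q = "1 / \<eta>\<^sup>2 + 1 / \<zeta>\<^sup>2" and ?t = "prior_scale \<eta> \<zeta>"
  let ?L = "\<bar>ln \<eta>\<bar> + \<bar>ln \<zeta>\<bar> + 1 / 2 + ?Q + 3 * ln (real n)"
  have ln0: "ln (real n) \<ge> 0" using n by simp
  have Q: "1 / (?t i)\<^sup>2 \<le> ?Q" for i by (simp add: prior_scale_def)
  have "(\<Sum>i\<le>K. \<bar>ln (?t i / (1 / real n ^ 3))\<bar> + (case_nat \<rho> \<theta> i)\<^sup>2 / (?t i)\<^sup>2 + 1 / 2 + (1 / real n ^ 3)\<^sup>2 / (?t i)\<^sup>2)
    \<le> (\<Sum>i\<le>K. ?L + ?Q * (case_nat \<rho> \<theta> i)\<^sup>2)"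
  proof (rule sum_mono)
    fix i
    have t: "?t i > 0" using pos by (rule prior_scale_pos)
    have "ln (?t i / (1 / real n ^ 3)) = ln (?t i) + 3 * ln (real n)"
      using t n by (simp add: ln_mult ln_realpow)
    then have "\<bar>ln (?t i / (1 / real n ^ 3))\<bar> \<le> \<bar>ln \<eta>\<bar> + \<bar>ln \<zeta>\<bar> + 3 * ln (real n)"
      using ln0 by (auto simp: prior_scale_def)
    moreover have "(case_nat \<rho> \<theta> i)\<^sup>2 / (?t i)\<^sup>2 \<le> ?Q * (case_nat \<rho> \<theta> i)\<^sup>2"
      using mult_right_mono[OF Q[of i], of "(case_nat \<rho> \<theta> i)\<^sup>2"] by simp
    moreover have "(1 / real n ^ 3)\<^sup>2 / (?t i)\<^sup>2 \<le> ?Q"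
    proof -
      have "(1 / real n ^ 3)\<^sup>2 \<le> 1" using n by (simp add: power_le_one)
      then have "(1 / real n ^ 3)\<^sup>2 / (?t i)\<^sup>2 \<le> 1 / (?t i)\<^sup>2" by (rule divide_right_mono) simp
      then show ?thesis using Q[of i] by linarith
    qed
    ultimately show "\<bar>ln (?t i / (1 / real n ^ 3))\<bar> + (case_nat \<rho> \<theta> i)\<^sup>2 / (?t i)\<^sup>2 + 1 / 2 + (1 / real n ^ 3)\<^sup>2 / (?t i)\<^sup>2
      \<le> ?L + ?Q * (case_nat \<rho> \<theta> i)\<^sup>2" by linarith
  qed
  also have "\<dots> = (real K + 1) * ?L + ?Q * (\<Sum>i\<le>K. (case_nat \<rho> \<theta> i)\<^sup>2)"
    by (simp add: sum.distrib sum_distrib_left)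
  also have "(\<Sum>i\<le>K. (case_nat \<rho> \<theta> i)\<^sup>2) = \<rho>\<^sup>2 + (\<Sum>i<K. (\<theta> i)\<^sup>2)"
    by (simp add: sum.atMost_shift)
  finally show ?thesis .
qed

text \<open>There are four sources: n^a ln n is negligible as a < 1 - \<delta>; S is the sum in
  (A2); n r is (A1) multiplied by n; everything else is O(1), which is negligible because \<delta> <
  1.\<close>

lemma competitor_cost_smallo:
  fixes K :: "nat \<Rightarrow> nat" and r S :: "nat \<Rightarrow> real"
  assumes a: "0 < a" and \<delta>: "0 \<le> \<delta>" "\<delta> < 1 - a" and C: "C > 0" and \<sigma>: "\<sigma> > 0"
    and r: "r \<in> o(\<lambda>n. real n powr (- \<delta>))" and S: "S \<in> o(\<lambda>n. real n powr (1 - \<delta>))"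
  shows "(\<lambda>n. (C * real n powr a + 1) * (L + 3 * ln (real n)) + Q * (\<rho>\<^sup>2 + S n)
      + real n * (3 / 2 * (1 / real n ^ 3 * (1 + 2 * exp 8))
          + 2 * exp 2 * ((r n + 1 / real n) / 2 + 2 * r n / \<sigma>\<^sup>2
              + (1 + real n) * (C * real n * (1 + sqrt (real n)))\<^sup>2 / \<sigma>\<^sup>2 * (C * real n * (1 / real n ^ 3)\<^sup>2)))
      + 1 + 2 * (C * real n powr a + 1) * exp (- real n)) \<in> o(\<lambda>n. real n powr (1 - \<delta>))"
    (is "?f \<in> o(?g)")
proof -
  have d1: "0 < 1 - \<delta>" using a \<delta> by simp
  have nr: "(\<lambda>n. real n * r n) \<in> o(?g)"
  proof -
    have "(\<lambda>n. real n * r n) \<in> o(\<lambda>n. real n * real n powr (- \<delta>))"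
      by (rule landau_o.small.mult_left[OF r])
    also have "o(\<lambda>n. real n * real n powr (- \<delta>)) = o(?g)"
    proof (rule landau_o.small.cong)
      show "\<forall>\<^sub>F n in sequentially. real n * real n powr (- \<delta>) = real n powr (1 - \<delta>)"
        using eventually_gt_at_top[of 0]
        by eventually_elim (simp add: powr_diff powr_minus field_simps)
    qed
    finally show ?thesis .
  qed
  have 1: "(\<lambda>n. (C * real n powr a + 1) * (L + 3 * ln (real n))) \<in> o(?g)"
  proof -
    have "a < 1 - \<delta>" using \<delta> by simp
    then show ?thesis using a C d1 by real_asymp
  qed
  have const: "(\<lambda>_. c) \<in> o(?g)" for c :: real using d1 by real_asymp
  have 2: "(\<lambda>n. Q * (\<rho>\<^sup>2 + S n)) \<in> o(?g)"
    unfolding distrib_left by (intro sum_in_smallo const) (use S in simp)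
  have bd: "(\<lambda>n. real n * (3 / 2 * (1 / real n ^ 3 * (1 + 2 * exp 8)))) \<in> o(\<lambda>_. 1 :: real)"
    by real_asymp
  \<comment> \<open>This fixes the power in 1 / n^3: the factors n, 1 + n, (n sqrt n)^2 and n
    together grow like n^6, which the square of 1 / n^3 just cancels.\<close>
  have bd2: "(\<lambda>n. real n * (2 * exp 2 * ((1 + real n) * (C * real n * (1 + sqrt (real n)))\<^sup>2 / \<sigma>\<^sup>2 * (C * real n * (1 / real n ^ 3)\<^sup>2)))) \<in> O(\<lambda>_. 1 :: real)"
    using C \<sigma> by real_asymp
  have bd3: "(\<lambda>n. 2 * (C * real n powr a + 1) * exp (- real n)) \<in> O(\<lambda>_. 1 :: real)"
    using C a by real_asymp
  note o1 = landau_o.small_trans[OF bd const] landau_o.big_small_trans[OF bd2 const] landau_o.big_small_trans[OF bd3 const]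
  have "(\<lambda>n. exp 2 * (real n * r n) + exp 2 * (real n * (1 / real n)) + 4 * exp 2 / \<sigma>\<^sup>2 * (real n * r n)) \<in> o(?g)"
  proof (intro sum_in_smallo)
    have "(\<lambda>n. exp 2 * (real n * (1 / real n))) \<in> O(\<lambda>_. 1 :: real)" by real_asymp
    then show "(\<lambda>n. exp 2 * (real n * (1 / real n))) \<in> o(?g)" by (rule landau_o.big_small_trans[OF _ const])
    show "(\<lambda>n. 4 * exp 2 / \<sigma>\<^sup>2 * (real n * r n)) \<in> o(?g)"
      using \<sigma> nr by (subst landau_o.small.cmult_in_iff) auto
  qed (use nr in simp_all)
  from sum_in_smallo(1)[OF sum_in_smallo(1)[OF sum_in_smallo(1)[OF sum_in_smallo(1)[OF sum_in_smallo(1)[OF sum_in_smallo(1)[OF 1 2] o1(1)] this] o1(2)] const[of 1]] o1(3)]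
  moreover have "N * (A + 2 * e * ((R + q) / 2 + 2 * R / s + X)) = N * A + (e * (N * R) + e * (N * q) + 4 * e / s * (N * R)) + N * (2 * e * X)"
    for N A e R q s X :: real
    by (simp add: algebra_simps add_divide_distrib)
  ultimately show ?thesis by (simp only: add.assoc)
qed

lemma L2norm_nonneg: "0 \<le> L2norm p g"
  by (simp add: L2norm_def integral_nonneg_AE)

text \<open>The weight r + 1/n has two tasks: being at least r it gives r^2 / \<tau> \<le> r, so the
  cost is linear in r, and being at least 1/n it gives 1 / \<tau> \<le> n even where r
  vanishes.\<close>

lemma competitor_network_cost_le:
  fixes r K C \<sigma> :: real
  assumes n: "n \<ge> 1" and r: "0 \<le> r" "r \<le> 1" and K: "0 \<le> K" "K \<le> C * real n"
  defines "\<tau> \<equiv> r + 1 / real n"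
  shows "\<tau> / 2 + (1 + 1 / \<tau>) * r\<^sup>2 / \<sigma>\<^sup>2
      + (1 + 1 / \<tau>) * (K * (1 + sqrt (real n)))\<^sup>2 / \<sigma>\<^sup>2 * (K * (1 / real n ^ 3)\<^sup>2)
    \<le> (r + 1 / real n) / 2 + 2 * r / \<sigma>\<^sup>2
      + (1 + real n) * (C * real n * (1 + sqrt (real n)))\<^sup>2 / \<sigma>\<^sup>2 * (C * real n * (1 / real n ^ 3)\<^sup>2)"
proof -
  have \<tau>: "\<tau> > 0" "r \<le> \<tau>" "1 / real n \<le> \<tau>"
    using n r by (auto simp: \<tau>_def add_nonneg_pos)
  have inv: "1 / \<tau> \<le> real n" using \<tau> n by (simp add: field_simps)
  have "r\<^sup>2 / \<tau> \<le> r"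
    using mult_left_mono[OF \<tau>(2) r(1)] \<tau>(1) by (simp add: pos_divide_le_eq power2_eq_square)
  moreover have "r\<^sup>2 \<le> r" using mult_left_mono[OF r(2) r(1)] by (simp add: power2_eq_square)
  ultimately have "(1 + 1 / \<tau>) * r\<^sup>2 \<le> 2 * r" by (simp add: algebra_simps)
  then have 1: "(1 + 1 / \<tau>) * r\<^sup>2 / \<sigma>\<^sup>2 \<le> 2 * r / \<sigma>\<^sup>2" by (rule divide_right_mono) simp
  have C0: "0 \<le> C * real n" using K by linarith
  have "(1 + 1 / \<tau>) * (K * (1 + sqrt (real n)))\<^sup>2 / \<sigma>\<^sup>2 * (K * (1 / real n ^ 3)\<^sup>2)
    \<le> (1 + real n) * (C * real n * (1 + sqrt (real n)))\<^sup>2 / \<sigma>\<^sup>2 * (C * real n * (1 / real n ^ 3)\<^sup>2)"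
    using inv K C0 \<tau> by (intro mult_mono divide_right_mono power_mono add_left_mono) auto
  then show ?thesis using 1 by (simp add: \<tau>_def)
qed

section \<open>Choice of the free parameters and passage to the limit\<close>

theorem theorem4:
  fixes p :: nat and k :: "nat \<Rightarrow> nat" and f0 :: "(nat \<Rightarrow> real) \<Rightarrow> real"
    and \<sigma>0 \<eta> \<zeta> a \<delta> :: real
    and \<theta>0 :: "nat \<Rightarrow> nat \<Rightarrow> real"
    and mstar sstar :: "nat \<Rightarrow> (nat \<Rightarrow> real \<times> (nat \<Rightarrow> real)) \<Rightarrow> nat \<Rightarrow> real"
  assumes \<sigma>0_pos: "\<sigma>0 > 0" and \<eta>_pos: "\<eta> > 0" and \<zeta>_pos: "\<zeta> > 0"
    and f0_meas: "f0 \<in> borel_measurable (cube_unif p)"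
    and f0_sq: "integrable (cube_unif p) (\<lambda>x. (f0 x)\<^sup>2)"
    and a_range: "0 < a" "a < 1/2"
    and kn: "(\<lambda>n. real (k n)) \<sim>[at_top] (\<lambda>n. real n powr a)"
    and \<delta>_range: "0 \<le> \<delta>" "\<delta> < 1 - a"
    and A1: "(\<lambda>n. L2norm p (\<lambda>x. net p (k n) (\<theta>0 n) x - f0 x)) \<in> o(\<lambda>n. real n powr (- \<delta>))"
    and A2: "(\<lambda>n. \<Sum>i<nparam p (k n). (\<theta>0 n i)\<^sup>2) \<in> o(\<lambda>n. real n powr (1 - \<delta>))"
    and VB: "\<And>n. AE D in P0n p f0 \<sigma>0 n.
               vb_minimizer p (k n) \<eta> \<zeta> n D (mstar n D) (sstar n D)"
  shows "\<forall>\<epsilon>>0. small_o_P (P0n p f0 \<sigma>0)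
           (\<lambda>n D. measure (vmeasure p (k n) (mstar n D) (sstar n D))
                     {\<omega> \<in> space (param_space p (k n)). hellinger p (k n) f0 \<sigma>0 \<omega> \<ge> \<epsilon>})
           (\<lambda>n. real n powr (- \<delta>))"
  unfolding small_o_P_def
proof (intro allI impI)
  fix \<epsilon> c :: real
  assume \<epsilon>: "\<epsilon> > 0" and c: "c > 0"
  let ?X = "\<lambda>n. outer_prob (P0n p f0 \<sigma>0 n) {D \<in> space (P0n p f0 \<sigma>0 n).
      \<bar>measure (vmeasure p (k n) (mstar n D) (sstar n D))
        {\<omega> \<in> space (param_space p (k n)). hellinger p (k n) f0 \<sigma>0 \<omega> \<ge> \<epsilon>}\<bar> > c * real n powr (- \<delta>)}"
  define \<rho>0 where "\<rho>0 = ln (exp \<sigma>0 - 1)"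
  have \<rho>0: "softplus \<rho>0 = \<sigma>0" unfolding \<rho>0_def by (rule softplus_surj[OF \<sigma>0_pos])
  obtain \<kappa> where \<kappa>: "0 < \<kappa>" "\<kappa> \<le> 1" "exp (7 / 2 * \<kappa>) * (1 - \<epsilon> / 2 + 4 * sqrt \<kappa>) \<le> exp (- (\<epsilon> / 4))"
    by (rule bracket_width_exists[OF \<epsilon>])
  \<comment> \<open>t = c1 n has to stay below n \<epsilon>/4 for the sieve, and below n so that e^t
    times the prior tail e^(-2n) is at most e^(-n).\<close>
  define c1 where "c1 = min (\<epsilon> / 4) 1"
  have c1: "0 < c1" "c1 \<le> \<epsilon> / 4" "c1 \<le> 1" using \<epsilon> by (auto simp: c1_def)
  \<comment> \<open>With R = V sqrt n and u = sqrt n the Chernoff exponent u^2 (\<eta>^2 +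
    \<zeta>^2) / 2 - u R equals -2n exactly.\<close>
  define V where "V = 2 + (\<eta>\<^sup>2 + \<zeta>\<^sup>2) / 2"
  have V: "V \<ge> 2" by (simp add: V_def)
  define C where "C = 2 * real p + 5"
  have C: "C > 0" by (simp add: C_def)
  define K where "K = (\<lambda>n. nparam p (k n))"
  have K1: "K n \<ge> 1" for n by (simp add: K_def nparam_def)
  define r where "r = (\<lambda>n. L2norm p (\<lambda>x. net p (k n) (\<theta>0 n) x - f0 x))"
  define S where "S = (\<lambda>n. \<Sum>i<K n. (\<theta>0 n i)\<^sup>2)"
  define L where "L = \<bar>ln \<eta>\<bar> + \<bar>ln \<zeta>\<bar> + 1 / 2 + (1 / \<eta>\<^sup>2 + 1 / \<zeta>\<^sup>2)"
  define Q where "Q = 1 / \<eta>\<^sup>2 + 1 / \<zeta>\<^sup>2"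
  define f where "f = (\<lambda>n. (C * real n powr a + 1) * (L + 3 * ln (real n)) + Q * (\<rho>0\<^sup>2 + S n)
      + real n * (3 / 2 * (1 / real n ^ 3 * (1 + 2 * exp 8))
          + 2 * exp 2 * ((r n + 1 / real n) / 2 + 2 * r n / \<sigma>0\<^sup>2
              + (1 + real n) * (C * real n * (1 + sqrt (real n)))\<^sup>2 / \<sigma>0\<^sup>2 * (C * real n * (1 / real n ^ 3)\<^sup>2)))
      + 1 + 2 * (C * real n powr a + 1) * exp (- real n))"
  \<comment> \<open>The mesh solves the resolution condition of \<open>model_dens_le_bracket\<close>
    with equality at R = V sqrt n.\<close>
  define \<tau> where "\<tau> = (\<lambda>n. \<kappa> * exp (- (V * sqrt (real n) + 1)) / (2 * real (K n) * (V * sqrt (real n) + 2)))"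
  define b where "b = (\<lambda>n. (2 * (V * sqrt (real n)) / \<tau> n + 3) ^ (K n + 1) * exp (- (real n * \<epsilon> / 8)))"
  have r_o: "r \<in> o(\<lambda>n. real n powr (- \<delta>))" using A1 by (simp add: r_def)
  have S_o: "S \<in> o(\<lambda>n. real n powr (1 - \<delta>))" using A2 by (simp add: S_def K_def)
  have K_le: "\<forall>\<^sub>F n in sequentially. real (K n) \<le> C * real n powr a"
    unfolding K_def C_def by (rule nparam_eventually_le[OF kn]) (use a_range in simp)
  have f_o: "f \<in> o(\<lambda>n. real n powr (1 - \<delta>))"
    unfolding f_def by (rule competitor_cost_smallo[OF a_range(1) \<delta>_range C \<sigma>0_pos r_o S_o])
  have b_lim: "b \<longlonglongrightarrow> 0"
    unfolding b_def \<tau>_def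
    by (rule sieve_entropy_tendsto_0[OF a_range _ C \<kappa>(1) \<epsilon> K1 K_le]) (use V in simp)
  have d1: "0 < 1 - \<delta>" using a_range \<delta>_range by simp
  \<comment> \<open>The threshold c n^(-\<delta>) times t = c1 n is c c1 n^(1 - \<delta>), the very
    order against which f is negligible; subtracting 1 does not change it.\<close>
  have cost_lim: "(\<lambda>n. f n / (c * real n powr (- \<delta>) * (c1 * real n) - 1)) \<longlonglongrightarrow> 0"
  proof -
    have 1: "(\<lambda>n. f n / real n powr (1 - \<delta>)) \<longlonglongrightarrow> 0"
      using f_o by (rule smalloD_tendsto)
    have 2: "(\<lambda>n. c * c1 - real n powr (- (1 - \<delta>))) \<longlonglongrightarrow> c * c1 - 0"
      using d1 by (intro tendsto_diff tendsto_const) real_asymp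
    have "(\<lambda>n. (f n / real n powr (1 - \<delta>)) / (c * c1 - real n powr (- (1 - \<delta>)))) \<longlonglongrightarrow> 0 / (c * c1 - 0)"
      using c c1 by (intro tendsto_divide 1 2) simp
    then have "(\<lambda>n. (f n / real n powr (1 - \<delta>)) / (c * c1 - real n powr (- (1 - \<delta>)))) \<longlonglongrightarrow> 0"
      by simp
    then show ?thesis
    proof (rule Lim_transform_eventually)
      show "\<forall>\<^sub>F n in sequentially. (f n / real n powr (1 - \<delta>)) / (c * c1 - real n powr (- (1 - \<delta>)))
          = f n / (c * real n powr (- \<delta>) * (c1 * real n) - 1)"
        using eventually_gt_at_top[of 0]
      proof eventually_elim
        case (elim n)
        have "real n powr (1 - \<delta>) * (c * c1 - real n powr (- (1 - \<delta>))) = c * c1 * real n powr (1 - \<delta>) - 1"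
          using elim by (simp add: algebra_simps flip: powr_add)
        moreover have "c * c1 * real n powr (1 - \<delta>) = c * real n powr (- \<delta>) * (c1 * real n)"
          using elim by (simp add: powr_diff powr_minus field_simps)
        ultimately show ?case by (simp only: divide_divide_eq_left)
      qed
    qed
  qed
  have r_le: "\<forall>\<^sub>F n in sequentially. r n \<le> 1"
    using landau_o.smallD[OF r_o zero_less_one] eventually_ge_at_top[of 1]
  proof eventually_elim
    case (elim n)
    have "real n powr (- \<delta>) \<le> real n powr 0" using elim(2) \<delta>_range by (intro powr_mono) auto
    then show ?case using elim by simp
  qed
  have S_le: "\<forall>\<^sub>F n in sequentially. S n \<le> real n"
    using landau_o.smallD[OF S_o zero_less_one] eventually_ge_at_top[of 1]
  proof eventually_elim
    case (elim n)
    have "real n powr (1 - \<delta>) \<le> real n powr 1" using elim(2) \<delta>_range by (intro powr_mono) auto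
    then show ?case using elim by simp
  qed
  have ct: "\<forall>\<^sub>F n in sequentially. c * real n powr (- \<delta>) * (c1 * real n) > 1"
    using c c1(1) d1 by real_asymp
  have bound: "\<forall>\<^sub>F n in sequentially. ?X n \<le> b n + f n / (c * real n powr (- \<delta>) * (c1 * real n) - 1)"
    using K_le r_le S_le ct eventually_ge_at_top[of 1]
  proof eventually_elim
    case (elim n)
    let ?s = "1 / real n ^ 3" and ?R = "V * sqrt (real n)" and ?\<tau>b = "r n + 1 / real n"
    let ?m = "case_nat \<rho>0 (\<theta>0 n)" and ?t = "prior_scale \<eta> \<zeta>"
    have n: "real n \<ge> 1" using elim(5) by simp
    have K0: "real (K n) > 0" using K1[of n] by simp
    have KCn: "real (K n) \<le> C * real n"
    proof -
      have "real n powr a \<le> real n powr 1" using n a_range by (intro powr_mono) auto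
      then have "C * real n powr a \<le> C * real n" using C n by (intro mult_left_mono) auto
      then show ?thesis using elim(1) by linarith
    qed
    have r0: "0 \<le> r n" by (simp add: r_def L2norm_nonneg)
    \<comment> \<open>Each parameter is at most the Euclidean norm, and (A2) makes S \<le> n
      eventually: hence the bound sqrt n for the reference network.\<close>
    have B: "\<bar>\<theta>0 n i\<bar> \<le> sqrt (real n)" if "i < nparam p (k n)" for i
    proof (rule real_le_rsqrt)
      have "(\<theta>0 n i)\<^sup>2 \<le> S n" unfolding S_def K_def using that by (intro member_le_sum) auto
      then show "\<bar>\<theta>0 n i\<bar>\<^sup>2 \<le> real n" using elim(3) by simp
    qed
    define E1 where "E1 = (\<Sum>i\<le>K n. \<bar>ln (?t i / ?s)\<bar> + (?m i)\<^sup>2 / (?t i)\<^sup>2 + 1 / 2 + ?s\<^sup>2 / (?t i)\<^sup>2)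
      + real n * (3 / 2 * (?s * (1 + 2 * exp 8))
          + 2 * exp 2 * (?\<tau>b / 2 + (1 + 1 / ?\<tau>b) * (r n)\<^sup>2 / \<sigma>0\<^sup>2
              + (1 + 1 / ?\<tau>b) * (real (K n) * (1 + sqrt (real n)))\<^sup>2 / \<sigma>0\<^sup>2 * (real (K n) * ?s\<^sup>2)))"
    have \<tau>b: "?\<tau>b > 0" using r0 n by (simp add: add_nonneg_pos)
    have s: "0 < ?s" "?s \<le> 1" using n by (auto simp: one_le_power)
    have E1_nonneg: "E1 \<ge> 0"
      unfolding E1_def using s \<tau>b K0 r0 by (intro add_nonneg_nonneg mult_nonneg_nonneg sum_nonneg divide_nonneg_nonneg) auto
    have comp: "(\<integral>\<^sup>+D. \<integral>\<^sup>+\<omega>. ennreal (vdens p (k n) ?m (\<lambda>_. ?s) \<omega>)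
        * ennreal \<bar>ln (vdens p (k n) ?m (\<lambda>_. ?s) \<omega> / weight p (k n) f0 \<sigma>0 \<eta> \<zeta> n D \<omega>)\<bar> \<partial>param_space p (k n) \<partial>P0n p f0 \<sigma>0 n) \<le> ennreal E1"
      using nn_integral_P0n_competitor_le[OF f0_meas f0_sq \<eta>_pos \<zeta>_pos \<tau>b s, of "k n" "\<theta>0 n" "sqrt (real n)" \<rho>0 n] B
      unfolding \<rho>0 E1_def r_def K_def by blast
    have \<tau>_pos: "\<tau> n > 0" unfolding \<tau>_def using \<kappa> K0 V by (intro divide_pos_pos mult_pos_pos add_nonneg_pos) auto
    have \<tau>_eq: "real (K n) * (?R + 2) * \<tau> n = \<kappa> * exp (- (?R + 1)) / 2"
    proof -
      have "A * W * (X / (2 * A * W)) = X / 2" if "A > 0" "W > 0" for A W X :: real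
        using that by simp
      moreover have "?R + 2 > 0" using V by (intro add_nonneg_pos) auto
      ultimately show ?thesis unfolding \<tau>_def using K0 by blast
    qed
    have \<tau>_le: "\<tau> n \<le> \<kappa>"
    proof -
      have "1 * 1 \<le> real (K n) * (?R + 2)" using K1[of n] V by (intro mult_mono) auto
      then have "1 * \<tau> n \<le> real (K n) * (?R + 2) * \<tau> n" using \<tau>_pos by (intro mult_right_mono) auto
      also have "\<dots> \<le> \<kappa> * exp 0" unfolding \<tau>_eq
      proof -
        have "0 \<le> ?R" using V by (intro mult_nonneg_nonneg) auto
        then have "\<kappa> * exp (- (?R + 1)) \<le> \<kappa> * exp 0"
          using \<kappa> by (intro mult_left_mono) auto
        moreover have "0 \<le> \<kappa> * exp 0" using \<kappa> by simp
        ultimately show "\<kappa> * exp (- (?R + 1)) / 2 \<le> \<kappa> * exp 0"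
          by linarith
      qed
      finally show ?thesis by simp
    qed
    have "?X n \<le> b n + (E1 + 1 + exp (c1 * real n) * (real (K n + 1) * (2 * exp ((sqrt (real n))\<^sup>2 * (\<eta>\<^sup>2 + \<zeta>\<^sup>2) / 2 - sqrt (real n) * ?R))))
        / (c * real n powr (- \<delta>) * (c1 * real n) - 1)"
      unfolding b_def K_def
    proof (rule outer_prob_vmeasure_tail_le[OF f0_meas \<sigma>0_pos \<eta>_pos \<zeta>_pos _ comp E1_nonneg \<kappa>])
      show "0 \<le> ?R" using V by (intro mult_nonneg_nonneg) auto
      show "real (nparam p (k n)) * (?R + 2) * \<tau> n \<le> \<kappa> * exp (- (?R + 1)) / 2"
        using \<tau>_eq by (simp add: K_def)
      show "0 \<le> c1 * real n" using c1 by simp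
      show "c1 * real n \<le> real n * \<epsilon> / 4" using mult_right_mono[OF c1(2), of "real n"] by (simp add: mult.commute)
    qed (use s \<tau>_pos \<tau>_le elim(4) VB in simp_all)
    also have "\<dots> \<le> b n + f n / (c * real n powr (- \<delta>) * (c1 * real n) - 1)"
    proof (intro add_left_mono divide_right_mono)
      \<comment> \<open>The choices of V, u and c1 meet here: the exponent becomes c1 n - 2 n \<le>
        -n, which outweighs the K + 1 coordinates of the union bound.\<close>
      have "exp (c1 * real n) * (real (K n + 1) * (2 * exp ((sqrt (real n))\<^sup>2 * (\<eta>\<^sup>2 + \<zeta>\<^sup>2) / 2 - sqrt (real n) * ?R)))
        = 2 * (real (K n) + 1) * exp (c1 * real n - 2 * real n)"
      proof -
        have "(sqrt (real n))\<^sup>2 * (\<eta>\<^sup>2 + \<zeta>\<^sup>2) / 2 - sqrt (real n) * ?R = - (2 * real n)"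
        proof -
          have "sqrt (real n) * ?R = V * (sqrt (real n) * sqrt (real n))" by (rule mult.left_commute)
          then show ?thesis by (simp add: V_def algebra_simps add_divide_distrib)
        qed
        moreover have "exp X * (A * (2 * exp (- Y))) = 2 * A * exp (X - Y)" for X A Y :: real
          by (simp add: exp_diff exp_minus divide_inverse)
        ultimately show ?thesis by (simp only: of_nat_add of_nat_1)
      qed
      also have "\<dots> \<le> 2 * (C * real n powr a + 1) * exp (- real n)"
      proof (intro mult_mono)
        have "c1 * real n \<le> 1 * real n" using c1 by (intro mult_right_mono) auto
        then show "exp (c1 * real n - 2 * real n) \<le> exp (- real n)" by simp
      qed (use elim(1) C in auto)
      finally have tail: "exp (c1 * real n) * (real (K n + 1) * (2 * exp ((sqrt (real n))\<^sup>2 * (\<eta>\<^sup>2 + \<zeta>\<^sup>2) / 2 - sqrt (real n) * ?R)))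
        \<le> 2 * (C * real n powr a + 1) * exp (- real n)" .
      have "(\<Sum>i\<le>K n. \<bar>ln (?t i / ?s)\<bar> + (?m i)\<^sup>2 / (?t i)\<^sup>2 + 1 / 2 + ?s\<^sup>2 / (?t i)\<^sup>2)
        \<le> (real (K n) + 1) * (L + 3 * ln (real n)) + Q * (\<rho>0\<^sup>2 + S n)"
        unfolding L_def Q_def S_def by (rule competitor_prior_cost_le[OF \<eta>_pos \<zeta>_pos elim(5)])
      also have "\<dots> \<le> (C * real n powr a + 1) * (L + 3 * ln (real n)) + Q * (\<rho>0\<^sup>2 + S n)"
        using elim(1) n by (intro add_right_mono mult_right_mono) (auto simp: L_def)
      finally have prior: "(\<Sum>i\<le>K n. \<bar>ln (?t i / ?s)\<bar> + (?m i)\<^sup>2 / (?t i)\<^sup>2 + 1 / 2 + ?s\<^sup>2 / (?t i)\<^sup>2)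
        \<le> (C * real n powr a + 1) * (L + 3 * ln (real n)) + Q * (\<rho>0\<^sup>2 + S n)" .
      have "E1 \<le> (C * real n powr a + 1) * (L + 3 * ln (real n)) + Q * (\<rho>0\<^sup>2 + S n)
        + real n * (3 / 2 * (?s * (1 + 2 * exp 8))
          + 2 * exp 2 * ((r n + 1 / real n) / 2 + 2 * r n / \<sigma>0\<^sup>2
              + (1 + real n) * (C * real n * (1 + sqrt (real n)))\<^sup>2 / \<sigma>0\<^sup>2 * (C * real n * ?s\<^sup>2)))"
        unfolding E1_def
        by (intro add_mono prior mult_left_mono competitor_network_cost_le elim(5,2) r0 KCn) auto
      then show "E1 + 1 + exp (c1 * real n) * (real (K n + 1) * (2 * exp ((sqrt (real n))\<^sup>2 * (\<eta>\<^sup>2 + \<zeta>\<^sup>2) / 2 - sqrt (real n) * ?R))) \<le> f n"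
        unfolding f_def using tail by linarith
    qed (use elim(4) in simp)
    finally show ?case .
  qed
  show "?X \<longlonglongrightarrow> 0"
  proof (rule tendsto_sandwich[OF _ bound tendsto_const])
    show "\<forall>\<^sub>F n in sequentially. 0 \<le> ?X n"
      by (intro always_eventually allI outer_prob_nonneg) auto
    show "(\<lambda>n. b n + f n / (c * real n powr (- \<delta>) * (c1 * real n) - 1)) \<longlonglongrightarrow> 0"
      using tendsto_add[OF b_lim cost_lim] by simp
  qed
qed

end
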